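(* Let $(\Omega,\mathcal F,\mathbb P)$ be a probability space equipped with the canonical filtration of a Brownian motion $W$, and let $x_0\ge0$. There is a process $BES^1(x_0)$ solving the strong martingale problem with respect to $\mathcal D_{L^1}(\mathbb R_+)$ and $W$. Moreover, the strong martingale problem admits pathwise uniqueness with respect to $\mathcal D_{L^1}(\mathbb R_+)$: if $X^1,X^2$ are ($\mathbb R_+$-valued) solutions with respect to $\mathcal D_{L^1}(\mathbb R_+)$ and the same Brownian motion $W$ with $\mathbb P[X_0^1=X_0^2]=1$, then $X^1$ and $X^2$ are indistinguishable.
   Context: Processes are indexed by $t\in[0,T]$, $T>0$ fixed; $\mathbb R_+=[0,\infty)$. $\mathcal D_{L^1}=\{f\in C^2(\mathbb R): f'(0)=0\}$ and $L^1f=\frac{f''}2$. $\mathcal D_{L^1}(\mathbb R_+)$ is the set of restrictions to $\mathbb R_+$ of functions $\hat f\in\mathcal D_{L^1}$, and for such a restriction $f$, $L^1f$ is the restriction of $L^1\hat f$ to $\mathbb R_+$. $BESQ^1(s_0)$, $s_0\ge0$, is the pathwise unique (non-negative) solution of $dS_t=2\sqrt{|S_t|}\,dW_t+dt$, $S_0=s_0$, with $W$ a Brownian motion; a non-negative process $X$ is a $BES^1(x_0)$ if $X^2$ is a $BESQ^1(x_0^2)$. Strong martingale problem with respect to $\mathcal D_{L^1}(\mathbb R_+)$ and $W$: a continuous $\mathbb R_+$-valued process $X$ with $X_0=x_0$, adapted to the canonical filtration of $W$ (satisfying the usual conditions), is a solution if $f(X_t)-f(x_0)-\int_0^tL^1f(X_s)ds=\int_0^tf'(X_s)dW_s$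 for all $f\in\mathcal D_{L^1}(\mathbb R_+)$ and all $t\in[0,T]$. *)

theory Defs
  imports "HOL-Probability.Probability"
begin

text \<open>
  Processes are functions \<open>X :: real \<Rightarrow> 'a \<Rightarrow> real\<close> on the space of a probability measure \<open>M\<close>; only
  the times in \<open>[0, T]\<close> matter.  \<open>M\<close> need not be complete: the usual conditions are imposed by
  working in \<open>completion M\<close>, and \<open>AE \<omega> in M\<close> is the same as \<open>AE \<omega> in completion M\<close>.
\<close>

section \<open>Filtrations and Brownian motion\<close>

definition natural_filtration :: "'a set \<Rightarrow> (real \<Rightarrow> 'a \<Rightarrow> real) \<Rightarrow> real \<Rightarrow> 'a measure" where
  "natural_filtration \<Omega> W t = sigma \<Omega> {W u -` B \<inter> \<Omega> |u B. u \<in> {0..t} \<and> B \<in> sets borel}"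

definition augmented_filtration :: "'a measure \<Rightarrow> (real \<Rightarrow> 'a \<Rightarrow> real) \<Rightarrow> real \<Rightarrow> 'a measure" where
  "augmented_filtration M W t =
     sigma (space M) (sets (natural_filtration (space M) W t) \<union> null_sets (completion M))"

text \<open>
  The canonical filtration of \<open>W\<close>: the natural filtration, augmented by the null sets and made
  right-continuous.  \<open>W\<close> lives on \<open>[0, T]\<close> only, so the filtration is frozen after \<open>T\<close>.
\<close>

definition canonical_filtration ::
    "'a measure \<Rightarrow> real \<Rightarrow> (real \<Rightarrow> 'a \<Rightarrow> real) \<Rightarrow> real \<Rightarrow> 'a measure" where
  "canonical_filtration M T W t =
     sigma (space M) (\<Inter>s\<in>{t<..}. sets (augmented_filtration M W (min s T)))"

definition continuous_paths :: "'a measure \<Rightarrow> real \<Rightarrow> (real \<Rightarrow> 'a \<Rightarrow> real) \<Rightarrow> bool" where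
  "continuous_paths M T X \<longleftrightarrow> (\<forall>\<omega>\<in>space M. continuous_on {0..T} (\<lambda>t. X t \<omega>))"

definition adapted_process :: "(real \<Rightarrow> 'a measure) \<Rightarrow> real \<Rightarrow> (real \<Rightarrow> 'a \<Rightarrow> real) \<Rightarrow> bool" where
  "adapted_process F T X \<longleftrightarrow> (\<forall>t\<in>{0..T}. X t \<in> borel_measurable (F t))"

definition progressively_measurable ::
    "(real \<Rightarrow> 'a measure) \<Rightarrow> real \<Rightarrow> (real \<Rightarrow> 'a \<Rightarrow> real) \<Rightarrow> bool" where
  "progressively_measurable F T H \<longleftrightarrow>
     (\<forall>t\<in>{0..T}. (\<lambda>(s, \<omega>). H s \<omega>) \<in> borel_measurable (restrict_space borel {0..t} \<Otimes>\<^sub>M F t))"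

definition nonneg_process :: "'a measure \<Rightarrow> real \<Rightarrow> (real \<Rightarrow> 'a \<Rightarrow> real) \<Rightarrow> bool" where
  "nonneg_process M T X \<longleftrightarrow> (\<forall>t\<in>{0..T}. \<forall>\<omega>\<in>space M. 0 \<le> X t \<omega>)"

definition indistinguishable ::
    "'a measure \<Rightarrow> real \<Rightarrow> (real \<Rightarrow> 'a \<Rightarrow> real) \<Rightarrow> (real \<Rightarrow> 'a \<Rightarrow> real) \<Rightarrow> bool" where
  "indistinguishable M T X Y \<longleftrightarrow> (AE \<omega> in M. \<forall>t\<in>{0..T}. X t \<omega> = Y t \<omega>)"

definition brownian_motion :: "'a measure \<Rightarrow> real \<Rightarrow> (real \<Rightarrow> 'a \<Rightarrow> real) \<Rightarrow> bool" where
  "brownian_motion M T W \<longleftrightarrow>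
     prob_space M \<and>
     (\<forall>t\<in>{0..T}. W t \<in> borel_measurable M) \<and>
     continuous_paths M T W \<and>
     (AE \<omega> in M. W 0 \<omega> = 0) \<and>
     (\<forall>s t. 0 \<le> s \<and> s < t \<and> t \<le> T \<longrightarrow>
        distributed M lborel (\<lambda>\<omega>. W t \<omega> - W s \<omega>) (normal_density 0 (sqrt (t - s))) \<and>
        prob_space.indep_set M
          (sets (natural_filtration (space M) W s))
          {(\<lambda>\<omega>. W t \<omega> - W s \<omega>) -` B \<inter> space M |B. B \<in> sets borel})"


section \<open>The Ito integral\<close>

text \<open>
  The simple process \<open>\<Sum>i<n. \<xi>\<^sub>i 1\<^bsub>(\<tau>\<^sub>i, \<tau>\<^sub>i\<^sub>+\<^sub>1]\<^esub>\<close> with deterministic times \<open>\<tau>\<^sub>i\<close> and bounded,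
  \<open>F \<tau>\<^sub>i\<close>-measurable coefficients \<open>\<xi>\<^sub>i\<close>, and its elementary stochastic integral over \<open>[0, t]\<close>.
\<close>

definition simple_process_data ::
    "'a measure \<Rightarrow> (real \<Rightarrow> 'a measure) \<Rightarrow> real \<Rightarrow> nat \<Rightarrow> (nat \<Rightarrow> real) \<Rightarrow> (nat \<Rightarrow> 'a \<Rightarrow> real) \<Rightarrow> bool" where
  "simple_process_data M F T n \<tau> \<xi> \<longleftrightarrow>
     (\<forall>i\<le>n. \<tau> i \<in> {0..T}) \<and>
     (\<forall>i<n. \<tau> i \<le> \<tau> (Suc i)) \<and>
     (\<forall>i<n. \<xi> i \<in> borel_measurable (F (\<tau> i))) \<and>
     (\<exists>C. \<forall>i<n. \<forall>\<omega>\<in>space M. \<bar>\<xi> i \<omega>\<bar> \<le> C)"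

definition simple_process ::
    "nat \<Rightarrow> (nat \<Rightarrow> real) \<Rightarrow> (nat \<Rightarrow> 'a \<Rightarrow> real) \<Rightarrow> real \<Rightarrow> 'a \<Rightarrow> real" where
  "simple_process n \<tau> \<xi> s \<omega> = (\<Sum>i<n. \<xi> i \<omega> * indicator {\<tau> i<..\<tau> (Suc i)} s)"

definition simple_integral ::
    "(real \<Rightarrow> 'a \<Rightarrow> real) \<Rightarrow> nat \<Rightarrow> (nat \<Rightarrow> real) \<Rightarrow> (nat \<Rightarrow> 'a \<Rightarrow> real) \<Rightarrow> real \<Rightarrow> 'a \<Rightarrow> real" where
  "simple_integral W n \<tau> \<xi> t \<omega> =
     (\<Sum>i<n. \<xi> i \<omega> * (W (min (\<tau> (Suc i)) t) \<omega> - W (min (\<tau> i) t) \<omega>))"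

text \<open>
  \<open>ito_integral M F T W H I\<close>: the process \<open>I\<close> is (a version of) \<open>t \<mapsto> \<integral>\<^sub>0\<^sup>t H\<^sub>s dW\<^sub>s\<close>, i.e. the continuous
  adapted process obtained as limit in probability of integrals of simple processes \<open>H\<^sup>k\<close> with
  \<open>\<integral>\<^sub>0\<^sup>T \<bar>H\<^sup>k\<^sub>s - H\<^sub>s\<bar>\<^sup>2 ds \<rightarrow> 0\<close> in probability.  Since simple processes are bounded, such a sequence
  can only exist if \<open>\<integral>\<^sub>0\<^sup>T H\<^sub>s\<^sup>2 ds < \<infinity>\<close> almost surely.  Limits at fixed times determine \<open>I\<close> up to
  indistinguishability because its paths are continuous, so an equation between processes
  \<open>Y\<^sub>t = \<integral>\<^sub>0\<^sup>t H\<^sub>s dW\<^sub>s\<close> for all \<open>t \<in> [0, T]\<close> is expressed by \<open>ito_integral M F T W H Y\<close>.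
\<close>

definition ito_integral ::
    "'a measure \<Rightarrow> (real \<Rightarrow> 'a measure) \<Rightarrow> real \<Rightarrow> (real \<Rightarrow> 'a \<Rightarrow> real)
      \<Rightarrow> (real \<Rightarrow> 'a \<Rightarrow> real) \<Rightarrow> (real \<Rightarrow> 'a \<Rightarrow> real) \<Rightarrow> bool" where
  "ito_integral M F T W H I \<longleftrightarrow>
     progressively_measurable F T H \<and>
     adapted_process F T I \<and>
     (AE \<omega> in M. continuous_on {0..T} (\<lambda>t. I t \<omega>)) \<and>
     (\<exists>n \<tau> \<xi>.
        (\<forall>k. simple_process_data M F T (n k) (\<tau> k) (\<xi> k)) \<and>
        (\<forall>\<epsilon>>0. (\<lambda>k. measure (completion M) {\<omega>\<in>space M.
             ennreal \<epsilon> < (\<integral>\<^sup>+s\<in>{0..T}.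
               ennreal ((simple_process (n k) (\<tau> k) (\<xi> k) s \<omega> - H s \<omega>)\<^sup>2) \<partial>lborel)})
           \<longlonglongrightarrow> 0) \<and>
        (\<forall>t\<in>{0..T}. \<forall>\<epsilon>>0. (\<lambda>k. measure (completion M) {\<omega>\<in>space M.
             \<epsilon> < \<bar>simple_integral W (n k) (\<tau> k) (\<xi> k) t \<omega> - I t \<omega>\<bar>})
           \<longlonglongrightarrow> 0))"


section \<open>The generator\<close>

definition D_L1 :: "(real \<Rightarrow> real) set" where
  "D_L1 = {f. (\<forall>x. f differentiable (at x)) \<and> (\<forall>x. deriv f differentiable (at x)) \<and>
              continuous_on UNIV (deriv (deriv f)) \<and> deriv f 0 = 0}"

definition L1 :: "(real \<Rightarrow> real) \<Rightarrow> real \<Rightarrow> real" where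
  "L1 f = (\<lambda>x. deriv (deriv f) x / 2)"

definition D_L1_Rplus :: "(real \<Rightarrow> real) set" where
  "D_L1_Rplus = (\<lambda>g. restrict g {0..}) ` D_L1"

text \<open>The value does not depend on the extension chosen, see \<open>L1_Rplus_restrict\<close> below.\<close>

definition L1_Rplus :: "(real \<Rightarrow> real) \<Rightarrow> real \<Rightarrow> real" where
  "L1_Rplus f = restrict (L1 (SOME g. g \<in> D_L1 \<and> restrict g {0..} = f)) {0..}"

text \<open>The derivative on \<open>[0, \<infinity>)\<close>, one-sided at \<open>0\<close>.\<close>

definition deriv_Rplus :: "(real \<Rightarrow> real) \<Rightarrow> real \<Rightarrow> real" where
  "deriv_Rplus f x = vector_derivative f (at x within {0..})"

lemma at_within_Rplus_neq_bot:
  fixes x :: real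
  assumes "0 \<le> x"
  shows "at x within {0..} \<noteq> bot"
proof -
  have "at x within {x..x + 1} \<noteq> bot"
    by (simp add: trivial_limit_within islimpt_Icc)
  moreover have "at x within {x..x + 1} \<le> at x within {0..}"
    using assms by (intro at_le) auto
  ultimately show ?thesis
    by (metis bot.extremum_uniqueI)
qed

lemma vector_derivative_within_Rplus:
  fixes g f :: "real \<Rightarrow> real"
  assumes "g differentiable (at x)" and "0 \<le> x" and "\<And>y. 0 \<le> y \<Longrightarrow> f y = g y"
  shows "vector_derivative f (at x within {0..}) = deriv g x"
proof (rule vector_derivative_within[OF at_within_Rplus_neq_bot[OF \<open>0 \<le> x\<close>]])
  have "(g has_vector_derivative deriv g x) (at x within {0..})"
    using assms(1) by (metis DERIV_deriv_iff_real_differentiable has_real_derivative_iff_has_vector_derivative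
        has_vector_derivative_at_within)
  then show "(f has_vector_derivative deriv g x) (at x within {0..})"
    by (rule has_vector_derivative_transform[rotated 2]) (use assms in auto)
qed

lemma deriv_Rplus_restrict:
  assumes "g \<in> D_L1" and "0 \<le> x"
  shows "deriv_Rplus (restrict g {0..}) x = deriv g x"
  unfolding deriv_Rplus_def using assms
  by (intro vector_derivative_within_Rplus) (auto simp: D_L1_def)

lemma L1_Rplus_restrict:
  assumes g: "g \<in> D_L1" and x: "0 \<le> x"
  shows "L1_Rplus (restrict g {0..}) x = L1 g x"
proof -
  define h where "h = (SOME h. h \<in> D_L1 \<and> restrict h {0..} = restrict g {0..})"
  have h: "h \<in> D_L1" "restrict h {0..} = restrict g {0..}"
    using someI[of "\<lambda>h. h \<in> D_L1 \<and> restrict h {0..} = restrict g {0..}" g] g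
    by (auto simp: h_def)
  have 1: "deriv h y = deriv g y" if "0 \<le> y" for y
    using deriv_Rplus_restrict[OF g that] deriv_Rplus_restrict[OF h(1) that] h(2) by simp
  have "deriv (deriv h) x = vector_derivative (deriv h) (at x within {0..})"
    using h(1) x by (intro vector_derivative_within_Rplus[symmetric]) (auto simp: D_L1_def)
  also have "\<dots> = deriv (deriv g) x"
    using g x 1 by (intro vector_derivative_within_Rplus) (auto simp: D_L1_def)
  finally show ?thesis
    using x by (simp add: L1_Rplus_def h_def[symmetric] L1_def)
qed


section \<open>Bessel processes and the strong martingale problem\<close>

text \<open>
  \<open>S\<close> is the \<open>BESQ\<^sup>1(s0)\<close> driven by the Brownian motion \<open>W\<close>: the non-negative strong solution of
  \<open>dS\<^sub>t = 2 \<surd>\<bar>S\<^sub>t\<bar> dW\<^sub>t + dt\<close>, \<open>S\<^sub>0 = s0\<close>.  Writing out the drift, \<open>S\<^sub>t - s0 - t = \<integral>\<^sub>0\<^sup>t 2 \<surd>\<bar>S\<^sub>u\<bar> dW\<^sub>u\<close>.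
\<close>

definition is_BESQ1 ::
    "'a measure \<Rightarrow> real \<Rightarrow> (real \<Rightarrow> 'a \<Rightarrow> real) \<Rightarrow> real \<Rightarrow> (real \<Rightarrow> 'a \<Rightarrow> real) \<Rightarrow> bool" where
  "is_BESQ1 M T W s0 S \<longleftrightarrow>
     brownian_motion M T W \<and> 0 \<le> s0 \<and>
     continuous_paths M T S \<and> nonneg_process M T S \<and>
     adapted_process (canonical_filtration M T W) T S \<and>
     (AE \<omega> in M. S 0 \<omega> = s0) \<and>
     ito_integral M (canonical_filtration M T W) T W
       (\<lambda>t \<omega>. 2 * sqrt \<bar>S t \<omega>\<bar>) (\<lambda>t \<omega>. S t \<omega> - s0 - t)"

definition is_BES1 ::
    "'a measure \<Rightarrow> real \<Rightarrow> (real \<Rightarrow> 'a \<Rightarrow> real) \<Rightarrow> real \<Rightarrow> (real \<Rightarrow> 'a \<Rightarrow> real) \<Rightarrow> bool" where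
  "is_BES1 M T W x0 X \<longleftrightarrow>
     nonneg_process M T X \<and> is_BESQ1 M T W (x0\<^sup>2) (\<lambda>t \<omega>. (X t \<omega>)\<^sup>2)"

definition strong_MP_solution ::
    "'a measure \<Rightarrow> real \<Rightarrow> (real \<Rightarrow> 'a \<Rightarrow> real) \<Rightarrow> real \<Rightarrow> (real \<Rightarrow> 'a \<Rightarrow> real) \<Rightarrow> bool" where
  "strong_MP_solution M T W x0 X \<longleftrightarrow>
     continuous_paths M T X \<and> nonneg_process M T X \<and>
     adapted_process (canonical_filtration M T W) T X \<and>
     (AE \<omega> in M. X 0 \<omega> = x0) \<and>
     (\<forall>f\<in>D_L1_Rplus.
        ito_integral M (canonical_filtration M T W) T W
          (\<lambda>t \<omega>. deriv_Rplus f (X t \<omega>))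
          (\<lambda>t \<omega>. f (X t \<omega>) - f x0 - (LINT s:{0..t}|lborel. L1_Rplus f (X s \<omega>))))"

end

theory Submission
  imports Defs
begin

text \<open>
  The solution is Skorokhod's reflection \<open>X = x0 + W + L\<close> with \<open>L\<^sub>t = sup\<^sub>s\<^sub>\<le>\<^sub>t (x0 + W\<^sub>s)\<^sup>-\<close>: in Ito's formula for
  \<open>f(X)\<close> the term \<open>\<integral> f'(X) dL\<close> drops out, since \<open>L\<close> increases only at zeros of \<open>X\<close> and \<open>f'(0) = 0\<close>; the
  function \<open>f(x) = x\<^sup>2\<close> shows that \<open>X\<^sup>2\<close> is a squared Bessel process.  Conversely, testing an arbitrary solution
  \<open>X\<close> with \<open>f\<^sub>\<epsilon>(x) = \<surd>(x\<^sup>2 + \<epsilon>\<^sup>2) - \<epsilon>\<close> and letting \<open>\<epsilon> \<rightarrow> 0\<close> shows that \<open>X - W\<close> is almost surely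
  nondecreasing and constant on the intervals where \<open>X > 0\<close>; two nonnegative processes with this property and the
  same initial value coincide.
\<close>

section \<open>Skorokhod reflection\<close>

text \<open>The identity function is not admissible, since its derivative at 0 is 1; this is why the
  uniqueness proof works with \<open>sabs e\<close>. All that \<open>ito_integral\<close> offers is
  convergence in probability at fixed times, so an unknown stochastic integral is accessed through a
  single estimate, \<open>ito_integral_bound\<close>, which compares it with a constant multiple of
  the Brownian increment. Two multiples suffice: 0 gives a crude bound on the drift, and 1 then
  identifies the limit of the martingale part. For existence, the definition asks for one sequence
  of simple processes that serves all times t at once; hence the grids are fixed on [0, T], cut off
  at t, and refined fast enough to give almost sure limits. Both halves rest on second moments, and
  these on the independence of Brownian increments from the augmented, right-continuous
  filtration.\<close>

definition running_sup :: "(real \<Rightarrow> real) \<Rightarrow> real \<Rightarrow> real" where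
  "running_sup g t = Sup (g ` {0..t})"

context
  fixes g :: "real \<Rightarrow> real" and T :: real
  assumes cont: "continuous_on {0..T} g"
begin

lemma running_sup_attained:
  assumes "0 \<le> t" "t \<le> T"
  shows "\<exists>u\<in>{0..t}. running_sup g t = g u \<and> (\<forall>v\<in>{0..t}. g v \<le> g u)"
proof -
  have "continuous_on {0..t} g"
    by (rule continuous_on_subset[OF cont]) (use assms in auto)
  then obtain u where u: "u \<in> {0..t}" "\<forall>v\<in>{0..t}. g v \<le> g u"
    using continuous_attains_sup[of "{0..t}" g] assms by auto
  then have "running_sup g t = g u"
    unfolding running_sup_def by (intro cSup_eq_maximum) auto
  with u show ?thesis by auto
qed

lemma running_sup_upper:
  assumes "0 \<le> u" "u \<le> t" "t \<le> T"
  shows "g u \<le> running_sup g t"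
  using running_sup_attained[of t] assms by auto

lemma running_sup_mono:
  assumes "0 \<le> a" "a \<le> b" "b \<le> T"
  shows "running_sup g a \<le> running_sup g b"
proof -
  obtain u where "u \<in> {0..a}" "running_sup g a = g u"
    using running_sup_attained[of a] assms by auto
  then show ?thesis using running_sup_upper[of u b] assms by auto
qed

text \<open>Once the supremum has grown after \<open>a\<close>, a maximiser over [0, b] cannot lie
  before \<open>a\<close>, and at a maximiser the supremum touches \<open>g\<close>. This is why a
  regulator can grow only at zeros of the reflected path.\<close>

lemma running_sup_increase:
  assumes "0 \<le> a" "a \<le> b" "b \<le> T" "running_sup g a < running_sup g b"
  shows "\<exists>u\<in>{a..b}. running_sup g u = g u \<and> running_sup g b = g u"
proof -
  obtain u where u: "u \<in> {0..b}" "running_sup g b = g u"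
    using running_sup_attained[of b] assms by auto
  have "a \<le> u"
    using running_sup_upper[of u a] assms u by force
  moreover have "running_sup g u = g u"
    using running_sup_upper[of u u] running_sup_mono[of u b] u assms by auto
  ultimately show ?thesis using u by auto
qed

text \<open>An increase over [a, b] is at most \<open>g u - g a\<close> for some u in [a, b], so the
  supremum inherits the modulus of uniform continuity of \<open>g\<close>.\<close>

lemma continuous_on_running_sup: "continuous_on {0..T} (running_sup g)"
proof (rule uniformly_continuous_imp_continuous, unfold uniformly_continuous_on_def, intro allI impI)
  fix e :: real assume "0 < e"
  have "uniformly_continuous_on {0..T} g"
    by (rule compact_uniformly_continuous[OF cont]) simp
  then obtain d where d: "0 < d" "\<And>u v. u \<in> {0..T} \<Longrightarrow> v \<in> {0..T} \<Longrightarrow> dist u v < d \<Longrightarrow> dist (g u) (g v) < e"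
    unfolding uniformly_continuous_on_def using \<open>0 < e\<close> by metis
  have *: "running_sup g b - running_sup g a < e" if ab: "0 \<le> a" "a \<le> b" "b \<le> T" "b - a < d" for a b
  proof (cases "running_sup g a < running_sup g b")
    case True
    then obtain u where u: "u \<in> {a..b}" "running_sup g b = g u"
      using running_sup_increase[OF ab(1-3)] by auto
    have "dist (g u) (g a) < e"
      by (rule d(2)) (use u ab in \<open>auto simp: dist_real_def\<close>)
    then show ?thesis
      using running_sup_upper[of a a] ab u by (auto simp: dist_real_def)
  qed (use \<open>0 < e\<close> in auto)
  have "dist (running_sup g v) (running_sup g u) < e" if "u \<in> {0..T}" "v \<in> {0..T}" "dist v u < d" for u v
    using *[of u v] *[of v u] running_sup_mono[of u v] running_sup_mono[of v u] that
    by (cases "u \<le> v") (auto simp: dist_real_def)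
  then show "\<exists>d>0. \<forall>u\<in>{0..T}. \<forall>v\<in>{0..T}. dist v u < d \<longrightarrow> dist (running_sup g v) (running_sup g u) < e"
    using d(1) by blast
qed

end

text \<open>Skorokhod's map: \<open>reg w\<close> is the least nondecreasing \<open>l \<ge> 0\<close> with \<open>c + w + l \<ge> 0\<close>.\<close>

definition reg :: "real \<Rightarrow> (real \<Rightarrow> real) \<Rightarrow> real \<Rightarrow> real" where
  "reg c w = running_sup (\<lambda>u. max 0 (- (c + w u)))"

context
  fixes w :: "real \<Rightarrow> real" and T c :: real
  assumes w: "continuous_on {0..T} w"
begin

lemma cont_reg_aux: "continuous_on {0..T} (\<lambda>u. max 0 (- (c + w u)))"
  using w by (intro continuous_intros)

lemma continuous_on_reg: "continuous_on {0..T} (reg c w)"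
  unfolding reg_def by (rule continuous_on_running_sup[OF cont_reg_aux])

lemma reg_mono: "0 \<le> a \<Longrightarrow> a \<le> b \<Longrightarrow> b \<le> T \<Longrightarrow> reg c w a \<le> reg c w b"
  unfolding reg_def by (rule running_sup_mono[OF cont_reg_aux])

lemma reflected_nonneg: "0 \<le> t \<Longrightarrow> t \<le> T \<Longrightarrow> 0 \<le> c + w t + reg c w t"
  using running_sup_upper[OF cont_reg_aux, of t t] unfolding reg_def by auto

text \<open>At the point u where the new supremum is attained, its value exceeds
  \<open>reg c w a\<close>, which is at least 0. So the maximum with 0 is attained by its second
  argument, and \<open>reg c w u = - (c + w u)\<close>.\<close>

lemma reg_flat_off_zeros:
  assumes "0 \<le> a" "a \<le> b" "b \<le> T" "reg c w a < reg c w b"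
  shows "\<exists>u\<in>{a..b}. c + w u + reg c w u = 0"
proof -
  let ?g = "\<lambda>u. max 0 (- (c + w u))"
  obtain u where u: "u \<in> {a..b}" "reg c w u = ?g u" "reg c w b = ?g u"
    using running_sup_increase[OF cont_reg_aux] assms unfolding reg_def by metis
  have "0 \<le> reg c w a"
    using running_sup_upper[OF cont_reg_aux, of a a] assms unfolding reg_def by auto
  with assms(4) u have "0 < ?g u" by linarith
  with u show ?thesis by (intro bexI[of _ u]) auto
qed

end

section \<open>The pathwise Ito formula\<close>

lemma abs_mult_le: "\<bar>a\<bar> \<le> b \<Longrightarrow> \<bar>c\<bar> \<le> d \<Longrightarrow> \<bar>a * c\<bar> \<le> b * (d::real)"
  by (simp add: abs_mult mult_mono)

lemma abs_add4_le:
  "\<bar>a\<bar> \<le> A \<Longrightarrow> \<bar>b\<bar> \<le> B \<Longrightarrow> \<bar>c\<bar> \<le> C \<Longrightarrow> \<bar>d\<bar> \<le> D \<Longrightarrow> \<bar>a + b + c + d\<bar> \<le> A + B + C + (D::real)"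
  by linarith

text \<open>Second-order Taylor expansion over one interval of a partition. The error has the factor
  \<open>e\<close> in front of quantities whose sums over a partition stay bounded: the increments
  of \<open>l\<close> and the lengths telescope, and the squared increments of \<open>w\<close> sum
  to the quadratic variation.\<close>

lemma ito_step:
  fixes f f' f'' w l x :: "real \<Rightarrow> real"
  assumes ab: "a \<le> b"
    and f: "\<And>y. (f has_real_derivative f' y) (at y)" "\<And>y. (f' has_real_derivative f'' y) (at y)"
    and f'': "continuous_on UNIV f''" and f'0: "f' 0 = 0"
    and x: "continuous_on {a..b} x"
    and dx: "x b - x a = (w b - w a) + (l b - l a)"
    and l: "l a \<le> l b" "l a < l b \<Longrightarrow> \<exists>u\<in>{a..b}. x u = 0"
    and osc: "\<And>u. u \<in> {a..b} \<Longrightarrow> \<bar>f' (x u) - f' (x a)\<bar> \<le> e" "\<And>u. u \<in> {a..b} \<Longrightarrow> \<bar>f'' (x u) - f'' (x a)\<bar> \<le> e"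
      "\<bar>w b - w a\<bar> \<le> e" "l b - l a \<le> e"
    and B: "\<bar>f'' (x a)\<bar> \<le> B"
  shows "\<bar>f (x b) - f (x a) - f' (x a) * (w b - w a)
           - f'' (x a) / 2 * ((w b - w a)\<^sup>2 - (b - a)) - integral {a..b} (\<lambda>s. f'' (x s) / 2)\<bar>
         \<le> e * ((1 + e + 3 / 2 * B) * (l b - l a) + (w b - w a)\<^sup>2 + (b - a) / 2)" (is "\<bar>?r\<bar> \<le> _")
proof -
  define dw dl where "dw = w b - w a" and "dl = l b - l a"
  have e: "0 \<le> e" using osc(3) by linarith
  have dl: "0 \<le> dl" "dl \<le> e" "\<bar>dw\<bar> \<le> e" using l(1) osc(3,4) by (simp_all add: dl_def dw_def)
  have cf: "continuous_on {a..b} (\<lambda>s. f'' (x s) / 2)"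
    by (intro continuous_intros continuous_on_compose2[OF f'' x]) auto
  \<comment> \<open>If \<open>l\<close> moves, then \<open>x\<close> vanishes somewhere in the
    interval; there \<open>f'\<close> is 0, so the oscillation bound makes \<open>f' (x a)\<close>
    itself small.\<close>
  have 1: "\<bar>f' (x a) * dl\<bar> \<le> e * dl"
  proof (cases "l a < l b")
    case True
    then obtain u where "u \<in> {a..b}" "x u = 0" using l by auto
    then have "\<bar>f' (x a)\<bar> \<le> e" using osc(1)[of u] f'0 by simp
    then show ?thesis using dl by (intro abs_mult_le) auto
  next
    case False then show ?thesis using l by (simp add: dl_def)
  qed
  \<comment> \<open>The intermediate point of Taylor's theorem lies between \<open>x a\<close> and
    \<open>x b\<close>, hence is a value of \<open>x\<close> on the interval, and the oscillation
    bound for \<open>f''\<close> along the path applies to it.\<close>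
  obtain \<zeta> where \<zeta>: "f (x b) - f (x a) = f' (x a) * (x b - x a) + f'' \<zeta> / 2 * (x b - x a)\<^sup>2"
    "\<bar>f'' \<zeta> - f'' (x a)\<bar> \<le> e"
  proof (cases "x a = x b")
    case True
    then show ?thesis using that[of "x a"] e by simp
  next
    case False
    define d where "d = (\<lambda>m::nat. case m of 0 \<Rightarrow> f | Suc 0 \<Rightarrow> f' | _ \<Rightarrow> f'')"
    have "\<exists>t. (if x b < x a then x b < t \<and> t < x a else x a < t \<and> t < x b) \<and>
      f (x b) = (\<Sum>m<2. (d m (x a) / fact m) * (x b - x a)^m) + (d 2 t / fact 2) * (x b - x a)^2"
      by (rule Taylor[of 2 d f "min (x a) (x b)" "max (x a) (x b)"])
         (use f False in \<open>auto simp: d_def numeral_2_eq_2 less_Suc_eq\<close>)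
    then obtain t where t: "min (x a) (x b) < t" "t < max (x a) (x b)"
      "f (x b) = f (x a) + f' (x a) * (x b - x a) + f'' t / 2 * (x b - x a)^2"
      by (auto simp: d_def numeral_2_eq_2 split: if_splits)
    have "\<exists>u. a \<le> u \<and> u \<le> b \<and> x u = t"
    proof (cases "x a \<le> x b")
      case True
      then show ?thesis using t by (intro IVT' ab x) auto
    next
      case False
      then show ?thesis using t by (intro IVT2' ab x) auto
    qed
    then have "\<bar>f'' t - f'' (x a)\<bar> \<le> e" using osc(2) by auto
    with t show ?thesis using that[of t] by auto
  qed
  have 4: "\<bar>f'' (x a) / 2 * (b - a) - integral {a..b} (\<lambda>s. f'' (x s) / 2)\<bar> \<le> e / 2 * (b - a)"
  proof -
    have "integral {a..b} (\<lambda>s. f'' (x a) / 2 - f'' (x s) / 2) = f'' (x a) / 2 * (b - a) - integral {a..b} (\<lambda>s. f'' (x s) / 2)"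
      using ab integrable_continuous_real[OF cf] by (subst integral_diff) auto
    moreover have "norm (integral {a..b} (\<lambda>s. f'' (x a) / 2 - f'' (x s) / 2)) \<le> e / 2 * (b - a)"
    proof (rule integral_bound[OF ab])
      show "continuous_on {a..b} (\<lambda>s. f'' (x a) / 2 - f'' (x s) / 2)"
        by (intro continuous_intros cf)
      show "norm (f'' (x a) / 2 - f'' (x s) / 2) \<le> e / 2" if "s \<in> {a..b}" for s
        using osc(2)[OF that] unfolding real_norm_def by linarith
    qed
    ultimately show ?thesis by simp
  qed
  \<comment> \<open>The bound comes from (dw + dl)^2 \<le> 2 dw^2 + 2 dl^2 and dl^2 \<le> e dl: the
    square of the regulator increment is traded for a multiple of the increment itself, which can be
    summed.\<close>
  have 2: "\<bar>(f'' \<zeta> - f'' (x a)) / 2 * (dw + dl)\<^sup>2\<bar> \<le> e / 2 * (2 * dw\<^sup>2 + 2 * e * dl)"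
  proof (rule abs_mult_le)
    have "dl\<^sup>2 \<le> e * dl" using dl by (simp add: power2_eq_square mult_right_mono)
    moreover have "0 \<le> (dw - dl)\<^sup>2" by simp
    ultimately have "(dw + dl)\<^sup>2 \<le> 2 * dw\<^sup>2 + 2 * e * dl" by (simp add: power2_sum power2_diff)
    then show "\<bar>(dw + dl)\<^sup>2\<bar> \<le> 2 * dw\<^sup>2 + 2 * e * dl" by simp
  qed (use \<zeta> in auto)
  have 3: "\<bar>f'' (x a) / 2 * (2 * dw * dl + dl\<^sup>2)\<bar> \<le> B / 2 * (3 * e * dl)"
  proof (rule abs_mult_le)
    have "\<bar>(2 * dw + dl) * dl\<bar> \<le> 3 * e * dl"
      using dl by (intro abs_mult_le) auto
    then show "\<bar>2 * dw * dl + dl\<^sup>2\<bar> \<le> 3 * e * dl" by (simp add: power2_eq_square algebra_simps)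
  qed (use B in auto)
  have "f (x b) - f (x a) = f' (x a) * (dw + dl) + f'' \<zeta> / 2 * (dw + dl)\<^sup>2"
    using \<zeta>(1) unfolding dx dw_def dl_def .
  \<comment> \<open>Four errors: the regulator in the first-order term, the displacement of the
    Taylor point, the part of (dw + dl)^2 other than dw^2, and the Riemann sum of the time
    integral.\<close>
  then have "?r = f' (x a) * dl + (f'' \<zeta> - f'' (x a)) / 2 * (dw + dl)\<^sup>2 + f'' (x a) / 2 * (2 * dw * dl + dl\<^sup>2)
     + (f'' (x a) / 2 * (b - a) - integral {a..b} (\<lambda>s. f'' (x s) / 2))"
    unfolding dw_def[symmetric] by (simp add: power2_eq_square algebra_simps add_divide_distrib diff_divide_distrib)
  then have "\<bar>?r\<bar> \<le> e * dl + e / 2 * (2 * dw\<^sup>2 + 2 * e * dl) + B / 2 * (3 * e * dl) + e / 2 * (b - a)"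
    using abs_add4_le[OF 1 2 3 4] by (simp only:)
  also have "\<dots> = e * ((1 + e + 3 / 2 * B) * dl + dw\<^sup>2 + (b - a) / 2)"
    by (simp add: algebra_simps)
  finally show ?thesis unfolding dw_def dl_def .
qed

lemma integral_sum_partition:
  fixes \<sigma> :: "nat \<Rightarrow> real" and h :: "real \<Rightarrow> real"
  assumes "\<And>i. i < n \<Longrightarrow> \<sigma> i \<le> \<sigma> (Suc i)" "continuous_on {\<sigma> 0..\<sigma> n} h"
  shows "\<sigma> 0 \<le> \<sigma> n \<and> (\<Sum>i<n. integral {\<sigma> i..\<sigma> (Suc i)} h) = integral {\<sigma> 0..\<sigma> n} h"
  using assms
proof (induction n)
  case (Suc n)
  have le: "\<sigma> n \<le> \<sigma> (Suc n)" using Suc.prems by auto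
  have "continuous_on {\<sigma> 0..\<sigma> n} h" by (rule continuous_on_subset[OF Suc.prems(2)]) (use le in auto)
  moreover have "\<And>i. i < n \<Longrightarrow> \<sigma> i \<le> \<sigma> (Suc i)" using Suc.prems(1) by simp
  ultimately have IH: "\<sigma> 0 \<le> \<sigma> n" "(\<Sum>i<n. integral {\<sigma> i..\<sigma> (Suc i)} h) = integral {\<sigma> 0..\<sigma> n} h"
    using Suc.IH by blast+
  have "integral {\<sigma> 0..\<sigma> n} h + integral {\<sigma> n..\<sigma> (Suc n)} h = integral {\<sigma> 0..\<sigma> (Suc n)} h"
    using IH(1) le by (rule Henstock_Kurzweil_Integration.integral_combine[OF _ _ integrable_continuous_real[OF Suc.prems(2)]])
  then show ?case using IH le by auto
qed auto

lemma partition_bounds: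
  fixes \<sigma> :: "nat \<Rightarrow> real"
  assumes "\<And>i. i < n \<Longrightarrow> \<sigma> i \<le> \<sigma> (Suc i)" "i \<le> j" "j \<le> n"
  shows "\<sigma> i \<le> \<sigma> j"
  using assms(2,3)
proof (induction j)
  case (Suc j) then show ?case using assms(1)[of j] by (cases "i = Suc j") auto
qed auto

text \<open>The hypotheses \<open>V\<close> and \<open>Q\<close> on the quadratic variation hold almost surely along Brownian paths.  The
  regulator \<open>l\<close> contributes nothing to the limit because it moves only at zeros of \<open>x\<close>, where \<open>f'\<close> vanishes.\<close>

lemma pathwise_ito:
  fixes f f' f'' w l x :: "real \<Rightarrow> real" and \<sigma> :: "nat \<Rightarrow> nat \<Rightarrow> real" and N :: "nat \<Rightarrow> nat"
  assumes f: "\<And>y. (f has_real_derivative f' y) (at y)" "\<And>y. (f' has_real_derivative f'' y) (at y)"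
    and f'': "continuous_on UNIV f''" and f'0: "f' 0 = 0"
    and w: "continuous_on {0..t} w" and l: "continuous_on {0..t} l"
    and x: "\<And>s. s \<in> {0..t} \<Longrightarrow> x s = c + w s + l s"
    and mono: "\<And>a b. 0 \<le> a \<Longrightarrow> a \<le> b \<Longrightarrow> b \<le> t \<Longrightarrow> l a \<le> l b"
    and flat: "\<And>a b. 0 \<le> a \<Longrightarrow> a \<le> b \<Longrightarrow> b \<le> t \<Longrightarrow> l a < l b \<Longrightarrow> \<exists>u\<in>{a..b}. x u = 0"
    and \<sigma>0: "\<And>k. \<sigma> k 0 = 0" and \<sigma>N: "\<And>k. \<sigma> k (N k) = t"
    and \<sigma>: "\<And>k i. i < N k \<Longrightarrow> \<sigma> k i \<le> \<sigma> k (Suc i)"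
    and mesh: "\<And>d. d > 0 \<Longrightarrow> \<forall>\<^sub>F k in sequentially. \<forall>i<N k. \<sigma> k (Suc i) - \<sigma> k i < d"
    and V: "\<And>k. (\<Sum>i<N k. (w (\<sigma> k (Suc i)) - w (\<sigma> k i))\<^sup>2) \<le> V"
    and Q: "(\<lambda>k. \<Sum>i<N k. f'' (x (\<sigma> k i)) / 2 * ((w (\<sigma> k (Suc i)) - w (\<sigma> k i))\<^sup>2 - (\<sigma> k (Suc i) - \<sigma> k i))) \<longlonglongrightarrow> 0"
  shows "(\<lambda>k. \<Sum>i<N k. f' (x (\<sigma> k i)) * (w (\<sigma> k (Suc i)) - w (\<sigma> k i)))
           \<longlonglongrightarrow> f (x t) - f (x 0) - integral {0..t} (\<lambda>s. f'' (x s) / 2)"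
proof -
  have t: "0 \<le> t" using integral_sum_partition[of "N 0" "\<sigma> 0" "\<lambda>_. 0"] \<sigma> \<sigma>0 \<sigma>N by auto
  have cx: "continuous_on {0..t} x"
    using continuous_on_cong[OF refl x, of "{0..t}"] w l by (auto intro!: continuous_intros)
  have cf': "continuous_on UNIV f'" by (meson DERIV_isCont continuous_at_imp_continuous_on f(2))
  have c1: "continuous_on {0..t} (\<lambda>u. f' (x u))" and c2: "continuous_on {0..t} (\<lambda>u. f'' (x u))"
    by (auto intro!: continuous_on_compose2[OF cf' cx] continuous_on_compose2[OF f'' cx])
  have "bounded ((\<lambda>u. f'' (x u)) ` {0..t})"
    by (intro compact_imp_bounded compact_continuous_image c2) auto
  then obtain B where B': "\<forall>y\<in>(\<lambda>u. f'' (x u)) ` {0..t}. norm y \<le> B" unfolding bounded_iff ..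
  have B: "\<bar>f'' (x u)\<bar> \<le> B" if "u \<in> {0..t}" for u using B' that by auto
  have B0: "0 \<le> B" using B[of 0] t by auto
  have V0: "0 \<le> V" by (rule order_trans[OF _ V[of 0]]) (simp add: sum_nonneg)
  define I where "I = integral {0..t} (\<lambda>s. f'' (x s) / 2)"
  define S where "S k = (\<Sum>i<N k. f' (x (\<sigma> k i)) * (w (\<sigma> k (Suc i)) - w (\<sigma> k i)))" for k
  define q where "q k = (\<Sum>i<N k. f'' (x (\<sigma> k i)) / 2 * ((w (\<sigma> k (Suc i)) - w (\<sigma> k i))\<^sup>2 - (\<sigma> k (Suc i) - \<sigma> k i)))" for k
  \<comment> \<open>Bounds the sum over a partition of the brackets in \<open>ito_step\<close> as
    long as e \<le> 1. The final 1 makes \<open>C\<close> positive, so that r / (2 C) is a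
    legitimate choice of \<open>e\<close>.\<close>
  define C where "C = (2 + 3 / 2 * B) * (l t - l 0) + V + t / 2 + 1"
  have l0: "0 \<le> l t - l 0" using mono[of 0 t] t by simp
  then have "0 \<le> (2 + 3 / 2 * B) * (l t - l 0)" using B0 by simp
  then have C: "0 < C" using V0 t unfolding C_def by linarith
  have "(\<lambda>k. f (x t) - f (x 0) - I - S k - q k) \<longlonglongrightarrow> 0"
  proof (rule LIMSEQ_I)
    fix r :: real assume r: "0 < r"
    define e where "e = min 1 (r / (2 * C))"
    have e: "0 < e" "e \<le> 1" "e * C < r" 
    proof -
      show "0 < e" "e \<le> 1" using r C by (auto simp: e_def)
      have "e * C \<le> r / (2 * C) * C" using C by (intro mult_right_mono) (auto simp: e_def)
      also have "\<dots> = r / 2" using C by simp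
      finally show "e * C < r" using r by linarith
    qed
    have uc: "\<exists>d>0. \<forall>u\<in>{0..t}. \<forall>v\<in>{0..t}. dist v u < d \<longrightarrow> dist (h v) (h u) < e"
      if "continuous_on {0..t} h" for h :: "real \<Rightarrow> real"
      using compact_uniformly_continuous[OF that] e unfolding uniformly_continuous_on_def by auto
    obtain d1 where d1: "d1 > 0" "\<And>u v. u\<in>{0..t} \<Longrightarrow> v\<in>{0..t} \<Longrightarrow> dist v u < d1 \<Longrightarrow> dist (f' (x v)) (f' (x u)) < e"
      using uc[OF c1] by metis
    obtain d2 where d2: "d2 > 0" "\<And>u v. u\<in>{0..t} \<Longrightarrow> v\<in>{0..t} \<Longrightarrow> dist v u < d2 \<Longrightarrow> dist (f'' (x v)) (f'' (x u)) < e"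
      using uc[OF c2] by metis
    obtain d3 where d3: "d3 > 0" "\<And>u v. u\<in>{0..t} \<Longrightarrow> v\<in>{0..t} \<Longrightarrow> dist v u < d3 \<Longrightarrow> dist (w v) (w u) < e"
      using uc[OF w] by metis
    obtain d4 where d4: "d4 > 0" "\<And>u v. u\<in>{0..t} \<Longrightarrow> v\<in>{0..t} \<Longrightarrow> dist v u < d4 \<Longrightarrow> dist (l v) (l u) < e"
      using uc[OF l] by metis
    define d where "d = Min {d1, d2, d3, d4}"
    have d: "0 < d" "d \<le> d1" "d \<le> d2" "d \<le> d3" "d \<le> d4" using d1(1) d2(1) d3(1) d4(1) by (auto simp: d_def)
    have "norm (f (x t) - f (x 0) - I - S k - q k - 0) < r" if k: "\<forall>i<N k. \<sigma> k (Suc i) - \<sigma> k i < d" for k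
    proof -
      define D where "D i = f (x (\<sigma> k (Suc i))) - f (x (\<sigma> k i)) - f' (x (\<sigma> k i)) * (w (\<sigma> k (Suc i)) - w (\<sigma> k i))
           - f'' (x (\<sigma> k i)) / 2 * ((w (\<sigma> k (Suc i)) - w (\<sigma> k i))\<^sup>2 - (\<sigma> k (Suc i) - \<sigma> k i))
           - integral {\<sigma> k i..\<sigma> k (Suc i)} (\<lambda>s. f'' (x s) / 2)" for i
      have "\<bar>D i\<bar> \<le> e * ((1 + e + 3 / 2 * B) * (l (\<sigma> k (Suc i)) - l (\<sigma> k i)) + (w (\<sigma> k (Suc i)) - w (\<sigma> k i))\<^sup>2 + (\<sigma> k (Suc i) - \<sigma> k i) / 2)"
        if i: "i < N k" for i
      proof -
        have s: "0 \<le> \<sigma> k i" "\<sigma> k i \<le> \<sigma> k (Suc i)" "\<sigma> k (Suc i) \<le> t"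
          using partition_bounds[of "N k" "\<sigma> k" 0 i] partition_bounds[of "N k" "\<sigma> k" "Suc i" "N k"] \<sigma> i \<sigma>0 \<sigma>N
          by (auto simp: Suc_le_eq)
        have sub: "{\<sigma> k i..\<sigma> k (Suc i)} \<subseteq> {0..t}" using s by auto
        have near: "dist u (\<sigma> k i) < d" if "u \<in> {\<sigma> k i..\<sigma> k (Suc i)}" for u
          using that k i by (auto simp: dist_real_def)
        have mem: "\<sigma> k i \<in> {0..t}" "\<sigma> k (Suc i) \<in> {0..t}" "\<sigma> k (Suc i) \<in> {\<sigma> k i..\<sigma> k (Suc i)}" using s by auto
        show ?thesis unfolding D_def
        proof (rule ito_step[OF s(2) f f'' f'0 continuous_on_subset[OF cx sub]])
          show "x (\<sigma> k (Suc i)) - x (\<sigma> k i) = w (\<sigma> k (Suc i)) - w (\<sigma> k i) + (l (\<sigma> k (Suc i)) - l (\<sigma> k i))"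
            using x mem by auto
          show "l (\<sigma> k i) \<le> l (\<sigma> k (Suc i))" using mono s by auto
          show "\<exists>u\<in>{\<sigma> k i..\<sigma> k (Suc i)}. x u = 0" if "l (\<sigma> k i) < l (\<sigma> k (Suc i))"
            by (rule flat) (use s that in auto)
          show "\<bar>f' (x u) - f' (x (\<sigma> k i))\<bar> \<le> e" if "u \<in> {\<sigma> k i..\<sigma> k (Suc i)}" for u
            using d1(2)[OF mem(1), of u] near[OF that] sub that d by (auto simp: dist_real_def)
          show "\<bar>f'' (x u) - f'' (x (\<sigma> k i))\<bar> \<le> e" if "u \<in> {\<sigma> k i..\<sigma> k (Suc i)}" for u
            using d2(2)[OF mem(1), of u] near[OF that] sub that d by (auto simp: dist_real_def)
          show "\<bar>w (\<sigma> k (Suc i)) - w (\<sigma> k i)\<bar> \<le> e"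
            using d3(2)[OF mem(1) mem(2)] near[OF mem(3)] d by (auto simp: dist_real_def)
          show "l (\<sigma> k (Suc i)) - l (\<sigma> k i) \<le> e"
            using d4(2)[OF mem(1) mem(2)] near[OF mem(3)] d by (auto simp: dist_real_def)
        qed (use B mem in auto)
      qed
      then have "\<bar>\<Sum>i<N k. D i\<bar> \<le> (\<Sum>i<N k. e * ((1 + e + 3 / 2 * B) * (l (\<sigma> k (Suc i)) - l (\<sigma> k i)) + (w (\<sigma> k (Suc i)) - w (\<sigma> k i))\<^sup>2 + (\<sigma> k (Suc i) - \<sigma> k i) / 2))"
        by (intro order_trans[OF sum_abs] sum_mono) auto
      also have "\<dots> = e * ((1 + e + 3 / 2 * B) * (l t - l 0) + (\<Sum>i<N k. (w (\<sigma> k (Suc i)) - w (\<sigma> k i))\<^sup>2) + t / 2)"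
        unfolding sum_distrib_left[symmetric] sum.distrib
        using sum_lessThan_telescope[of "\<lambda>i. l (\<sigma> k i)" "N k"] sum_lessThan_telescope[of "\<sigma> k" "N k"] \<sigma>0 \<sigma>N
        by (simp add: sum_divide_distrib[symmetric])
      also have "\<dots> \<le> e * C"
      proof (intro mult_left_mono)
        have "(1 + e + 3 / 2 * B) * (l t - l 0) \<le> (2 + 3 / 2 * B) * (l t - l 0)"
          using e l0 by (intro mult_right_mono) auto
        then show "(1 + e + 3 / 2 * B) * (l t - l 0) + (\<Sum>i<N k. (w (\<sigma> k (Suc i)) - w (\<sigma> k i))\<^sup>2) + t / 2 \<le> C"
          using V[of k] unfolding C_def by linarith
      qed (use e in auto)
      also have "\<dots> < r" using e by simp
      finally have *: "\<bar>\<Sum>i<N k. D i\<bar> < r" .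
      have "continuous_on {\<sigma> k 0..\<sigma> k (N k)} (\<lambda>s. f'' (x s) / 2)" using c2 \<sigma>0 \<sigma>N by (auto intro!: continuous_intros)
      from integral_sum_partition[OF \<sigma> this] have "(\<Sum>i<N k. integral {\<sigma> k i..\<sigma> k (Suc i)} (\<lambda>s. f'' (x s) / 2)) = I"
        unfolding I_def using \<sigma>0 \<sigma>N by auto
      then have "(\<Sum>i<N k. D i) = f (x t) - f (x 0) - I - S k - q k"
        unfolding D_def sum_subtractf S_def q_def
        using sum_lessThan_telescope[of "\<lambda>i. f (x (\<sigma> k i))" "N k"] \<sigma>0 \<sigma>N by (simp add: sum_subtractf)
      with * show ?thesis by simp
    qed
    with mesh[OF d(1)] show "\<exists>no. \<forall>n\<ge>no. norm (f (x t) - f (x 0) - I - S n - q n - 0) < r"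
      unfolding eventually_sequentially by blast
  qed
  moreover have "q \<longlonglongrightarrow> 0" using Q by (simp add: q_def[abs_def])
  ultimately have "(\<lambda>k. (f (x t) - f (x 0) - I) - (f (x t) - f (x 0) - I - S k - q k) - q k) \<longlonglongrightarrow> (f (x t) - f (x 0) - I) - 0 - 0"
    by (intro tendsto_diff tendsto_const)
  then show ?thesis unfolding S_def[symmetric] I_def[symmetric] by simp
qed

text \<open>Suppose x1 exceeds x2 at t, and let s be the last earlier time at which they agree.
  After s, x1 > x2 \<ge> 0, so x1 - w cannot increase while x2 - w cannot decrease; the difference
  therefore does not increase after s, although it starts from 0 and becomes positive. Monotonicity
  and flatness are asked at rational times only, because for random paths they hold almost surely
  for countably many pairs of times.\<close>

lemma skorokhod_le:
  fixes x1 x2 w :: "real \<Rightarrow> real"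
  assumes c: "continuous_on {0..T} x1" "continuous_on {0..T} x2"
    and 0: "x1 0 = x2 0" and nonneg: "\<And>t. t \<in> {0..T} \<Longrightarrow> 0 \<le> x2 t"
    and mono: "\<And>a b. a \<in> \<rat> \<Longrightarrow> b \<in> \<rat> \<Longrightarrow> 0 \<le> a \<Longrightarrow> a \<le> b \<Longrightarrow> b \<le> T \<Longrightarrow> x2 a - w a \<le> x2 b - w b"
    and flat: "\<And>a b. a \<in> \<rat> \<Longrightarrow> b \<in> \<rat> \<Longrightarrow> 0 \<le> a \<Longrightarrow> a \<le> b \<Longrightarrow> b \<le> T \<Longrightarrow> (\<forall>u\<in>{a..b}. 0 < x1 u) \<Longrightarrow> x1 b - w b \<le> x1 a - w a"
    and t: "t \<in> {0..T}"
  shows "x1 t \<le> x2 t"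
proof (rule ccontr)
  assume "\<not> x1 t \<le> x2 t"
  define D where "D u = x1 u - x2 u" for u
  have Dt: "0 < D t" using \<open>\<not> x1 t \<le> x2 t\<close> by (simp add: D_def)
  have cD: "continuous_on {0..T} D" unfolding D_def by (intro continuous_intros c)
  define Z where "Z = {u \<in> {0..t}. D u = 0}"
  have cDt: "continuous_on {0..t} D" by (rule continuous_on_subset[OF cD]) (use t in auto)
  have "closed Z" unfolding Z_def by (intro continuous_closed_preimage_constant cDt) auto
  moreover have "bounded Z" by (rule bounded_subset[of "{0..t}"]) (auto simp: Z_def)
  ultimately have "compact Z" by (simp add: compact_eq_bounded_closed)
  moreover have "0 \<in> Z" using t 0 by (auto simp: Z_def D_def)
  ultimately obtain s where s: "s \<in> Z" "\<And>u. u \<in> Z \<Longrightarrow> u \<le> s"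
    using compact_attains_sup[of Z] by auto
  have s': "0 \<le> s" "s < t" "D s = 0" using s(1) Dt by (auto simp: Z_def less_le)
  have pos: "0 < D u" if u: "s < u" "u \<le> t" for u
  proof (rule ccontr)
    assume "\<not> 0 < D u"
    moreover have "continuous_on {u..t} D" by (rule continuous_on_subset[OF cDt]) (use u s' in auto)
    ultimately obtain v where "u \<le> v" "v \<le> t" "D v = 0"
      using IVT'[of D u 0 t] Dt u by force
    then show False using s(2)[of v] u s' by (auto simp: Z_def)
  qed
  \<comment> \<open>The contradiction needs two rational times s < a < b < t with D a < D b. First
    \<open>b\<close> is fixed, then \<open>a\<close> is taken so close to s that continuity and D s
    = 0 force the inequality.\<close>
  obtain b where b: "b \<in> \<rat>" "s < b" "b < t" using Rats_dense_in_real[OF s'(2)] by auto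
  have "0 < D b" using pos b by auto
  moreover have "continuous_on {s..b} D" by (rule continuous_on_subset[OF cDt]) (use s' b in auto)
  moreover have "(D \<longlongrightarrow> D s) (at s within {s..b})"
    using calculation(2) b by (auto simp: continuous_on)
  then have "(D \<longlongrightarrow> D s) (at_right s)" using b(2) by (simp add: at_within_Icc_at_right)
  then have "\<forall>\<^sub>F u in at_right s. D u < D b"
    by (rule order_tendstoD(2)) (use s'(3) \<open>0 < D b\<close> in auto)
  then obtain d where d: "s < d" "\<And>u. s < u \<Longrightarrow> u < d \<Longrightarrow> D u < D b"
    unfolding eventually_at_right[OF b(2)] by blast
  obtain a where a: "a \<in> \<rat>" "s < a" "a < min d b" using Rats_dense_in_real[of s "min d b"] d b by auto
  have "\<forall>u\<in>{a..b}. 0 < x1 u"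
  proof
    fix u assume "u \<in> {a..b}"
    then have "0 < D u" "0 \<le> x2 u" using pos[of u] nonneg[of u] a b s' t by auto
    then show "0 < x1 u" by (simp add: D_def)
  qed
  then have "x1 b - w b \<le> x1 a - w a" by (intro flat) (use a b s' t in auto)
  moreover have "x2 a - w a \<le> x2 b - w b" by (rule mono) (use a b s' t in auto)
  ultimately have "D b \<le> D a" by (simp add: D_def)
  with d(2)[of a] a show False by auto
qed

section \<open>Brownian increments and the canonical filtration\<close>

locale brownian =
  fixes M :: "'a measure" and T :: real and W :: "real \<Rightarrow> 'a \<Rightarrow> real"
  assumes BM: "brownian_motion M T W" and T_pos: "0 < T"
begin

abbreviation "N \<equiv> completion M"
abbreviation "F \<equiv> canonical_filtration M T W"
abbreviation "G t \<equiv> natural_filtration (space M) W t"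
abbreviation "A t \<equiv> augmented_filtration M W t"

sublocale M: prob_space M using BM by (simp add: brownian_motion_def)
sublocale N: prob_space N by (rule M.prob_space_completion)

lemma W_measurable_M: "t \<in> {0..T} \<Longrightarrow> W t \<in> borel_measurable M"
  and W_continuous: "\<omega> \<in> space M \<Longrightarrow> continuous_on {0..T} (\<lambda>t. W t \<omega>)"
  and W_0: "AE \<omega> in M. W 0 \<omega> = 0"
  and W_distr: "0 \<le> s \<Longrightarrow> s < t \<Longrightarrow> t \<le> T \<Longrightarrow>
        distributed M lborel (\<lambda>\<omega>. W t \<omega> - W s \<omega>) (normal_density 0 (sqrt (t - s)))"
  and W_indep: "0 \<le> s \<Longrightarrow> s < t \<Longrightarrow> t \<le> T \<Longrightarrow>
        M.indep_set (sets (G s)) {(\<lambda>\<omega>. W t \<omega> - W s \<omega>) -` B \<inter> space M |B. B \<in> sets borel}"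
  using BM by (auto simp: brownian_motion_def continuous_paths_def)

lemma W_measurable_N: "t \<in> {0..T} \<Longrightarrow> W t \<in> borel_measurable N"
  using W_measurable_M measurable_completion by blast

section \<open>Relations between the natural, the augmented and the canonical filtration\<close>

lemma space_G [simp]: "space (G t) = space M" and space_A [simp]: "space (A t) = space M"
  and space_F [simp]: "space (F t) = space M"
  by (simp_all add: natural_filtration_def augmented_filtration_def canonical_filtration_def space_measure_of_conv)

lemma sets_G: "sets (G t) = sigma_sets (space M) {W u -` B \<inter> space M |u B. u \<in> {0..t} \<and> B \<in> sets borel}"
  unfolding natural_filtration_def by (intro sets_measure_of) auto

lemma sets_G_subset: "t \<le> T \<Longrightarrow> sets (G t) \<subseteq> sets M"
  unfolding sets_G by (intro sets.sigma_sets_subset) (auto intro!: measurable_sets W_measurable_M)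

lemma W_measurable_G: "0 \<le> u \<Longrightarrow> u \<le> t \<Longrightarrow> W u \<in> borel_measurable (G t)"
  by (rule measurableI) (auto simp: sets_G intro!: sigma_sets.Basic)

lemma sets_G_mono: "s \<le> t \<Longrightarrow> sets (G s) \<subseteq> sets (G t)"
  unfolding sets_G by (intro sigma_sets_mono') force

lemma sets_A: "t \<le> T \<Longrightarrow> sets (A t) = sigma_sets (space M) (sets (G t) \<union> null_sets N)"
  unfolding augmented_filtration_def
  using sets.space_closed[of "G t"] sets.space_closed[of N] by (intro sets_measure_of) (auto simp: null_sets_def)

lemma sets_A_subset: "t \<le> T \<Longrightarrow> sets (A t) \<subseteq> sets N"
  using sets_G_subset sets.sigma_sets_subset[of "sets (G t) \<union> null_sets N" N] by (auto simp: sets_A)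

text \<open>The sets that agree almost surely with a member of \<open>G t\<close> form a
  sigma-algebra containing all generators. This carries independence over to the
  augmentation.\<close>

lemma sets_A_approx:
  assumes t: "t \<le> T" and B: "B \<in> sets (A t)"
  shows "\<exists>C\<in>sets (G t). AE x in N. x \<in> B \<longleftrightarrow> x \<in> C"
  using B unfolding sets_A[OF t]
proof (induction rule: sigma_sets.induct)
  case (Basic a)
  then show ?case
  proof
    assume "a \<in> null_sets N"
    then have "AE x in N. x \<notin> a" by (rule AE_not_in)
    then show ?thesis by (intro bexI[of _ "{}"]) auto
  qed auto
next
  case Empty then show ?case by (intro bexI[of _ "{}"]) auto
next
  case (Compl a)
  then obtain C where C: "C \<in> sets (G t)" "AE x in N. x \<in> a \<longleftrightarrow> x \<in> C" by auto
  have "space M - C \<in> sets (G t)" using sets.compl_sets[OF C(1)] by simp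
  moreover have "AE x in N. x \<in> space M - a \<longleftrightarrow> x \<in> space M - C" using C(2) by auto
  ultimately show ?case by blast
next
  case (Union a)
  then obtain C where C: "\<And>i. C i \<in> sets (G t)" "\<And>i::nat. AE x in N. x \<in> a i \<longleftrightarrow> x \<in> C i" by metis
  have "AE x in N. \<forall>i. x \<in> a i \<longleftrightarrow> x \<in> C i" using C(2) by (simp add: AE_all_countable)
  then have "AE x in N. x \<in> (\<Union>i. a i) \<longleftrightarrow> x \<in> (\<Union>i. C i)" by eventually_elim auto
  with C(1) show ?case by (intro bexI[of _ "\<Union>i. C i"]) auto
qed

text \<open>The intersection is already a sigma-algebra, so generating one from it adds nothing.
  Membership in \<open>F t\<close> thus becomes membership in the augmented sigma-algebras at all
  later times up to \<open>T\<close>.\<close>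

lemma sets_F: "sets (F t) = (\<Inter>s\<in>{t<..}. sets (A (min s T)))"
proof -
  have ne: "{t<..} \<noteq> {}" using gt_ex[of t] by auto
  let ?I = "\<Inter>s\<in>{t<..}. sets (A (min s T))"
  have sub: "?I \<subseteq> Pow (space M)"
  proof
    fix x assume "x \<in> ?I"
    then have "x \<in> sets (A (min (t + 1) T))" by auto
    then show "x \<in> Pow (space M)" using sets.sets_into_space by fastforce
  qed
  have "sigma_algebra (space M) ?I"
  proof (rule sigma_algebra_iff2[THEN iffD2], intro conjI ballI allI impI)
    show "space M - s \<in> ?I" if "s \<in> ?I" for s
      using that sets.compl_sets[of s "A (min u T)" for u] by auto
  qed (use sub in auto)
  then show ?thesis
    unfolding canonical_filtration_def by (rule sigma_algebra.sets_measure_of_eq)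
qed

lemma sets_F_le: "t < s \<Longrightarrow> sets (F t) \<subseteq> sets (A (min s T))"
  unfolding sets_F by auto

lemma sets_F_subset: "sets (F t) \<subseteq> sets N"
  using sets_F_le[of t "t + 1"] sets_A_subset[of "min (t + 1) T"] by auto

lemma sets_F_mono: "s \<le> t \<Longrightarrow> sets (F s) \<subseteq> sets (F t)"
  unfolding sets_F by (intro INF_superset_mono) auto

lemma sets_G_subset_F: "t \<le> T \<Longrightarrow> sets (G t) \<subseteq> sets (F t)"
proof -
  assume "t \<le> T"
  then have "sets (G t) \<subseteq> sets (A (min s T))" if "t < s" for s
    using sets_G_mono[of t "min s T"] that by (auto simp: sets_A)
  then show ?thesis unfolding sets_F by auto
qed

lemma measurable_G_F: "t \<le> T \<Longrightarrow> f \<in> borel_measurable (G t) \<Longrightarrow> f \<in> borel_measurable (F t)"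
  using sets_G_subset_F by (auto simp: measurable_def)

lemma measurable_F_mono: "s \<le> t \<Longrightarrow> f \<in> borel_measurable (F s) \<Longrightarrow> f \<in> borel_measurable (F t)"
  using sets_F_mono by (auto simp: measurable_def)

lemma measurable_F_N: "f \<in> borel_measurable (F t) \<Longrightarrow> f \<in> borel_measurable N"
  using sets_F_subset by (auto simp: measurable_def)

lemma W_measurable_F: "0 \<le> u \<Longrightarrow> u \<le> t \<Longrightarrow> t \<le> T \<Longrightarrow> W u \<in> borel_measurable (F t)"
  by (intro measurable_G_F W_measurable_G)

section \<open>Independence of Brownian increments from the canonical filtration\<close>

lemma increment_indep_A:
  assumes s: "0 \<le> s" "s < t" "t \<le> T" and C: "C \<in> sets (A s)" and B: "B \<in> sets borel"
  shows "measure N (C \<inter> ((\<lambda>\<omega>. W t \<omega> - W s \<omega>) -` B \<inter> space M)) =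
    measure N C * measure N ((\<lambda>\<omega>. W t \<omega> - W s \<omega>) -` B \<inter> space M)"
proof -
  let ?E = "(\<lambda>\<omega>. W t \<omega> - W s \<omega>) -` B \<inter> space M"
  have E: "?E \<in> sets M"
    using s B by (intro measurable_sets[of _ _ borel] borel_measurable_diff W_measurable_M) auto
  obtain D where D: "D \<in> sets (G s)" "AE x in N. x \<in> C \<longleftrightarrow> x \<in> D"
    using sets_A_approx[of s C] s C by auto
  have DM: "D \<in> sets M" using D(1) sets_G_subset[of s] s by auto
  have CN: "C \<in> sets N" using C sets_A_subset[of s] s by auto
  have "measure N (C \<inter> ?E) = measure N (D \<inter> ?E)"
    using D(2) by (intro N.finite_measure_eq_AE) (use CN DM E in auto)
  also have "\<dots> = measure M (D \<inter> ?E)" using DM E by simp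
  also have "\<dots> = measure M D * measure M ?E"
    by (rule M.indep_setD[OF W_indep[OF s]]) (use D B in auto)
  also have "measure M D = measure N C"
  proof -
    have "measure N C = measure N D"
      using D(2) by (intro N.finite_measure_eq_AE) (use CN DM in auto)
    then show ?thesis using DM by simp
  qed
  finally show ?thesis using E by simp
qed

lemma increment_distr_N:
  assumes "0 \<le> s" "s < t" "t \<le> T"
  shows "distributed N lborel (\<lambda>\<omega>. W t \<omega> - W s \<omega>) (normal_density 0 (sqrt (t - s)))"
  using W_distr[OF assms] distr_completion[of "\<lambda>\<omega>. W t \<omega> - W s \<omega>" M lborel]
  by (auto simp: distributed_def intro: measurable_completion)

lemma increment_AE_neq:
  assumes "0 \<le> s" "s < t" "t \<le> T"
  shows "AE \<omega> in N. W t \<omega> - W s \<omega> \<noteq> x"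
proof -
  have "AE y in distr N lborel (\<lambda>\<omega>. W t \<omega> - W s \<omega>). y \<noteq> x"
    unfolding distributed_distr_eq_density[OF increment_distr_N[OF assms]]
    by (subst AE_density) (use AE_lborel_singleton[of x] in auto)
  then show ?thesis
    using distributed_measurable[OF increment_distr_N[OF assms]] by (subst (asm) AE_distr_iff) auto
qed

text \<open>Right-continuity costs nothing: \<open>F s\<close> is independent of \<open>W\<^sub>t - W\<^sub>u\<close> for \<open>u > s\<close>, and \<open>W\<^sub>t - W\<^sub>s\<close> is the
  limit of these increments and has no atoms.\<close>

lemma increment_indep_F_atMost:
  assumes s: "0 \<le> s" "s < t" "t \<le> T" and C: "C \<in> sets (F s)"
  shows "measure N (C \<inter> ((\<lambda>\<omega>. W t \<omega> - W s \<omega>) -` {..x} \<inter> space M)) =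
    measure N C * measure N ((\<lambda>\<omega>. W t \<omega> - W s \<omega>) -` {..x} \<inter> space M)"
proof -
  \<comment> \<open>\<open>u n\<close> is s + (t - s) / (n + 2): it decreases to s, and the shift by
    two keeps it strictly below t for n = 0 as well, as \<open>increment_indep_A\<close>
    demands.\<close>
  define u where "u n = s + (t - s) * inverse (real (Suc (Suc n)))" for n
  have u: "s < u n" "u n < t" for n
  proof -
    show "s < u n" using s by (simp add: u_def)
    have "(t - s) * inverse (real (Suc (Suc n))) < (t - s) * 1"
      using s by (intro mult_strict_left_mono) (auto simp: field_simps)
    then show "u n < t" by (simp add: u_def)
  qed
  have "u \<longlonglongrightarrow> s + (t - s) * 0"
    unfolding u_def by (intro tendsto_intros LIMSEQ_Suc[OF LIMSEQ_inverse_real_of_nat])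
  then have us: "u \<longlonglongrightarrow> s" by simp
  define E where "E v = (\<lambda>\<omega>. W t \<omega> - W v \<omega>) -` {..x} \<inter> space M" for v
  have EM: "E v \<in> sets N" if "v \<in> {0..T}" for v
  proof -
    have "(\<lambda>\<omega>. W t \<omega> - W v \<omega>) \<in> borel_measurable N"
      using that s by (intro borel_measurable_diff W_measurable_N) auto
    from measurable_sets[OF this, of "{..x}"] show ?thesis unfolding E_def by simp
  qed
  have EI: "E v \<inter> space M = E v" for v by (auto simp: E_def)
  have CN: "C \<in> sets N" using C sets_F_subset by auto
  have uT: "u n \<in> {0..T}" for n using u[of n] s by auto
  have lim: "AE \<omega> in N. (\<lambda>n. indicat_real (E (u n)) \<omega>) \<longlonglongrightarrow> indicator (E s) \<omega>"
    using increment_AE_neq[OF s, of x] AE_space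
  proof eventually_elim
    case (elim \<omega>)
    have c: "(\<lambda>n. W t \<omega> - W (u n) \<omega>) \<longlonglongrightarrow> W t \<omega> - W s \<omega>"
      using uT us elim s continuous_on_tendsto_compose[OF W_continuous us, of \<omega>] by (intro tendsto_diff) auto
    have "\<forall>\<^sub>F n in sequentially. indicat_real (E (u n)) \<omega> = indicator (E s) \<omega>"
    proof (cases "W t \<omega> - W s \<omega> < x")
      case True
      then show ?thesis using order_tendstoD(2)[OF c True] elim
        by (auto simp: E_def elim!: eventually_mono)
    next
      case False
      then have "x < W t \<omega> - W s \<omega>" using elim by auto
      from order_tendstoD(1)[OF c this] show ?thesis using False elim
        by (auto simp: E_def elim!: eventually_mono)
    qed
    then show ?case by (rule tendsto_eventually)
  qed
  have 1: "(\<lambda>n. measure N (E (u n))) \<longlonglongrightarrow> measure N (E s)"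
  proof -
    have "(\<lambda>n. \<integral>\<omega>. indicat_real (E (u n)) \<omega> \<partial>N) \<longlonglongrightarrow> (\<integral>\<omega>. indicator (E s) \<omega> \<partial>N)"
      by (rule integral_dominated_convergence[where w="\<lambda>_. 1"]) (use EM uT s lim in auto)
    then show ?thesis by (simp add: EI)
  qed
  have 2: "(\<lambda>n. measure N (C \<inter> E (u n))) \<longlonglongrightarrow> measure N (C \<inter> E s)"
  proof -
    have "(\<lambda>n. \<integral>\<omega>. indicat_real (C \<inter> E (u n)) \<omega> \<partial>N) \<longlonglongrightarrow> (\<integral>\<omega>. indicator (C \<inter> E s) \<omega> \<partial>N)"
    proof (rule integral_dominated_convergence[where w="\<lambda>_. 1"])
      show "AE \<omega> in N. (\<lambda>n. indicat_real (C \<inter> E (u n)) \<omega>) \<longlonglongrightarrow> indicator (C \<inter> E s) \<omega>"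
        using lim by eventually_elim (auto simp: indicator_inter_arith intro!: tendsto_intros)
    qed (use EM uT s CN in auto)
    then show ?thesis by (simp add: EI Int_assoc)
  qed
  have "measure N (C \<inter> E (u n)) = measure N C * measure N (E (u n))" for n
    unfolding E_def
  proof (rule increment_indep_A)
    have "min (u n) T = u n" using u[of n] s by auto
    then show "C \<in> sets (A (u n))" using sets_F_le[OF u(1)[of n]] C by auto
  qed (use u[of n] s in auto)
  then have "(\<lambda>n. measure N (C \<inter> E (u n))) \<longlonglongrightarrow> measure N C * measure N (E s)"
    using 1 by (auto intro!: tendsto_intros)
  with 2 have "measure N (C \<inter> E s) = measure N C * measure N (E s)" by (rule LIMSEQ_unique)
  then show ?thesis unfolding E_def .
qed

text \<open>The preimages of half-lines form an intersection-stable generator of the sigma-algebra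
  of the increment, so the product rule of \<open>increment_indep_F_atMost\<close> extends to all
  Borel sets.\<close>

lemma increment_indep_F:
  assumes s: "0 \<le> s" "s < t" "t \<le> T" and Y: "Y \<in> borel_measurable (F s)"
  shows "N.indep_var borel Y borel (\<lambda>\<omega>. W t \<omega> - W s \<omega>)"
proof -
  let ?Z = "\<lambda>\<omega>. W t \<omega> - W s \<omega>"
  let ?B = "{?Z -` a \<inter> space M | a. a \<in> range (\<lambda>x. {..x})}"
  have Z: "?Z \<in> borel_measurable N" using s by (intro borel_measurable_diff W_measurable_N) auto
  have YN: "Y \<in> borel_measurable N" using Y by (rule measurable_F_N)
  have B: "sigma_sets (space N) ?B = {?Z -` a \<inter> space M | a. a \<in> sets borel}"
  proof -
    have "{?Z -` a \<inter> space M | a. a \<in> sigma_sets UNIV (range (\<lambda>x. {..x}))} = sigma_sets (space M) ?B"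
      by (rule sigma_sets_vimage_commute) auto
    then show ?thesis by (simp add: borel_eq_atMost)
  qed
  have "N.indep_set (sets (F s)) ?B"
  proof (rule N.indep_setI)
    show "?B \<subseteq> N.events" using measurable_sets[OF Z] by auto
    show "N.prob (a \<inter> b) = N.prob a * N.prob b" if "a \<in> sets (F s)" "b \<in> ?B" for a b
      using that increment_indep_F_atMost[OF s] by auto
  qed (rule sets_F_subset)
  then have "N.indep_set (sigma_sets (space N) (sets (F s))) (sigma_sets (space N) ?B)"
  proof (rule N.indep_set_sigma_sets)
    show "Int_stable (sets (F s))" by (simp add: Int_stable_def)
    show "Int_stable ?B"
    proof (rule Int_stableI)
      fix a b assume "a \<in> ?B" "b \<in> ?B"
      then obtain x y where "a = ?Z -` {..x} \<inter> space M" "b = ?Z -` {..y} \<inter> space M" by auto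
      then have "a \<inter> b = ?Z -` {..min x y} \<inter> space M" by auto
      then show "a \<inter> b \<in> ?B" by blast
    qed
  qed
  then have ind: "N.indep_set (sets (F s)) {?Z -` a \<inter> space M | a. a \<in> sets borel}"
    unfolding B using sets.sigma_sets_eq[of "F s"] by simp
  have sub: "sigma_sets (space N) {Y -` a \<inter> space N | a. a \<in> sets borel} \<subseteq> sets (F s)"
    using sets.sigma_sets_subset[of "{Y -` a \<inter> space N | a. a \<in> sets borel}" "F s"] measurable_sets[OF Y] by auto
  have Zs: "sigma_sets (space N) {?Z -` a \<inter> space N | a. a \<in> sets borel} = {?Z -` a \<inter> space M | a. a \<in> sets borel}"
    using sigma_sets_vimage_commute[of ?Z "space N" UNIV "sets borel"] sets.sigma_sets_eq[of "borel :: real measure"] by simp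
  show ?thesis unfolding N.indep_var_eq Zs
  proof (intro conjI N.indep_setI)
    show "N.prob (a \<inter> b) = N.prob a * N.prob b"
      if "a \<in> sigma_sets (space N) {Y -` a \<inter> space N | a. a \<in> sets borel}" "b \<in> {?Z -` a \<inter> space M | a. a \<in> sets borel}" for a b
      using N.indep_setD[OF ind] that sub by blast
  qed (use sub sets_F_subset measurable_sets[OF Z] Z YN in auto)
qed

text \<open>The fourth moment is there for the variance of the compensated square
  \<open>(W t - W s)^2 - (t - s)\<close>. A degenerate increment is split off because the normal
  density requires a positive deviation; it occurs when a partition is cut off at a time t.\<close>

lemma increment_moments:
  assumes s: "0 \<le> s" "s \<le> t" "t \<le> T"
  shows "integrable N (\<lambda>\<omega>. (W t \<omega> - W s \<omega>) ^ k)"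
    and "(\<integral>\<omega>. W t \<omega> - W s \<omega> \<partial>N) = 0"
    and "(\<integral>\<omega>. (W t \<omega> - W s \<omega>)\<^sup>2 \<partial>N) = t - s"
    and "(\<integral>\<omega>. (W t \<omega> - W s \<omega>) ^ 4 \<partial>N) = 3 * (t - s)\<^sup>2"
proof -
  let ?Z = "\<lambda>\<omega>. W t \<omega> - W s \<omega>"
  have "integrable N (\<lambda>\<omega>. ?Z \<omega> ^ k) \<and> (\<integral>\<omega>. ?Z \<omega> \<partial>N) = 0 \<and> (\<integral>\<omega>. (?Z \<omega>)\<^sup>2 \<partial>N) = t - s
    \<and> (\<integral>\<omega>. (?Z \<omega>) ^ 4 \<partial>N) = 3 * (t - s)\<^sup>2"
  proof (cases "s = t")
    case True then show ?thesis by simp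
  next
    case False
    with s have st: "s < t" by simp
    have \<sigma>: "0 < sqrt (t - s)" using st by simp
    note D = increment_distr_N[OF s(1) st s(3)]
    have nn: "\<And>x. 0 \<le> normal_density 0 (sqrt (t - s)) x" by (simp add: normal_density_nonneg)
    have E: "(\<integral>\<omega>. ?Z \<omega> ^ j \<partial>N) = (\<integral>x. normal_density 0 (sqrt (t - s)) x * (x - 0) ^ j \<partial>lborel)" for j
      using distributed_integral[OF D, of "\<lambda>x. x ^ j"] nn by simp
    have "integrable lborel (\<lambda>x. normal_density 0 (sqrt (t - s)) x * (x - 0) ^ k)"
      by (rule integrable_normal_moment[OF \<sigma>])
    then have "integrable N (\<lambda>\<omega>. ?Z \<omega> ^ k)"
      using distributed_integrable[OF D, of "\<lambda>x. x ^ k"] nn by simp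
    moreover have "(\<integral>\<omega>. ?Z \<omega> \<partial>N) = 0"
      using E[of 1] integral_normal_moment_odd[OF \<sigma>, of 0 0] by simp
    moreover have "(\<integral>\<omega>. (?Z \<omega>)\<^sup>2 \<partial>N) = t - s"
      using E[of 2] integral_normal_moment_even[OF \<sigma>, of 0 1] st by simp
    moreover have "(\<integral>\<omega>. (?Z \<omega>) ^ 4 \<partial>N) = 3 * (t - s)\<^sup>2"
      using E[of 4] integral_normal_moment_even[OF \<sigma>, of 0 2] st
      by (simp add: fact_numeral power_divide power2_eq_square[of "_ :: real"])
    ultimately show ?thesis by simp
  qed
  then show "integrable N (\<lambda>\<omega>. ?Z \<omega> ^ k)" "(\<integral>\<omega>. ?Z \<omega> \<partial>N) = 0" "(\<integral>\<omega>. (?Z \<omega>)\<^sup>2 \<partial>N) = t - s"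
    "(\<integral>\<omega>. (?Z \<omega>) ^ 4 \<partial>N) = 3 * (t - s)\<^sup>2" by auto
qed

text \<open>With a general \<open>g\<close> the same rule handles both the cross term and the
  diagonal term in the induction of \<open>transform_isometry\<close>.\<close>

lemma increment_mult:
  fixes g :: "real \<Rightarrow> real"
  assumes s: "0 \<le> s" "s \<le> t" "t \<le> T" and Y: "Y \<in> borel_measurable (F s)" "integrable N Y"
    and g: "g \<in> borel_measurable borel" "integrable N (\<lambda>\<omega>. g (W t \<omega> - W s \<omega>))"
  shows "integrable N (\<lambda>\<omega>. Y \<omega> * g (W t \<omega> - W s \<omega>))"
    and "(\<integral>\<omega>. Y \<omega> * g (W t \<omega> - W s \<omega>) \<partial>N) = (\<integral>\<omega>. Y \<omega> \<partial>N) * (\<integral>\<omega>. g (W t \<omega> - W s \<omega>) \<partial>N)"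
proof -
  have "integrable N (\<lambda>\<omega>. Y \<omega> * g (W t \<omega> - W s \<omega>)) \<and>
    (\<integral>\<omega>. Y \<omega> * g (W t \<omega> - W s \<omega>) \<partial>N) = (\<integral>\<omega>. Y \<omega> \<partial>N) * (\<integral>\<omega>. g (W t \<omega> - W s \<omega>) \<partial>N)"
  proof (cases "s = t")
    case True then show ?thesis using Y N.prob_space by simp
  next
    case False
    then have "s < t" using s by simp
    have "N.indep_var borel ((\<lambda>x. x) \<circ> Y) borel (g \<circ> (\<lambda>\<omega>. W t \<omega> - W s \<omega>))"
      by (rule N.indep_var_compose[OF increment_indep_F[OF s(1) \<open>s < t\<close> s(3) Y(1)]]) (use g in auto)
    then have "N.indep_var borel Y borel (\<lambda>\<omega>. g (W t \<omega> - W s \<omega>))" by (simp add: comp_def)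
    from N.indep_var_integrable[OF this Y(2) g(2)] N.indep_var_lebesgue_integral[OF this Y(2) g(2)]
    show ?thesis by simp
  qed
  then show "integrable N (\<lambda>\<omega>. Y \<omega> * g (W t \<omega> - W s \<omega>))"
    "(\<integral>\<omega>. Y \<omega> * g (W t \<omega> - W s \<omega>) \<partial>N) = (\<integral>\<omega>. Y \<omega> \<partial>N) * (\<integral>\<omega>. g (W t \<omega> - W s \<omega>) \<partial>N)" by auto
qed

text \<open>The cross terms vanish by independence.\<close>

lemma transform_isometry:
  fixes K :: "nat \<Rightarrow> 'a \<Rightarrow> real" and g :: "nat \<Rightarrow> real \<Rightarrow> real" and \<tau> :: "nat \<Rightarrow> real"
  defines "d \<equiv> \<lambda>i \<omega>. g i (W (\<tau> (Suc i)) \<omega> - W (\<tau> i) \<omega>)"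
  assumes \<tau>: "\<And>i. i \<le> n \<Longrightarrow> \<tau> i \<in> {0..T}" "\<And>i. i < n \<Longrightarrow> \<tau> i \<le> \<tau> (Suc i)"
    and K: "\<And>i. i < n \<Longrightarrow> K i \<in> borel_measurable (F (\<tau> i))" "\<And>i \<omega>. i < n \<Longrightarrow> \<omega> \<in> space M \<Longrightarrow> \<bar>K i \<omega>\<bar> \<le> C"
    and g: "\<And>i. i < n \<Longrightarrow> g i \<in> borel_measurable borel" "\<And>i. i < n \<Longrightarrow> integrable N (d i)"
      "\<And>i. i < n \<Longrightarrow> integrable N (\<lambda>\<omega>. (d i \<omega>)\<^sup>2)" "\<And>i. i < n \<Longrightarrow> (\<integral>\<omega>. d i \<omega> \<partial>N) = 0"
      "\<And>i. i < n \<Longrightarrow> (\<integral>\<omega>. (d i \<omega>)\<^sup>2 \<partial>N) = c i"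
  shows "(\<lambda>\<omega>. \<Sum>i<n. K i \<omega> * d i \<omega>) \<in> borel_measurable (F (\<tau> n))"
    "integrable N (\<lambda>\<omega>. (\<Sum>i<n. K i \<omega> * d i \<omega>)\<^sup>2)"
    "(\<integral>\<omega>. (\<Sum>i<n. K i \<omega> * d i \<omega>)\<^sup>2 \<partial>N) = (\<Sum>i<n. c i * (\<integral>\<omega>. (K i \<omega>)\<^sup>2 \<partial>N))"
proof -
  have "(\<lambda>\<omega>. \<Sum>i<n. K i \<omega> * d i \<omega>) \<in> borel_measurable (F (\<tau> n)) \<and>
    integrable N (\<lambda>\<omega>. (\<Sum>i<n. K i \<omega> * d i \<omega>)\<^sup>2) \<and>
    (\<integral>\<omega>. (\<Sum>i<n. K i \<omega> * d i \<omega>)\<^sup>2 \<partial>N) = (\<Sum>i<n. c i * (\<integral>\<omega>. (K i \<omega>)\<^sup>2 \<partial>N))"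
    using \<tau> K g(1) g(2-)
  proof (induction n)
    case (Suc n)
    define S where "S \<omega> = (\<Sum>i<n. K i \<omega> * d i \<omega>)" for \<omega>
    have IH: "S \<in> borel_measurable (F (\<tau> n))" "integrable N (\<lambda>\<omega>. (S \<omega>)\<^sup>2)"
      "(\<integral>\<omega>. (S \<omega>)\<^sup>2 \<partial>N) = (\<Sum>i<n. c i * (\<integral>\<omega>. (K i \<omega>)\<^sup>2 \<partial>N))"
      using Suc.IH Suc.prems unfolding S_def by auto
    have \<tau>n: "0 \<le> \<tau> n" "\<tau> n \<le> \<tau> (Suc n)" "\<tau> (Suc n) \<le> T" using Suc.prems(1)[of n] Suc.prems(1)[of "Suc n"] Suc.prems(2)[of n] by auto
    have Kn: "K n \<in> borel_measurable (F (\<tau> n))" "\<And>\<omega>. \<omega> \<in> space M \<Longrightarrow> \<bar>K n \<omega>\<bar> \<le> C" using Suc.prems by auto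
    have C: "0 \<le> C" using Kn(2) N.not_empty by fastforce
    have gn: "g n \<in> borel_measurable borel" "integrable N (d n)" "integrable N (\<lambda>\<omega>. (d n \<omega>)\<^sup>2)"
      "(\<integral>\<omega>. d n \<omega> \<partial>N) = 0" "(\<integral>\<omega>. (d n \<omega>)\<^sup>2 \<partial>N) = c n" using Suc.prems by auto
    note [measurable] = measurable_F_N[OF IH(1)] measurable_F_N[OF Kn(1)] gn(1)
    have Si: "integrable N S" by (rule N.square_integrable_imp_integrable[OF _ IH(2)]) measurable
    have SK: "integrable N (\<lambda>\<omega>. S \<omega> * K n \<omega>)"
      by (rule Bochner_Integration.integrable_bound[of N "\<lambda>\<omega>. C * S \<omega>"])
         (use Si Kn(2) C in \<open>auto simp: abs_mult mult.commute[of C] intro!: mult_left_mono AE_I2\<close>)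
    have K2: "integrable N (\<lambda>\<omega>. (K n \<omega>)\<^sup>2)"
      by (rule N.integrable_const_bound[of _ "C\<^sup>2"]) (use Kn(2) C in \<open>auto intro!: AE_I2 abs_le_square_iff[THEN iffD1]\<close>)
    have mS: "(\<lambda>\<omega>. S \<omega> * K n \<omega>) \<in> borel_measurable (F (\<tau> n))" "(\<lambda>\<omega>. (K n \<omega>)\<^sup>2) \<in> borel_measurable (F (\<tau> n))"
      using IH(1) Kn(1) by simp_all
    note i1 = increment_mult[OF \<tau>n mS(1) SK gn(1) gn(2)[unfolded d_def]]
    have "(\<lambda>x. (g n x)\<^sup>2) \<in> borel_measurable borel" by measurable
    note i2 = increment_mult[OF \<tau>n mS(2) K2 this gn(3)[unfolded d_def]]
    have eq: "(\<Sum>i<Suc n. K i \<omega> * d i \<omega>)\<^sup>2 = (S \<omega>)\<^sup>2 + (2 * (S \<omega> * K n \<omega> * d n \<omega>) + (K n \<omega>)\<^sup>2 * (d n \<omega>)\<^sup>2)" for \<omega>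
      by (simp add: S_def[symmetric] power2_sum power_mult_distrib algebra_simps)
    have i1': "integrable N (\<lambda>\<omega>. S \<omega> * K n \<omega> * d n \<omega>)" "(\<integral>\<omega>. S \<omega> * K n \<omega> * d n \<omega> \<partial>N) = 0"
      using i1 gn(4) by (simp_all add: d_def)
    have i2': "integrable N (\<lambda>\<omega>. (K n \<omega>)\<^sup>2 * (d n \<omega>)\<^sup>2)" "(\<integral>\<omega>. (K n \<omega>)\<^sup>2 * (d n \<omega>)\<^sup>2 \<partial>N) = c n * (\<integral>\<omega>. (K n \<omega>)\<^sup>2 \<partial>N)"
      using i2 gn(5) by (simp_all add: d_def mult.commute)
    have "integrable N (\<lambda>\<omega>. (\<Sum>i<Suc n. K i \<omega> * d i \<omega>)\<^sup>2)"
      unfolding eq using IH(2) i1'(1) i2'(1) by simp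
    moreover have "(\<integral>\<omega>. (\<Sum>i<Suc n. K i \<omega> * d i \<omega>)\<^sup>2 \<partial>N) = (\<Sum>i<Suc n. c i * (\<integral>\<omega>. (K i \<omega>)\<^sup>2 \<partial>N))"
      unfolding eq using IH(2,3) i1' i2' by simp
    moreover have "(\<lambda>\<omega>. \<Sum>i<Suc n. K i \<omega> * d i \<omega>) \<in> borel_measurable (F (\<tau> (Suc n)))"
    proof -
      have [measurable]: "S \<in> borel_measurable (F (\<tau> (Suc n)))" "K n \<in> borel_measurable (F (\<tau> (Suc n)))"
        "W (\<tau> (Suc n)) \<in> borel_measurable (F (\<tau> (Suc n)))" "W (\<tau> n) \<in> borel_measurable (F (\<tau> (Suc n)))"
        using measurable_F_mono[OF \<tau>n(2)] IH(1) Kn(1) \<tau>n W_measurable_F by auto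
      have "(\<lambda>\<omega>. S \<omega> + K n \<omega> * d n \<omega>) \<in> borel_measurable (F (\<tau> (Suc n)))" unfolding d_def by measurable
      then show ?thesis by (simp add: S_def)
    qed
    ultimately show ?case by simp
  qed simp
  then show "(\<lambda>\<omega>. \<Sum>i<n. K i \<omega> * d i \<omega>) \<in> borel_measurable (F (\<tau> n))"
    "integrable N (\<lambda>\<omega>. (\<Sum>i<n. K i \<omega> * d i \<omega>)\<^sup>2)"
    "(\<integral>\<omega>. (\<Sum>i<n. K i \<omega> * d i \<omega>)\<^sup>2 \<partial>N) = (\<Sum>i<n. c i * (\<integral>\<omega>. (K i \<omega>)\<^sup>2 \<partial>N))" by auto
qed

end

section \<open>A bound for Ito integrals in probability\<close>

lemma power2_diff_le: "(a - c)\<^sup>2 \<le> 2 * (a - b)\<^sup>2 + 2 * (b - c)\<^sup>2" for a b c :: real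
proof -
  have "0 \<le> ((a - b) - (b - c))\<^sup>2" by simp
  then show ?thesis by (simp add: power2_eq_square algebra_simps)
qed

lemma sum_indicator_partition:
  fixes \<tau> :: "nat \<Rightarrow> real"
  assumes "\<And>i. i < n \<Longrightarrow> \<tau> i \<le> \<tau> (Suc i)"
  shows "(\<Sum>i<n. indicator {\<tau> i<..\<tau> (Suc i)} s :: real) = indicator {\<tau> 0<..\<tau> n} s"
  using assms
proof (induction n)
  case (Suc n)
  have "\<tau> 0 \<le> \<tau> n" using partition_bounds[of "Suc n" \<tau> 0 n] Suc.prems by simp
  moreover have "\<tau> n \<le> \<tau> (Suc n)" using Suc.prems by simp
  moreover have "(\<Sum>i<Suc n. indicator {\<tau> i<..\<tau> (Suc i)} s :: real) = indicator {\<tau> 0<..\<tau> n} s + indicator {\<tau> n<..\<tau> (Suc n)} s"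
    using Suc by simp
  ultimately show ?case by (auto simp: indicator_def)
qed simp

text \<open>The half-open intervals are disjoint, so at each time at most one summand is nonzero and
  no mixed products survive.\<close>

lemma simple_process_power2:
  assumes "\<And>i. i < n \<Longrightarrow> \<tau> i \<le> \<tau> (Suc i)"
  shows "(simple_process n \<tau> \<xi> s \<omega>)\<^sup>2 = (\<Sum>i<n. (\<xi> i \<omega>)\<^sup>2 * indicator {\<tau> i<..\<tau> (Suc i)} s)"
  using assms
proof (induction n)
  case (Suc n)
  have IH: "(simple_process n \<tau> \<xi> s \<omega>)\<^sup>2 = (\<Sum>i<n. (\<xi> i \<omega>)\<^sup>2 * indicator {\<tau> i<..\<tau> (Suc i)} s)"
    using Suc by simp
  have z: "simple_process n \<tau> \<xi> s \<omega> = 0" if s: "\<tau> n < s"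
    unfolding simple_process_def
  proof (rule sum.neutral, rule ballI)
    fix i assume "i \<in> {..<n}"
    then have "\<tau> (Suc i) \<le> \<tau> n" using partition_bounds[of "Suc n" \<tau> "Suc i" n] Suc.prems by simp
    then show "\<xi> i \<omega> * indicator {\<tau> i<..\<tau> (Suc i)} s = 0" using s by simp
  qed
  have "simple_process (Suc n) \<tau> \<xi> s \<omega> = simple_process n \<tau> \<xi> s \<omega> + \<xi> n \<omega> * indicator {\<tau> n<..\<tau> (Suc n)} s"
    by (simp add: simple_process_def)
  then show ?case
    using z IH by (cases "\<tau> n < s \<and> s \<le> \<tau> (Suc n)") (auto simp: indicator_def)
qed (simp add: simple_process_def)

lemma nn_integral_simple_process:
  assumes \<tau>: "\<And>i. i < n \<Longrightarrow> \<tau> i \<le> \<tau> (Suc i)" "\<And>i. i \<le> n \<Longrightarrow> \<tau> i \<in> {0..T}"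
  shows "(\<integral>\<^sup>+s\<in>{0..T}. ennreal ((simple_process n \<tau> \<xi> s \<omega>)\<^sup>2) \<partial>lborel) = ennreal (\<Sum>i<n. (\<xi> i \<omega>)\<^sup>2 * (\<tau> (Suc i) - \<tau> i))"
proof -
  have "(\<integral>\<^sup>+s\<in>{0..T}. ennreal ((simple_process n \<tau> \<xi> s \<omega>)\<^sup>2) \<partial>lborel)
     = (\<integral>\<^sup>+s. (\<Sum>i<n. ennreal ((\<xi> i \<omega>)\<^sup>2) * indicator {\<tau> i<..\<tau> (Suc i)} s) \<partial>lborel)"
  proof (rule nn_integral_cong)
    fix s
    have sub: "{\<tau> i<..\<tau> (Suc i)} \<subseteq> {0..T}" if "i < n" for i using \<tau>(2)[of i] \<tau>(2)[of "Suc i"] that by auto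
    have "ennreal ((simple_process n \<tau> \<xi> s \<omega>)\<^sup>2) = (\<Sum>i<n. ennreal ((\<xi> i \<omega>)\<^sup>2 * indicator {\<tau> i<..\<tau> (Suc i)} s))"
    proof -
      have "(simple_process n \<tau> \<xi> s \<omega>)\<^sup>2 = (\<Sum>i<n. (\<xi> i \<omega>)\<^sup>2 * indicator {\<tau> i<..\<tau> (Suc i)} s)"
        by (intro simple_process_power2 \<tau>(1))
      then show ?thesis by (simp only:) (rule sum_ennreal[symmetric], simp)
    qed
    also have "\<dots> = (\<Sum>i<n. ennreal ((\<xi> i \<omega>)\<^sup>2) * indicator {\<tau> i<..\<tau> (Suc i)} s)"
      by (intro sum.cong refl) (auto simp: indicator_def)
    finally have eq: "ennreal ((simple_process n \<tau> \<xi> s \<omega>)\<^sup>2) = (\<Sum>i<n. ennreal ((\<xi> i \<omega>)\<^sup>2) * indicator {\<tau> i<..\<tau> (Suc i)} s)" .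
    show "ennreal ((simple_process n \<tau> \<xi> s \<omega>)\<^sup>2) * indicator {0..T} s = (\<Sum>i<n. ennreal ((\<xi> i \<omega>)\<^sup>2) * indicator {\<tau> i<..\<tau> (Suc i)} s)"
      unfolding eq sum_distrib_right
    proof (rule sum.cong)
      fix i assume "i \<in> {..<n}"
      then have "s \<in> {0..T}" if "s \<in> {\<tau> i<..\<tau> (Suc i)}" using sub[of i] that by auto
      then show "ennreal ((\<xi> i \<omega>)\<^sup>2) * indicator {\<tau> i<..\<tau> (Suc i)} s * indicator {0..T} s = ennreal ((\<xi> i \<omega>)\<^sup>2) * indicator {\<tau> i<..\<tau> (Suc i)} s"
        by (auto simp: indicator_def)
    qed simp
  qed
  also have "\<dots> = (\<Sum>i<n. ennreal ((\<xi> i \<omega>)\<^sup>2) * emeasure lborel {\<tau> i<..\<tau> (Suc i)})"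
    by (subst nn_integral_sum) (auto simp: nn_integral_cmult_indicator)
  also have "\<dots> = (\<Sum>i<n. ennreal ((\<xi> i \<omega>)\<^sup>2 * (\<tau> (Suc i) - \<tau> i)))"
    using \<tau>(1) by (intro sum.cong) (auto simp: ennreal_mult)
  also have "\<dots> = ennreal (\<Sum>i<n. (\<xi> i \<omega>)\<^sup>2 * (\<tau> (Suc i) - \<tau> i))"
    using \<tau>(1) by (intro sum_ennreal) auto
  finally show ?thesis .
qed

lemma (in prob_space) Chebyshev_second_moment:
  assumes Z: "Z \<in> borel_measurable M" "integrable M (\<lambda>\<omega>. (Z \<omega>)\<^sup>2)" and \<eta>: "0 < \<eta>"
  shows "prob {\<omega>\<in>space M. \<eta> < \<bar>Z \<omega>\<bar>} \<le> expectation (\<lambda>\<omega>. (Z \<omega>)\<^sup>2) / \<eta>\<^sup>2"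
proof -
  note [measurable] = Z(1)
  have "prob {\<omega>\<in>space M. \<eta> < \<bar>Z \<omega>\<bar>} \<le> prob {\<omega>\<in>space M. \<eta>\<^sup>2 \<le> (Z \<omega>)\<^sup>2}"
  proof (rule finite_measure_mono)
    show "{\<omega>\<in>space M. \<eta> < \<bar>Z \<omega>\<bar>} \<subseteq> {\<omega>\<in>space M. \<eta>\<^sup>2 \<le> (Z \<omega>)\<^sup>2}"
    proof safe
      fix \<omega> assume "\<eta> < \<bar>Z \<omega>\<bar>"
      then have "\<eta>\<^sup>2 \<le> \<bar>Z \<omega>\<bar>\<^sup>2" using \<eta> by (intro power_mono) auto
      then show "\<eta>\<^sup>2 \<le> (Z \<omega>)\<^sup>2" by simp
    qed
  qed measurable
  also have "\<dots> \<le> expectation (\<lambda>\<omega>. (Z \<omega>)\<^sup>2) / \<eta>\<^sup>2"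
    by (rule integral_Markov_inequality_measure[where A="{}"]) (use Z \<eta> in auto)
  finally show ?thesis .
qed

context brownian begin

lemma simple_integral_measurable:
  assumes "simple_process_data M F T n \<tau> \<xi>" "t \<in> {0..T}"
  shows "simple_integral W n \<tau> \<xi> t \<in> borel_measurable N"
proof -
  have "(\<lambda>\<omega>. \<xi> i \<omega> * (W (min (\<tau> (Suc i)) t) \<omega> - W (min (\<tau> i) t) \<omega>)) \<in> borel_measurable N" if "i \<in> {..<n}" for i
  proof -
    have "\<tau> i \<in> {0..T}" "\<tau> (Suc i) \<in> {0..T}" "\<xi> i \<in> borel_measurable (F (\<tau> i))"
      using that assms unfolding simple_process_data_def by auto
    then have [measurable]: "\<xi> i \<in> borel_measurable N" "W (min (\<tau> (Suc i)) t) \<in> borel_measurable N"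
      "W (min (\<tau> i) t) \<in> borel_measurable N"
      using measurable_F_N W_measurable_N assms(2) by (auto simp: min_def)
    show ?thesis by measurable
  qed
  then show ?thesis unfolding simple_integral_def[abs_def] by (rule borel_measurable_sum)
qed

text \<open>Stop the integrand when its square integral exceeds \<open>\<delta>\<close>: the stopped integral has second moment at
  most \<open>\<delta>\<close>, and it agrees with the original one unless the whole square integral exceeds \<open>\<delta>\<close>.\<close>

lemma simple_integral_bound:
  assumes D: "simple_process_data M F T n \<tau> \<xi>" and t: "t \<in> {0..T}" and \<eta>: "0 < \<eta>" and \<delta>: "0 < \<delta>"
  shows "measure N {\<omega>\<in>space M. \<eta> < \<bar>simple_integral W n \<tau> \<xi> t \<omega>\<bar>}
     \<le> measure N {\<omega>\<in>space M. ennreal \<delta> < (\<integral>\<^sup>+s\<in>{0..T}. ennreal ((simple_process n \<tau> \<xi> s \<omega>)\<^sup>2) \<partial>lborel)} + \<delta> / \<eta>\<^sup>2"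
proof -
  have \<tau>: "\<And>i. i \<le> n \<Longrightarrow> \<tau> i \<in> {0..T}" "\<And>i. i < n \<Longrightarrow> \<tau> i \<le> \<tau> (Suc i)"
    and \<xi>: "\<And>i. i < n \<Longrightarrow> \<xi> i \<in> borel_measurable (F (\<tau> i))"
    using D unfolding simple_process_data_def by auto
  obtain C where C: "\<And>i \<omega>. i < n \<Longrightarrow> \<omega> \<in> space M \<Longrightarrow> \<bar>\<xi> i \<omega>\<bar> \<le> C"
    using D unfolding simple_process_data_def by metis
  have \<tau>_le: "\<tau> i \<le> \<tau> j" if "i \<le> j" "j \<le> n" for i j using partition_bounds[of n \<tau> i j] \<tau>(2) that by auto
  define V where "V m \<omega> = (\<Sum>j<m. (\<xi> j \<omega>)\<^sup>2 * (\<tau> (Suc j) - \<tau> j))" for m \<omega>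
  \<comment> \<open>The test involves \<open>V (Suc i)\<close>, which already counts the interval
    about to be entered: its coefficient is known at time \<open>\<tau> i\<close>, so the test is
    measurable there and the stopped sum never overshoots \<open>\<delta>\<close>. The condition
    \<open>\<tau> i \<le> t\<close> makes \<open>K i\<close> measurable at the earlier time
    \<open>\<sigma> i\<close>; where it fails, the increment of W along \<open>\<sigma>\<close> is
    0.\<close>
  define K where "K i \<omega> = (if \<tau> i \<le> t \<and> V (Suc i) \<omega> \<le> \<delta> then \<xi> i \<omega> else 0)" for i \<omega>
  define \<sigma> where "\<sigma> i = min (\<tau> i) t" for i
  have V_meas: "V (Suc i) \<in> borel_measurable (F (\<tau> i))" if i: "i < n" for i
    unfolding V_def[abs_def]
  proof (intro borel_measurable_sum borel_measurable_times borel_measurable_const borel_measurable_power)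
    fix j assume "j \<in> {..<Suc i}"
    then show "\<xi> j \<in> borel_measurable (F (\<tau> i))"
      using measurable_F_mono[OF \<tau>_le \<xi>] i by auto
  qed
  have V_mono: "V i \<omega> \<le> V j \<omega>" if "i \<le> j" "j \<le> n" for i j \<omega>
    unfolding V_def by (rule sum_mono2) (use that \<tau>(2) in auto)
  have K_meas: "K i \<in> borel_measurable (F (\<sigma> i))" if i: "i < n" for i
  proof (cases "\<tau> i \<le> t")
    case True
    note [measurable] = V_meas[OF i] \<xi>[OF i]
    have "(\<lambda>\<omega>. if V (Suc i) \<omega> \<le> \<delta> then \<xi> i \<omega> else 0) \<in> borel_measurable (F (\<tau> i))" by measurable
    then show ?thesis using True by (simp add: K_def[abs_def] \<sigma>_def min_def)
  next
    case False then show ?thesis by (simp add: K_def[abs_def])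
  qed
  have K_bound: "\<bar>K i \<omega>\<bar> \<le> max C 0" if "i < n" "\<omega> \<in> space M" for i \<omega>
    using C[OF that] by (auto simp: K_def)
  have K_sum: "(\<Sum>i<m. (K i \<omega>)\<^sup>2 * (\<tau> (Suc i) - \<tau> i)) \<le> \<delta>" if m: "m \<le> n" for m \<omega>
    using m
  proof (induction m)
    case (Suc m)
    show ?case
    proof (cases "V (Suc m) \<omega> \<le> \<delta>")
      case True
      have "(\<Sum>i<Suc m. (K i \<omega>)\<^sup>2 * (\<tau> (Suc i) - \<tau> i)) \<le> V (Suc m) \<omega>"
        unfolding V_def using Suc.prems \<tau>(2) by (intro sum_mono mult_right_mono) (auto simp: K_def)
      with True show ?thesis by simp
    next
      case False then show ?thesis using Suc by (simp add: K_def)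
    qed
  qed (use \<delta> in simp)
  have \<sigma>: "\<And>i. i \<le> n \<Longrightarrow> \<sigma> i \<in> {0..T}" "\<And>i. i < n \<Longrightarrow> \<sigma> i \<le> \<sigma> (Suc i)"
    using \<tau> t unfolding \<sigma>_def by (fastforce simp: min_def)+
  define S where "S \<omega> = (\<Sum>i<n. K i \<omega> * (W (\<sigma> (Suc i)) \<omega> - W (\<sigma> i) \<omega>))" for \<omega>
  have iso: "S \<in> borel_measurable (F (\<sigma> n))" "integrable N (\<lambda>\<omega>. (S \<omega>)\<^sup>2)"
    "(\<integral>\<omega>. (S \<omega>)\<^sup>2 \<partial>N) = (\<Sum>i<n. (\<sigma> (Suc i) - \<sigma> i) * (\<integral>\<omega>. (K i \<omega>)\<^sup>2 \<partial>N))"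
  proof -
    have m: "integrable N (\<lambda>\<omega>. W (\<sigma> (Suc i)) \<omega> - W (\<sigma> i) \<omega>)"
      "integrable N (\<lambda>\<omega>. (W (\<sigma> (Suc i)) \<omega> - W (\<sigma> i) \<omega>)\<^sup>2)"
      "(\<integral>\<omega>. W (\<sigma> (Suc i)) \<omega> - W (\<sigma> i) \<omega> \<partial>N) = 0"
      "(\<integral>\<omega>. (W (\<sigma> (Suc i)) \<omega> - W (\<sigma> i) \<omega>)\<^sup>2 \<partial>N) = \<sigma> (Suc i) - \<sigma> i" if "i < n" for i
    proof -
      have "0 \<le> \<sigma> i" "\<sigma> i \<le> \<sigma> (Suc i)" "\<sigma> (Suc i) \<le> T" using \<sigma>(1)[of i] \<sigma>(1)[of "Suc i"] \<sigma>(2)[of i] that by auto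
      note inc = increment_moments[OF this]
      show "integrable N (\<lambda>\<omega>. W (\<sigma> (Suc i)) \<omega> - W (\<sigma> i) \<omega>)" using inc(1)[of 1] by simp
    qed (use increment_moments \<sigma> that in auto)
    \<comment> \<open>With \<open>g\<close> the identity, \<open>c i\<close> is the length of the
      i-th interval and the result is Ito's isometry for simple integrands.\<close>
    note iso = transform_isometry[where \<tau>=\<sigma> and n=n and K=K and g="\<lambda>i x. x" and c="\<lambda>i. \<sigma> (Suc i) - \<sigma> i" and C="max C 0",
        OF \<sigma> K_meas K_bound _ m, simplified]
    show "S \<in> borel_measurable (F (\<sigma> n))" "integrable N (\<lambda>\<omega>. (S \<omega>)\<^sup>2)"
      "(\<integral>\<omega>. (S \<omega>)\<^sup>2 \<partial>N) = (\<Sum>i<n. (\<sigma> (Suc i) - \<sigma> i) * (\<integral>\<omega>. (K i \<omega>)\<^sup>2 \<partial>N))"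
      unfolding S_def[abs_def] using iso by auto
  qed
  have K2: "integrable N (\<lambda>\<omega>. (K i \<omega>)\<^sup>2)" if i: "i < n" for i
  proof (rule N.integrable_const_bound[of _ "(max C 0)\<^sup>2"])
    show "AE \<omega> in N. norm ((K i \<omega>)\<^sup>2) \<le> (max C 0)\<^sup>2"
      using K_bound[OF i] by (auto intro!: AE_I2 abs_le_square_iff[THEN iffD1])
  qed (use measurable_F_N[OF K_meas[OF i]] in simp)
  \<comment> \<open>Cutting the partition off at t only shortens its intervals, so the pathwise
    bound \<open>K_sum\<close> over the full intervals can be integrated.\<close>
  have "(\<integral>\<omega>. (S \<omega>)\<^sup>2 \<partial>N) \<le> (\<Sum>i<n. (\<tau> (Suc i) - \<tau> i) * (\<integral>\<omega>. (K i \<omega>)\<^sup>2 \<partial>N))"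
    unfolding iso(3) using \<tau>(2) by (intro sum_mono mult_right_mono) (fastforce simp: \<sigma>_def min_def)+
  also have "\<dots> = (\<integral>\<omega>. (\<Sum>i<n. (K i \<omega>)\<^sup>2 * (\<tau> (Suc i) - \<tau> i)) \<partial>N)"
    using K2 by (simp add: mult.commute)
  also have "\<dots> \<le> (\<integral>\<omega>. \<delta> \<partial>N)"
    using K2 K_sum[of n] by (intro integral_mono) auto
  also have "\<dots> = \<delta>" using N.prob_space by simp
  finally have S2: "(\<integral>\<omega>. (S \<omega>)\<^sup>2 \<partial>N) \<le> \<delta>" .
  let ?A = "{\<omega>\<in>space M. \<eta> < \<bar>simple_integral W n \<tau> \<xi> t \<omega>\<bar>}"
  let ?B = "{\<omega>\<in>space M. ennreal \<delta> < (\<integral>\<^sup>+s\<in>{0..T}. ennreal ((simple_process n \<tau> \<xi> s \<omega>)\<^sup>2) \<partial>lborel)}"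
  let ?C = "{\<omega>\<in>space M. \<eta> < \<bar>S \<omega>\<bar>}"
  have B: "?B = {\<omega>\<in>space M. \<delta> < V n \<omega>}"
  proof -
    have "(\<integral>\<^sup>+s\<in>{0..T}. ennreal ((simple_process n \<tau> \<xi> s \<omega>)\<^sup>2) \<partial>lborel) = ennreal (V n \<omega>)" for \<omega>
      unfolding V_def by (intro nn_integral_simple_process \<tau>)
    then show ?thesis using \<delta> by (simp add: ennreal_less_iff)
  qed
  have "V n \<in> borel_measurable N"
    unfolding V_def[abs_def] using measurable_F_N[OF \<xi>]
    by (intro borel_measurable_sum borel_measurable_times borel_measurable_const borel_measurable_power) auto
  then have Bm: "?B \<in> sets N" unfolding B by measurable (simp add: space_completion)
  have Sm: "S \<in> borel_measurable N" by (rule measurable_F_N[OF iso(1)])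
  then have Cm: "?C \<in> sets N" by measurable (simp add: space_completion)
  have "?A \<subseteq> ?B \<union> ?C"
  proof safe
    fix \<omega> assume \<omega>: "\<omega> \<in> space M" "\<eta> < \<bar>simple_integral W n \<tau> \<xi> t \<omega>\<bar>"
      "\<not> \<eta> < \<bar>S \<omega>\<bar>"
    show "ennreal \<delta> < (\<integral>\<^sup>+s\<in>{0..T}. ennreal ((simple_process n \<tau> \<xi> s \<omega>)\<^sup>2) \<partial>lborel)"
    proof (rule ccontr)
      assume "\<not> ?thesis"
      then have "\<omega> \<notin> ?B" by simp
      then have "V n \<omega> \<le> \<delta>" unfolding B using \<omega>(1) by simp
      have "simple_integral W n \<tau> \<xi> t \<omega> = S \<omega>"
        unfolding simple_integral_def S_def \<sigma>_def
      proof (rule sum.cong)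
        fix i assume "i \<in> {..<n}"
        then have i: "i < n" by simp
        have "V (Suc i) \<omega> \<le> \<delta>" using V_mono[of "Suc i" n \<omega>] i \<open>V n \<omega> \<le> \<delta>\<close> by simp
        then show "\<xi> i \<omega> * (W (min (\<tau> (Suc i)) t) \<omega> - W (min (\<tau> i) t) \<omega>) = K i \<omega> * (W (min (\<tau> (Suc i)) t) \<omega> - W (min (\<tau> i) t) \<omega>)"
          using \<tau>(2)[OF i] by (auto simp: K_def min_def)
      qed simp
      with \<omega> show False by simp
    qed
  qed
  then have "measure N ?A \<le> measure N (?B \<union> ?C)" by (rule N.finite_measure_mono) (use Bm Cm in auto)
  also have "\<dots> \<le> measure N ?B + measure N ?C" by (rule measure_Un_le[OF Bm Cm])
  also have "measure N ?C \<le> (\<integral>\<omega>. (S \<omega>)\<^sup>2 \<partial>N) / \<eta>\<^sup>2"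
    using N.Chebyshev_second_moment[OF Sm iso(2) \<eta>] by simp
  also have "\<dots> \<le> \<delta> / \<eta>\<^sup>2" using S2 by (intro divide_right_mono) auto
  finally show ?thesis by simp
qed

section \<open>Joint measurability of integrands, and the bound for general integrands\<close>

lemma square_integral_measurable:
  fixes J :: "real \<Rightarrow> 'a \<Rightarrow> real"
  assumes "(\<lambda>(s, \<omega>). J s \<omega>) \<in> borel_measurable (restrict_space borel {0..T} \<Otimes>\<^sub>M N)"
  shows "(\<lambda>\<omega>. \<integral>\<^sup>+s\<in>{0..T}. ennreal ((J s \<omega>)\<^sup>2) \<partial>lborel) \<in> borel_measurable N"
proof -
  let ?L = "restrict_space lborel {0..T}"
  interpret L: sigma_finite_measure ?L
    by (rule sigma_finite_measure_restrict_space) (auto intro: lborel.sigma_finite_measure_axioms)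
  have "sets (restrict_space borel {0..T} \<Otimes>\<^sub>M N) = sets (?L \<Otimes>\<^sub>M N)"
    by (intro sets_pair_measure_cong sets_restrict_space_cong) auto
  then have [measurable]: "(\<lambda>(s, \<omega>). J s \<omega>) \<in> borel_measurable (?L \<Otimes>\<^sub>M N)"
    using assms measurable_cong_sets by blast
  have "(\<lambda>(\<omega>, s). J s \<omega>) \<in> borel_measurable (N \<Otimes>\<^sub>M ?L)"
    using measurable_pair_swap[OF \<open>(\<lambda>(s, \<omega>). J s \<omega>) \<in> borel_measurable (?L \<Otimes>\<^sub>M N)\<close>] by simp
  then have "(\<lambda>(\<omega>, s). ennreal ((J s \<omega>)\<^sup>2)) \<in> borel_measurable (N \<Otimes>\<^sub>M ?L)"
    unfolding split_beta' by measurable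
  then have "(\<lambda>\<omega>. \<integral>\<^sup>+s. ennreal ((J s \<omega>)\<^sup>2) \<partial>?L) \<in> borel_measurable N"
    by (rule L.borel_measurable_nn_integral)
  then show ?thesis by (subst (asm) nn_integral_restrict_space) auto
qed

lemma progressively_measurable_N:
  assumes "progressively_measurable F T H"
  shows "(\<lambda>(s, \<omega>). H s \<omega>) \<in> borel_measurable (restrict_space borel {0..T} \<Otimes>\<^sub>M N)"
proof -
  have "(\<lambda>(s, \<omega>). H s \<omega>) \<in> borel_measurable (restrict_space borel {0..T} \<Otimes>\<^sub>M F T)"
    using assms T_pos unfolding progressively_measurable_def by auto
  moreover have "(\<lambda>\<omega>. \<omega>) \<in> N \<rightarrow>\<^sub>M F T"
  proof (rule measurableI)
    fix B assume B: "B \<in> sets (F T)"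
    then have "B \<subseteq> space M" using sets.sets_into_space by fastforce
    then show "(\<lambda>\<omega>. \<omega>) -` B \<inter> space N \<in> sets N" using B sets_F_subset by (auto simp: Int_absorb2)
  qed simp
  then have "(\<lambda>x. (fst x, snd x)) \<in> restrict_space borel {0..T} \<Otimes>\<^sub>M N \<rightarrow>\<^sub>M restrict_space borel {0..T} \<Otimes>\<^sub>M F T"
    by (intro measurable_Pair measurable_fst measurable_compose[OF measurable_snd])
  ultimately show ?thesis using measurable_compose by fastforce
qed

lemma simple_process_measurable:
  assumes "simple_process_data M F T n \<tau> \<xi>"
  shows "(\<lambda>(s, \<omega>). simple_process n \<tau> \<xi> s \<omega>) \<in> borel_measurable (restrict_space borel {0..T} \<Otimes>\<^sub>M N)"
proof -
  have "(\<lambda>x. \<xi> i (snd x) * indicator {\<tau> i<..\<tau> (Suc i)} (fst x) :: real) \<in> borel_measurable (restrict_space borel {0..T} \<Otimes>\<^sub>M N)"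
    if "i \<in> {..<n}" for i
  proof -
    have "\<xi> i \<in> borel_measurable (F (\<tau> i))"
      using that assms unfolding simple_process_data_def by auto
    then have [measurable]: "\<xi> i \<in> borel_measurable N" by (rule measurable_F_N)
    have "(\<lambda>x. x) \<in> borel_measurable (restrict_space borel {0..T})" by (intro measurable_restrict_space1) simp
    then have [measurable]: "fst \<in> borel_measurable (restrict_space borel {0..T} \<Otimes>\<^sub>M N)"
      using measurable_compose[OF measurable_fst] by blast
    show ?thesis by measurable
  qed
  then show ?thesis unfolding simple_process_def split_beta' by (rule borel_measurable_sum)
qed

text \<open>The increment \<open>c * (W t - W 0)\<close> is the simple integral of the constant
  \<open>c\<close>, so an approximating simple integral minus it is the simple integral of the
  coefficients minus \<open>c\<close>. To that \<open>simple_integral_bound\<close> applies with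
  \<eta> / 2 and 4 \<delta>, the other half of \<eta> being left for the approximation of
  \<open>I\<close>; this gives 4 \<delta> / (\<eta> / 2)^2 = 16 \<delta> / \<eta>^2. By
  \<open>power2_diff_le\<close> a square integral above 4 \<delta> forces that of the approximation
  error or that of \<open>H - c\<close> above \<delta>, and the former becomes improbable in the
  limit.\<close>

lemma ito_integral_bound:
  assumes ito: "ito_integral M F T W H I" and t: "t \<in> {0..T}" and \<eta>: "0 < \<eta>" and \<delta>: "0 < \<delta>"
  shows "measure N {\<omega>\<in>space M. \<eta> < \<bar>I t \<omega> - c * (W t \<omega> - W 0 \<omega>)\<bar>}
     \<le> measure N {\<omega>\<in>space M. ennreal \<delta> < (\<integral>\<^sup>+s\<in>{0..T}. ennreal ((H s \<omega> - c)\<^sup>2) \<partial>lborel)} + 16 * \<delta> / \<eta>\<^sup>2"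
proof -
  have H: "progressively_measurable F T H" and I: "adapted_process F T I"
    using ito unfolding ito_integral_def by auto
  obtain n \<tau> \<xi> where *: "(\<forall>k. simple_process_data M F T (n k) (\<tau> k) (\<xi> k)) \<and>
        (\<forall>\<epsilon>>0. (\<lambda>k. measure N {\<omega>\<in>space M. ennreal \<epsilon> < (\<integral>\<^sup>+s\<in>{0..T}.
               ennreal ((simple_process (n k) (\<tau> k) (\<xi> k) s \<omega> - H s \<omega>)\<^sup>2) \<partial>lborel)}) \<longlonglongrightarrow> 0) \<and>
        (\<forall>t\<in>{0..T}. \<forall>\<epsilon>>0. (\<lambda>k. measure N {\<omega>\<in>space M.
             \<epsilon> < \<bar>simple_integral W (n k) (\<tau> k) (\<xi> k) t \<omega> - I t \<omega>\<bar>}) \<longlonglongrightarrow> 0)"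
    using ito unfolding ito_integral_def by - (elim conjE exE, rule that, intro conjI)
  then have D: "simple_process_data M F T (n k) (\<tau> k) (\<xi> k)" for k by (elim conjE allE)
  from * have H_lim: "(\<lambda>k. measure N {\<omega>\<in>space M. ennreal \<epsilon> < (\<integral>\<^sup>+s\<in>{0..T}.
               ennreal ((simple_process (n k) (\<tau> k) (\<xi> k) s \<omega> - H s \<omega>)\<^sup>2) \<partial>lborel)}) \<longlonglongrightarrow> 0" if "\<epsilon> > 0" for \<epsilon>
    using that by blast
  from * have I_lim: "(\<lambda>k. measure N {\<omega>\<in>space M.
             \<epsilon> < \<bar>simple_integral W (n k) (\<tau> k) (\<xi> k) t \<omega> - I t \<omega>\<bar>}) \<longlonglongrightarrow> 0" if "\<epsilon> > 0" for \<epsilon>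
    using that t by blast
  have It: "I t \<in> borel_measurable N" using I t unfolding adapted_process_def by (intro measurable_F_N[of _ t]) auto
  have [measurable]: "W t \<in> borel_measurable N" "W 0 \<in> borel_measurable N" using t W_measurable_N T_pos by auto
  note HN = progressively_measurable_N[OF H]
  define Pb where "Pb k = measure N {\<omega>\<in>space M. \<eta> / 2 < \<bar>simple_integral W (n k) (\<tau> k) (\<xi> k) t \<omega> - I t \<omega>\<bar>}" for k
  define Qb where "Qb k = measure N {\<omega>\<in>space M.
             ennreal \<delta> < (\<integral>\<^sup>+s\<in>{0..T}. ennreal ((simple_process (n k) (\<tau> k) (\<xi> k) s \<omega> - H s \<omega>)\<^sup>2) \<partial>lborel)}" for k
  define R where "R = measure N {\<omega>\<in>space M. ennreal \<delta> < (\<integral>\<^sup>+s\<in>{0..T}. ennreal ((H s \<omega> - c)\<^sup>2) \<partial>lborel)}"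
  let ?L = "measure N {\<omega>\<in>space M. \<eta> < \<bar>I t \<omega> - c * (W t \<omega> - W 0 \<omega>)\<bar>}"
  have "?L \<le> Pb k + (Qb k + R + 16 * \<delta> / \<eta>\<^sup>2)" for k
  proof -
    \<comment> \<open>Subtracting a constant needs a partition of all of [0, T]. So the stretches
      before the first and after the last partition point are added, with coefficient
      \<open>- c\<close> because the original simple process vanishes there.\<close>
    define n' where "n' = Suc (Suc (n k))"
    define \<tau>' where "\<tau>' i = (case i of 0 \<Rightarrow> 0 | Suc j \<Rightarrow> if j \<le> n k then \<tau> k j else T)" for i
    define \<xi>' where "\<xi>' i \<omega> = (case i of 0 \<Rightarrow> - c | Suc j \<Rightarrow> if j < n k then \<xi> k j \<omega> - c else - c)" for i and \<omega> :: 'a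
    have \<tau>: "\<And>i. i \<le> n k \<Longrightarrow> \<tau> k i \<in> {0..T}" "\<And>i. i < n k \<Longrightarrow> \<tau> k i \<le> \<tau> k (Suc i)"
      and \<xi>: "\<And>i. i < n k \<Longrightarrow> \<xi> k i \<in> borel_measurable (F (\<tau> k i))"
      using D[of k] unfolding simple_process_data_def by auto
    obtain C where C: "\<And>i \<omega>. i < n k \<Longrightarrow> \<omega> \<in> space M \<Longrightarrow> \<bar>\<xi> k i \<omega>\<bar> \<le> C"
      using D[of k] unfolding simple_process_data_def by metis
    have D': "simple_process_data M F T n' \<tau>' \<xi>'"
      unfolding simple_process_data_def
    proof (intro conjI allI impI)
      show "\<tau>' i \<in> {0..T}" for i using \<tau>(1) T_pos by (auto simp: \<tau>'_def split: nat.splits)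
      show "\<tau>' i \<le> \<tau>' (Suc i)" if "i < n'" for i
        using \<tau>(1)[of 0] \<tau>(1)[of "n k"] \<tau>(2) that by (auto simp: \<tau>'_def n'_def less_Suc_eq split: nat.splits)
      show "\<xi>' i \<in> borel_measurable (F (\<tau>' i))" if "i < n'" for i
      proof (cases "\<exists>j. i = Suc j \<and> j < n k")
        case True
        then show ?thesis using \<xi> by (auto simp: \<tau>'_def \<xi>'_def[abs_def])
      next
        case False
        then have "\<xi>' i = (\<lambda>_. - c)" by (auto simp: \<xi>'_def split: nat.splits)
        then show ?thesis by simp
      qed
      show "\<exists>C. \<forall>i<n'. \<forall>\<omega>\<in>space M. \<bar>\<xi>' i \<omega>\<bar> \<le> C"
      proof (intro exI[of _ "max C 0 + \<bar>c\<bar>"] allI impI ballI)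
        fix i \<omega> assume "i < n'" "\<omega> \<in> space M"
        then show "\<bar>\<xi>' i \<omega>\<bar> \<le> max C 0 + \<bar>c\<bar>"
        proof (cases i)
          case (Suc j)
          then show ?thesis using C[of j \<omega>] \<open>\<omega> \<in> space M\<close> abs_triangle_ineq4[of "\<xi> k j \<omega>" c] by (auto simp: \<xi>'_def)
        qed (simp add: \<xi>'_def)
      qed
    qed
    have SI: "simple_integral W n' \<tau>' \<xi>' t \<omega> = simple_integral W (n k) (\<tau> k) (\<xi> k) t \<omega> - c * (W t \<omega> - W 0 \<omega>)" for \<omega>
    proof -
      have "(\<Sum>i<n k. (\<xi> k i \<omega> - c) * (W (min (\<tau> k (Suc i)) t) \<omega> - W (min (\<tau> k i) t) \<omega>))
        = simple_integral W (n k) (\<tau> k) (\<xi> k) t \<omega> - c * (\<Sum>i<n k. W (min (\<tau> k (Suc i)) t) \<omega> - W (min (\<tau> k i) t) \<omega>)"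
        by (simp add: simple_integral_def sum_distrib_left sum_subtractf[symmetric] left_diff_distrib)
      also have "(\<Sum>i<n k. W (min (\<tau> k (Suc i)) t) \<omega> - W (min (\<tau> k i) t) \<omega>) = W (min (\<tau> k (n k)) t) \<omega> - W (min (\<tau> k 0) t) \<omega>"
        by (rule sum_lessThan_telescope)
      finally have *: "(\<Sum>i<n k. (\<xi> k i \<omega> - c) * (W (min (\<tau> k (Suc i)) t) \<omega> - W (min (\<tau> k i) t) \<omega>))
        = simple_integral W (n k) (\<tau> k) (\<xi> k) t \<omega> - c * (W (min (\<tau> k (n k)) t) \<omega> - W (min (\<tau> k 0) t) \<omega>)" .
      have "simple_integral W n' \<tau>' \<xi>' t \<omega> = - c * (W (min (\<tau> k 0) t) \<omega> - W (min 0 t) \<omega>)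
         + ((\<Sum>i<n k. (\<xi> k i \<omega> - c) * (W (min (\<tau> k (Suc i)) t) \<omega> - W (min (\<tau> k i) t) \<omega>))
          + - c * (W (min T t) \<omega> - W (min (\<tau> k (n k)) t) \<omega>))"
        unfolding simple_integral_def n'_def sum.lessThan_Suc_shift[of _ "Suc (n k)"] sum.lessThan_Suc[of _ "n k"]
        by (simp add: \<tau>'_def \<xi>'_def)
      moreover have "min 0 t = 0" "min T t = t" using t by auto
      ultimately show ?thesis using * by (simp add: algebra_simps)
    qed
    \<comment> \<open>Time 0 lies in no half-open interval, so the identity is claimed only for
      positive times; the missing point is discarded later as a Lebesgue null set.\<close>
    have SP: "simple_process n' \<tau>' \<xi>' s \<omega> = simple_process (n k) (\<tau> k) (\<xi> k) s \<omega> - c" if s: "s \<in> {0<..T}" for s \<omega>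
    proof -
      have 0: "(\<Sum>i<n k. indicator {\<tau> k i<..\<tau> k (Suc i)} s :: real) = indicator {\<tau> k 0<..\<tau> k (n k)} s"
        by (intro sum_indicator_partition \<tau>(2))
      have 1: "(\<Sum>i<n k. (\<xi> k i \<omega> - c) * indicator {\<tau> k i<..\<tau> k (Suc i)} s)
        = simple_process (n k) (\<tau> k) (\<xi> k) s \<omega> - c * indicator {\<tau> k 0<..\<tau> k (n k)} s"
        unfolding 0[symmetric] by (simp only: simple_process_def sum_distrib_left sum_subtractf left_diff_distrib)
      have 2: "simple_process n' \<tau>' \<xi>' s \<omega> = - c * indicator {0<..\<tau> k 0} s
        + ((\<Sum>i<n k. (\<xi> k i \<omega> - c) * indicator {\<tau> k i<..\<tau> k (Suc i)} s) + - c * indicator {\<tau> k (n k)<..T} s)"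
        unfolding simple_process_def n'_def sum.lessThan_Suc_shift[of _ "Suc (n k)"] sum.lessThan_Suc[of _ "n k"]
        by (simp add: \<tau>'_def \<xi>'_def)
      have "\<tau> k 0 \<le> \<tau> k (n k)" using partition_bounds[of "n k" "\<tau> k" 0 "n k"] \<tau>(2) by auto
      then show ?thesis unfolding 2 1 using s by (auto simp: indicator_def)
    qed
    let ?E1 = "{\<omega>\<in>space M. \<eta> / 2 < \<bar>simple_integral W (n k) (\<tau> k) (\<xi> k) t \<omega> - I t \<omega>\<bar>}"
    let ?E2 = "{\<omega>\<in>space M. \<eta> / 2 < \<bar>simple_integral W n' \<tau>' \<xi>' t \<omega>\<bar>}"
    let ?U = "\<lambda>\<omega>. \<integral>\<^sup>+s\<in>{0..T}. ennreal ((simple_process (n k) (\<tau> k) (\<xi> k) s \<omega> - H s \<omega>)\<^sup>2) \<partial>lborel"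
    let ?V = "\<lambda>\<omega>. \<integral>\<^sup>+s\<in>{0..T}. ennreal ((H s \<omega> - c)\<^sup>2) \<partial>lborel"
    let ?E3 = "{\<omega>\<in>space M. ennreal (4 * \<delta>) < (\<integral>\<^sup>+s\<in>{0..T}. ennreal ((simple_process n' \<tau>' \<xi>' s \<omega>)\<^sup>2) \<partial>lborel)}"
    note [measurable] = It simple_integral_measurable[OF D[of k] t] simple_integral_measurable[OF D' t]
    have Em: "?E1 \<in> sets N" "?E2 \<in> sets N"
      unfolding space_completion[of M, symmetric] by measurable
    have "(\<lambda>x. simple_process (n k) (\<tau> k) (\<xi> k) (fst x) (snd x) - H (fst x) (snd x)) \<in> borel_measurable (restrict_space borel {0..T} \<Otimes>\<^sub>M N)"
      using simple_process_measurable[OF D[of k]] HN unfolding split_beta' by (rule borel_measurable_diff)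
    then have [measurable]: "?U \<in> borel_measurable N" by (intro square_integral_measurable) (simp add: split_beta')
    have "(\<lambda>x. H (fst x) (snd x) - c) \<in> borel_measurable (restrict_space borel {0..T} \<Otimes>\<^sub>M N)"
      using HN unfolding split_beta' by (intro borel_measurable_diff) auto
    then have [measurable]: "?V \<in> borel_measurable N" by (intro square_integral_measurable) (simp add: split_beta')
    have Um: "{\<omega>\<in>space M. ennreal \<delta> < ?U \<omega>} \<in> sets N" "{\<omega>\<in>space M. ennreal \<delta> < ?V \<omega>} \<in> sets N"
      unfolding space_completion[of M, symmetric] by measurable
    have "?L \<le> measure N (?E1 \<union> ?E2)"
    proof (rule N.finite_measure_mono)
      show "{\<omega>\<in>space M. \<eta> < \<bar>I t \<omega> - c * (W t \<omega> - W 0 \<omega>)\<bar>} \<subseteq> ?E1 \<union> ?E2"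
      proof
        fix \<omega> assume "\<omega> \<in> {\<omega>\<in>space M. \<eta> < \<bar>I t \<omega> - c * (W t \<omega> - W 0 \<omega>)\<bar>}"
        then show "\<omega> \<in> ?E1 \<union> ?E2"
          unfolding SI Un_iff mem_Collect_eq by linarith
      qed
    qed (use Em in auto)
    also have "\<dots> \<le> Pb k + measure N ?E2" unfolding Pb_def by (rule measure_Un_le[OF Em])
    also have "measure N ?E2 \<le> measure N ?E3 + 4 * \<delta> / (\<eta> / 2)\<^sup>2"
      by (rule simple_integral_bound[OF D' t]) (use \<eta> \<delta> in auto)
    also have "measure N ?E3 \<le> measure N ({\<omega>\<in>space M. ennreal \<delta> < ?U \<omega>} \<union> {\<omega>\<in>space M. ennreal \<delta> < ?V \<omega>})"
    proof (rule N.finite_measure_mono)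
      show "?E3 \<subseteq> {\<omega>\<in>space M. ennreal \<delta> < ?U \<omega>} \<union> {\<omega>\<in>space M. ennreal \<delta> < ?V \<omega>}"
      proof safe
        fix \<omega> assume \<omega>: "\<omega> \<in> space M" "\<not> ennreal \<delta> < ?V \<omega>"
          "ennreal (4 * \<delta>) < (\<integral>\<^sup>+s\<in>{0..T}. ennreal ((simple_process n' \<tau>' \<xi>' s \<omega>)\<^sup>2) \<partial>lborel)"
        show "ennreal \<delta> < ?U \<omega>"
        proof (rule ccontr)
          assume "\<not> ennreal \<delta> < ?U \<omega>"
          have mU: "(\<lambda>s. ennreal ((simple_process (n k) (\<tau> k) (\<xi> k) s \<omega> - H s \<omega>)\<^sup>2) * indicator {0..T} s) \<in> borel_measurable lborel"
            and mV: "(\<lambda>s. ennreal ((H s \<omega> - c)\<^sup>2) * indicator {0..T} s) \<in> borel_measurable lborel"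
          proof -
            have [measurable]: "(\<lambda>s. H s \<omega>) \<in> borel_measurable (restrict_space borel {0..T})"
              using measurable_Pair_compose_split[OF HN, of "\<lambda>s. s" "restrict_space borel {0..T}" "\<lambda>_. \<omega>"] \<omega>(1) by simp
            have [measurable]: "(\<lambda>s. simple_process (n k) (\<tau> k) (\<xi> k) s \<omega>) \<in> borel_measurable (restrict_space borel {0..T})"
              using measurable_Pair_compose_split[OF simple_process_measurable[OF D[of k]], of "\<lambda>s. s" "restrict_space borel {0..T}" "\<lambda>_. \<omega>"] \<omega>(1) by simp
            have "(\<lambda>s. ennreal ((simple_process (n k) (\<tau> k) (\<xi> k) s \<omega> - H s \<omega>)\<^sup>2)) \<in> borel_measurable (restrict_space borel {0..T})"
              "(\<lambda>s. ennreal ((H s \<omega> - c)\<^sup>2)) \<in> borel_measurable (restrict_space borel {0..T})"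
              by measurable
            then show "(\<lambda>s. ennreal ((simple_process (n k) (\<tau> k) (\<xi> k) s \<omega> - H s \<omega>)\<^sup>2) * indicator {0..T} s) \<in> borel_measurable lborel"
              "(\<lambda>s. ennreal ((H s \<omega> - c)\<^sup>2) * indicator {0..T} s) \<in> borel_measurable lborel"
              unfolding measurable_lborel1
              by (auto intro!: borel_measurable_restrict_space_iff_ennreal[THEN iffD1])
          qed
          have "(\<integral>\<^sup>+s\<in>{0..T}. ennreal ((simple_process n' \<tau>' \<xi>' s \<omega>)\<^sup>2) \<partial>lborel)
             \<le> (\<integral>\<^sup>+s. (2 * (ennreal ((simple_process (n k) (\<tau> k) (\<xi> k) s \<omega> - H s \<omega>)\<^sup>2) * indicator {0..T} s)
               + 2 * (ennreal ((H s \<omega> - c)\<^sup>2) * indicator {0..T} s)) \<partial>lborel)"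
          proof (rule nn_integral_mono_AE)
            show "AE s in lborel. ennreal ((simple_process n' \<tau>' \<xi>' s \<omega>)\<^sup>2) * indicator {0..T} s
              \<le> 2 * (ennreal ((simple_process (n k) (\<tau> k) (\<xi> k) s \<omega> - H s \<omega>)\<^sup>2) * indicator {0..T} s)
               + 2 * (ennreal ((H s \<omega> - c)\<^sup>2) * indicator {0..T} s)"
              using AE_lborel_singleton[of 0]
            proof eventually_elim
              case (elim s)
              have "ennreal ((simple_process (n k) (\<tau> k) (\<xi> k) s \<omega> - c)\<^sup>2)
                \<le> ennreal (2 * (simple_process (n k) (\<tau> k) (\<xi> k) s \<omega> - H s \<omega>)\<^sup>2 + 2 * (H s \<omega> - c)\<^sup>2)"
                by (intro ennreal_leI power2_diff_le)
              also have "\<dots> = 2 * ennreal ((simple_process (n k) (\<tau> k) (\<xi> k) s \<omega> - H s \<omega>)\<^sup>2) + 2 * ennreal ((H s \<omega> - c)\<^sup>2)"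
                by (simp add: ennreal_mult)
              finally show ?case using elim SP[of s \<omega>] by (auto simp: indicator_def)
            qed
          qed
          also have "\<dots> = 2 * ?U \<omega> + 2 * ?V \<omega>"
            using mU mV by (simp add: nn_integral_add nn_integral_cmult)
          also have "\<dots> \<le> 2 * ennreal \<delta> + 2 * ennreal \<delta>"
            using \<open>\<not> ennreal \<delta> < ?U \<omega>\<close> \<omega>(2) by (intro add_mono mult_left_mono) auto
          also have "\<dots> = ennreal (2 * \<delta> + 2 * \<delta>)"
            using \<delta> by (simp add: ennreal_mult distrib_right[symmetric])
          finally show False using \<omega>(3) by simp
        qed
      qed
    qed (use Um in auto)
    also have "\<dots> \<le> Qb k + R" unfolding Qb_def R_def by (rule measure_Un_le[OF Um])
    also have "4 * \<delta> / (\<eta> / 2)\<^sup>2 = 16 * \<delta> / \<eta>\<^sup>2" by (simp add: power2_eq_square)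
    finally show ?thesis by simp
  qed
  moreover have "(\<lambda>k. Pb k + (Qb k + R + 16 * \<delta> / \<eta>\<^sup>2)) \<longlonglongrightarrow> 0 + (0 + R + 16 * \<delta> / \<eta>\<^sup>2)"
    unfolding Pb_def Qb_def by (intro tendsto_intros H_lim I_lim) (use \<eta> \<delta> in auto)
  ultimately have "?L \<le> 0 + (0 + R + 16 * \<delta> / \<eta>\<^sup>2)"
    by (intro LIMSEQ_le_const) auto
  then show ?thesis unfolding R_def by simp
qed

end

section \<open>Pathwise uniqueness\<close>

lemma set_integral_continuous:
  fixes h :: "real \<Rightarrow> real"
  assumes "continuous_on {a..b} h"
  shows "(LINT s:{a..b}|lborel. h s) = integral {a..b} h"
  by (rule set_borel_integral_eq_integral(2)[OF borel_integrable_atLeastAtMost'[OF assms]])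

lemma nn_integral_continuous:
  fixes h :: "real \<Rightarrow> real"
  assumes "continuous_on {a..b} h" "\<And>s. s \<in> {a..b} \<Longrightarrow> 0 \<le> h s"
  shows "(\<integral>\<^sup>+s\<in>{a..b}. ennreal (h s) \<partial>lborel) = ennreal (integral {a..b} h)"
proof -
  have "(\<integral>\<^sup>+s\<in>{a..b}. ennreal (h s) \<partial>lborel) = (\<integral>\<^sup>+s. ennreal (indicator {a..b} s *\<^sub>R h s) \<partial>lborel)"
    by (intro nn_integral_cong) (auto simp: indicator_def)
  also have "\<dots> = ennreal (\<integral>s. indicator {a..b} s *\<^sub>R h s \<partial>lborel)"
    using borel_integrable_atLeastAtMost'[OF assms(1)] assms(2) unfolding set_integrable_def
    by (intro nn_integral_eq_integral) (auto simp: indicator_def)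
  finally show ?thesis
    using set_integral_continuous[OF assms(1)] by (simp add: set_lebesgue_integral_def)
qed

text \<open>From some index on, all \<open>E k\<close> contain \<open>B\<close>, and their
  intersection is a null set. Convergence in probability thus yields an almost sure statement
  without passing to a subsequence and without measurability of \<open>B\<close>, whose later
  instances quantify over uncountably many times.\<close>

lemma (in finite_measure) AE_notin_if_small_covers:
  assumes "\<And>k::nat. E k \<in> sets M" "(\<lambda>k. measure M (E k)) \<longlonglongrightarrow> 0" "\<forall>\<^sub>F k in sequentially. B \<subseteq> E k"
  shows "AE \<omega> in M. \<omega> \<notin> B"
proof -
  obtain K where K: "\<And>k. k \<ge> K \<Longrightarrow> B \<subseteq> E k" using assms(3) unfolding eventually_sequentially by auto
  let ?I = "\<Inter>k\<in>{K..}. E k"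
  have I: "?I \<in> sets M" using assms(1) by (intro sets.countable_INT') auto
  have "measure M ?I \<le> measure M (E k)" if "k \<ge> K" for k
    using that assms(1) by (intro finite_measure_mono) auto
  then have "measure M ?I \<le> 0"
    by (intro LIMSEQ_le_const[OF assms(2)]) auto
  then have "measure M ?I = 0" using measure_nonneg[of M ?I] by linarith
  then have "?I \<in> null_sets M" using I by (intro null_setsI) (simp_all add: emeasure_eq_measure)
  then have "AE \<omega> in M. \<omega> \<notin> ?I" by (rule AE_not_in)
  then show ?thesis by eventually_elim (use K in auto)
qed

text \<open>As \<open>e \<rightarrow> 0\<close>, \<open>L1 (sabs e)\<close> concentrates at \<open>0\<close>, and its time integral along a solution recovers the
  regulator of that solution.\<close>

definition sabs :: "real \<Rightarrow> real \<Rightarrow> real" where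
  "sabs e x = sqrt (x\<^sup>2 + e\<^sup>2) - e"

context
  fixes e :: real
  assumes e: "0 < e"
begin

lemma sabs_pos: "0 < x\<^sup>2 + e\<^sup>2"
  using e by (simp add: add_nonneg_pos)

lemma deriv_sabs: "deriv (sabs e) = (\<lambda>x. x / sqrt (x\<^sup>2 + e\<^sup>2))"
  and sabs_has_deriv: "(sabs e has_real_derivative x / sqrt (x\<^sup>2 + e\<^sup>2)) (at x)"
proof -
  have *: "(sabs e has_real_derivative x / sqrt (x\<^sup>2 + e\<^sup>2)) (at x)" for x
    unfolding sabs_def[abs_def] using sabs_pos[of x]
    by (auto intro!: derivative_eq_intros simp: field_simps)
  then show "(sabs e has_real_derivative x / sqrt (x\<^sup>2 + e\<^sup>2)) (at x)" .
  show "deriv (sabs e) = (\<lambda>x. x / sqrt (x\<^sup>2 + e\<^sup>2))" using DERIV_imp_deriv[OF *] by auto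
qed

lemma deriv2_sabs: "deriv (deriv (sabs e)) = (\<lambda>x. e\<^sup>2 / sqrt (x\<^sup>2 + e\<^sup>2) ^ 3)"
  and deriv_sabs_has_deriv: "(deriv (sabs e) has_real_derivative e\<^sup>2 / sqrt (x\<^sup>2 + e\<^sup>2) ^ 3) (at x)"
proof -
  have *: "(deriv (sabs e) has_real_derivative e\<^sup>2 / sqrt (x\<^sup>2 + e\<^sup>2) ^ 3) (at x)" for x
  proof -
    define r where "r = sqrt (x\<^sup>2 + e\<^sup>2)"
    have r: "0 < r" "r\<^sup>2 = x\<^sup>2 + e\<^sup>2" using sabs_pos[of x] by (auto simp: r_def)
    have "((\<lambda>x. x / sqrt (x\<^sup>2 + e\<^sup>2)) has_real_derivative (1 * r - x * (inverse r / 2 * (2 * x))) / (r * r)) (at x)"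
      unfolding r_def using sabs_pos[of x]
      by (auto intro!: derivative_eq_intros)
    also have "(1 * r - x * (inverse r / 2 * (2 * x))) / (r * r) = e\<^sup>2 / r ^ 3"
    proof -
      have "(1 * r - x * (inverse r / 2 * (2 * x))) / (r * r) = (r\<^sup>2 - x\<^sup>2) / r ^ 3"
        using r(1) by (simp add: field_simps power2_eq_square power3_eq_cube)
      then show ?thesis using r(2) by simp
    qed
    finally show ?thesis unfolding deriv_sabs r_def .
  qed
  then show "(deriv (sabs e) has_real_derivative e\<^sup>2 / sqrt (x\<^sup>2 + e\<^sup>2) ^ 3) (at x)" .
  show "deriv (deriv (sabs e)) = (\<lambda>x. e\<^sup>2 / sqrt (x\<^sup>2 + e\<^sup>2) ^ 3)" using DERIV_imp_deriv[OF *] by auto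
qed

lemma L1_sabs: "L1 (sabs e) x = e\<^sup>2 / (2 * sqrt (x\<^sup>2 + e\<^sup>2) ^ 3)"
  by (simp add: L1_def deriv2_sabs)

lemma L1_sabs_nonneg: "0 \<le> L1 (sabs e) x"
  using sabs_pos[of x] by (simp add: L1_sabs)

lemma continuous_on_L1_sabs: "continuous_on A (L1 (sabs e))"
  unfolding L1_sabs[abs_def] using sabs_pos less_imp_neq[OF sabs_pos]
  by (intro continuous_intros) (auto simp: real_sqrt_eq_zero_cancel_iff)

lemma sabs_D_L1: "sabs e \<in> D_L1"
proof -
  have "continuous_on UNIV (\<lambda>x. 2 * L1 (sabs e) x)"
    by (intro continuous_intros continuous_on_L1_sabs)
  then have "continuous_on UNIV (deriv (deriv (sabs e)))" by (simp add: L1_def)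
  then show ?thesis
    using sabs_has_deriv deriv_sabs_has_deriv unfolding D_L1_def
    by (auto simp: real_differentiable_def deriv_sabs)
qed

text \<open>Write r for the root of x^2 + e^2. Then (r - x) r \<le> (r - x) (r + x) = e^2, hence (1
  - x / r)^2 \<le> e^4 / r^4 \<le> e^3 / r^3, and the last quotient is exactly
  \<open>2 * e * L1 (sabs e) x\<close>.\<close>

lemma deriv_sabs_bounds:
  assumes "0 \<le> x"
  shows "(deriv (sabs e) x)\<^sup>2 \<le> 1" "(deriv (sabs e) x - 1)\<^sup>2 \<le> 2 * e * L1 (sabs e) x"
proof -
  define r where "r = sqrt (x\<^sup>2 + e\<^sup>2)"
  have r: "0 < r" "r\<^sup>2 = x\<^sup>2 + e\<^sup>2" using sabs_pos[of x] by (auto simp: r_def)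
  have xr: "x \<le> r" unfolding r_def by (rule real_le_rsqrt) simp
  have er: "e \<le> r" unfolding r_def by (rule real_le_rsqrt) simp
  have "(x / r)\<^sup>2 \<le> 1\<^sup>2" using xr assms r(1) by (intro power_mono) auto
  then show "(deriv (sabs e) x)\<^sup>2 \<le> 1" by (simp add: deriv_sabs r_def)
  have "(r - x) * r \<le> (r - x) * (r + x)" using xr assms by (intro mult_left_mono) auto
  also have "\<dots> = e\<^sup>2" using r(2) by (simp add: algebra_simps power2_eq_square)
  finally have "((r - x) * r)\<^sup>2 \<le> (e\<^sup>2)\<^sup>2" using xr r by (intro power_mono) auto
  also have "\<dots> \<le> e ^ 3 * r" using er e by (simp add: power2_eq_square power3_eq_cube mult_left_mono)
  finally have 1: "((r - x) * r)\<^sup>2 \<le> e ^ 3 * r" .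
  have "(x / r - 1)\<^sup>2 = ((r - x) * r)\<^sup>2 / r ^ 4"
    using r(1) by (simp add: field_simps power2_eq_square eval_nat_numeral)
  also have "\<dots> \<le> e ^ 3 * r / r ^ 4" using 1 r(1) by (intro divide_right_mono) auto
  also have "\<dots> = 2 * e * (e\<^sup>2 / (2 * r ^ 3))" using r(1) by (simp add: field_simps eval_nat_numeral)
  finally show "(deriv (sabs e) x - 1)\<^sup>2 \<le> 2 * e * L1 (sabs e) x"
    by (simp add: deriv_sabs L1_sabs r_def)
qed

lemma sabs_bounds:
  assumes "0 \<le> x"
  shows "0 \<le> sabs e x" "sabs e x \<le> x" "x - e \<le> sabs e x"
proof -
  have "sqrt (x\<^sup>2 + e\<^sup>2) \<le> x + e" using assms e by (intro real_le_lsqrt) (auto simp: power2_sum)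
  then show "sabs e x \<le> x" by (simp add: sabs_def)
  have "x \<le> sqrt (x\<^sup>2 + e\<^sup>2)" using assms by (intro real_le_rsqrt) auto
  then show "x - e \<le> sabs e x" by (simp add: sabs_def)
  have "e \<le> sqrt (x\<^sup>2 + e\<^sup>2)" using assms by (intro real_le_rsqrt) auto
  then show "0 \<le> sabs e x" by (simp add: sabs_def)
qed

text \<open>Away from 0 the generator term is of order e^2 and disappears in the limit; this is the
  source of the flatness of \<open>X - W\<close> where \<open>X\<close> is positive.\<close>

lemma L1_sabs_le:
  assumes "0 < m" "m \<le> x"
  shows "L1 (sabs e) x \<le> e\<^sup>2 / (2 * m ^ 3)"
proof -
  have "m \<le> sqrt (x\<^sup>2 + e\<^sup>2)" using assms by (intro real_le_rsqrt) (simp add: add_increasing2 power_mono)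
  then have "m ^ 3 \<le> sqrt (x\<^sup>2 + e\<^sup>2) ^ 3" using assms by (intro power_mono) auto
  then show ?thesis unfolding L1_sabs using assms sabs_pos[of x]
    by (intro divide_left_mono) (auto intro!: mult_pos_pos)
qed

end

section \<open>The regulator of an arbitrary solution, recovered from the test functions
  \<open>sabs e\<close>\<close>

locale MP_solution = brownian M T W for M :: "'a measure" and T W +
  fixes x0 :: real and X :: "real \<Rightarrow> 'a \<Rightarrow> real"
  assumes x0: "0 \<le> x0" and sol: "strong_MP_solution M T W x0 X"
begin

lemma X_continuous: "\<omega> \<in> space M \<Longrightarrow> continuous_on {0..T} (\<lambda>t. X t \<omega>)"
  and X_nonneg: "t \<in> {0..T} \<Longrightarrow> \<omega> \<in> space M \<Longrightarrow> 0 \<le> X t \<omega>"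
  and X_0: "AE \<omega> in M. X 0 \<omega> = x0"
  using sol by (auto simp: strong_MP_solution_def continuous_paths_def nonneg_process_def)

lemma X_measurable: "t \<in> {0..T} \<Longrightarrow> X t \<in> borel_measurable N"
  using sol by (intro measurable_F_N[of _ t]) (auto simp: strong_MP_solution_def adapted_process_def)

definition drift :: "real \<Rightarrow> real \<Rightarrow> 'a \<Rightarrow> real" where
  "drift e t \<omega> = integral {0..t} (\<lambda>s. L1 (sabs e) (X s \<omega>))"

definition mart :: "real \<Rightarrow> real \<Rightarrow> 'a \<Rightarrow> real" where
  "mart e t \<omega> = sabs e (X t \<omega>) - sabs e x0 - drift e t \<omega>"

lemma continuous_on_L1_X:
  assumes "0 < e" "\<omega> \<in> space M" "S \<subseteq> {0..T}"
  shows "continuous_on S (\<lambda>s. L1 (sabs e) (X s \<omega>))"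
  using continuous_on_subset[OF X_continuous assms(3)] assms(1,2)
  by (intro continuous_on_compose2[OF continuous_on_L1_sabs[of e UNIV]]) auto

lemma drift_increment:
  assumes e: "0 < e" and \<omega>: "\<omega> \<in> space M" and ab: "0 \<le> a" "a \<le> b" "b \<le> T"
  shows "drift e b \<omega> - drift e a \<omega> = integral {a..b} (\<lambda>s. L1 (sabs e) (X s \<omega>))"
    and "0 \<le> drift e b \<omega> - drift e a \<omega>"
proof -
  have "(\<lambda>s. L1 (sabs e) (X s \<omega>)) integrable_on {0..b}"
    by (intro integrable_continuous_real continuous_on_L1_X e \<omega>) (use ab in auto)
  from Henstock_Kurzweil_Integration.integral_combine[OF ab(1,2) this]
  show *: "drift e b \<omega> - drift e a \<omega> = integral {a..b} (\<lambda>s. L1 (sabs e) (X s \<omega>))"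
    by (simp add: drift_def)
  show "0 \<le> drift e b \<omega> - drift e a \<omega>"
    unfolding * using L1_sabs_nonneg[OF e]
    by (intro Henstock_Kurzweil_Integration.integral_nonneg integrable_continuous_real continuous_on_L1_X e \<omega>) (use ab in auto)
qed

text \<open>Since \<open>X\<close> is nonnegative, the restricted and one-sided operators of the
  martingale problem coincide along its paths with the ordinary ones of \<open>sabs e\<close>. So
  \<open>mart e\<close> is the Ito integral that the martingale problem supplies, and
  \<open>ito_integral_bound\<close> applies.\<close>

lemma mart_bound:
  assumes e: "0 < e" and t: "t \<in> {0..T}" and \<eta>: "0 < \<eta>" and \<delta>: "0 < \<delta>"
  shows "mart e t \<in> borel_measurable N"
    and "measure N {\<omega>\<in>space M. \<eta> < \<bar>mart e t \<omega> - c * (W t \<omega> - W 0 \<omega>)\<bar>}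
     \<le> measure N {\<omega>\<in>space M. ennreal \<delta> < (\<integral>\<^sup>+s\<in>{0..T}. ennreal ((deriv (sabs e) (X s \<omega>) - c)\<^sup>2) \<partial>lborel)} + 16 * \<delta> / \<eta>\<^sup>2"
proof -
  define f where "f = restrict (sabs e) {0..}"
  have f: "f \<in> D_L1_Rplus" unfolding f_def D_L1_Rplus_def using sabs_D_L1[OF e] by auto
  define J where "J = (\<lambda>t \<omega>. f (X t \<omega>) - f x0 - (LINT s:{0..t}|lborel. L1_Rplus f (X s \<omega>)))"
  have ito: "ito_integral M F T W (\<lambda>t \<omega>. deriv_Rplus f (X t \<omega>)) J"
    using sol f unfolding strong_MP_solution_def J_def by blast
  have J: "J t \<omega> = mart e t \<omega>" if t: "t \<in> {0..T}" and \<omega>: "\<omega> \<in> space M" for t \<omega>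
  proof -
    have "(LINT s:{0..t}|lborel. L1_Rplus f (X s \<omega>)) = (LINT s:{0..t}|lborel. L1 (sabs e) (X s \<omega>))"
      using L1_Rplus_restrict[OF sabs_D_L1[OF e]] X_nonneg[OF _ \<omega>] t unfolding f_def
      by (intro set_lebesgue_integral_cong) auto
    also have "\<dots> = drift e t \<omega>"
      unfolding drift_def by (intro set_integral_continuous continuous_on_L1_X e \<omega>) (use t in auto)
    finally show ?thesis using X_nonneg[OF t \<omega>] x0 by (simp add: J_def mart_def f_def)
  qed
  have "J t \<in> borel_measurable N"
    using ito t unfolding ito_integral_def adapted_process_def by (intro measurable_F_N[of _ t]) auto
  then show "mart e t \<in> borel_measurable N"
    using J[OF t] by (subst measurable_cong[of N "mart e t" "J t"]) auto
  have d: "deriv_Rplus f (X s \<omega>) = deriv (sabs e) (X s \<omega>)" if "s \<in> {0..T}" "\<omega> \<in> space M" for s \<omega>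
    unfolding f_def using X_nonneg[OF that] by (intro deriv_Rplus_restrict sabs_D_L1[OF e])
  have 1: "{\<omega>\<in>space M. \<eta> < \<bar>J t \<omega> - c * (W t \<omega> - W 0 \<omega>)\<bar>} = {\<omega>\<in>space M. \<eta> < \<bar>mart e t \<omega> - c * (W t \<omega> - W 0 \<omega>)\<bar>}"
    using J[OF t] by auto
  have "(\<integral>\<^sup>+s\<in>{0..T}. ennreal ((deriv_Rplus f (X s \<omega>) - c)\<^sup>2) \<partial>lborel) = (\<integral>\<^sup>+s\<in>{0..T}. ennreal ((deriv (sabs e) (X s \<omega>) - c)\<^sup>2) \<partial>lborel)"
    if "\<omega> \<in> space M" for \<omega>
    using d that by (intro nn_integral_cong) (auto simp: indicator_def)
  then have 2: "{\<omega>\<in>space M. ennreal \<delta> < (\<integral>\<^sup>+s\<in>{0..T}. ennreal ((deriv_Rplus f (X s \<omega>) - c)\<^sup>2) \<partial>lborel)}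
    = {\<omega>\<in>space M. ennreal \<delta> < (\<integral>\<^sup>+s\<in>{0..T}. ennreal ((deriv (sabs e) (X s \<omega>) - c)\<^sup>2) \<partial>lborel)}"
    by auto
  show "measure N {\<omega>\<in>space M. \<eta> < \<bar>mart e t \<omega> - c * (W t \<omega> - W 0 \<omega>)\<bar>}
     \<le> measure N {\<omega>\<in>space M. ennreal \<delta> < (\<integral>\<^sup>+s\<in>{0..T}. ennreal ((deriv (sabs e) (X s \<omega>) - c)\<^sup>2) \<partial>lborel)} + 16 * \<delta> / \<eta>\<^sup>2"
    using ito_integral_bound[OF ito t \<eta> \<delta>, of c] unfolding 1 2 .
qed

lemma mart_measurable: "0 < e \<Longrightarrow> t \<in> {0..T} \<Longrightarrow> mart e t \<in> borel_measurable N"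
  using mart_bound(1)[of e t 1 1] by simp

text \<open>Obtained by solving the definition of \<open>mart\<close> for the drift: the
  measurability of \<open>mart e t\<close> comes with the Ito integral.\<close>

lemma drift_measurable:
  assumes "0 < e" "t \<in> {0..T}"
  shows "drift e t \<in> borel_measurable N"
proof -
  note [measurable] = mart_measurable[OF assms] X_measurable[OF assms(2)]
  have "(\<lambda>\<omega>. sabs e (X t \<omega>) - sabs e x0 - mart e t \<omega>) \<in> borel_measurable N"
    unfolding sabs_def by measurable
  then show ?thesis by (simp add: mart_def)
qed

abbreviation eps :: "nat \<Rightarrow> real" where "eps k \<equiv> inverse (real (Suc k))"

lemma eps_pos: "0 < eps k" by simp

text \<open>Multiplied by \<open>e\<close>, the equation for \<open>sabs e\<close> says that \<open>e * drift e\<close> tends to \<open>0\<close>.  As \<open>2 e * drift e\<close>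
  dominates the square integral of \<open>deriv (sabs e) (X) - 1\<close>, the martingale part converges to \<open>W\<close> itself.\<close>

lemma eps_drift_tendsto:
  assumes \<eta>: "0 < \<eta>"
  shows "(\<lambda>k. measure N {\<omega>\<in>space M. \<eta> < eps k * drift (eps k) T \<omega>}) \<longlonglongrightarrow> 0"
proof (rule tendsto_sandwich[OF _ _ tendsto_const])
  let ?E1 = "\<lambda>k. {\<omega>\<in>space M. \<eta> < eps k * drift (eps k) T \<omega>}"
  let ?E2 = "\<lambda>k. {\<omega>\<in>space M. \<eta> / 2 < eps k * X T \<omega>}"
  let ?E3 = "\<lambda>k. {\<omega>\<in>space M. \<eta> / 2 / eps k < \<bar>mart (eps k) T \<omega> - 0 * (W T \<omega> - W 0 \<omega>)\<bar>}"
  have T: "T \<in> {0..T}" using T_pos by simp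
  note [measurable] = X_measurable[OF T]
  have Xm: "?E2 k \<in> sets N" for k
    unfolding space_completion[of M, symmetric] by measurable
  have "measure N (?E1 k)
     \<le> measure N (?E2 k) + 16 * T / (\<eta> / 2 / eps k)\<^sup>2" for k
  proof -
    have [measurable]: "mart (eps k) T \<in> borel_measurable N" "W T \<in> borel_measurable N" "W 0 \<in> borel_measurable N"
      using mart_measurable[OF eps_pos T] W_measurable_N T_pos by auto
    have Im: "?E3 k \<in> sets N"
      unfolding space_completion[of M, symmetric] by measurable
    \<comment> \<open>The integrand lies between 0 and 1, so its square integral never exceeds T.
      With \<delta> = T and c = 0 the exceptional event is therefore empty, and what remains of the
      bound is of order \<open>(eps k)^2\<close>.\<close>
    have "{\<omega>\<in>space M. ennreal T < (\<integral>\<^sup>+s\<in>{0..T}. ennreal ((deriv (sabs (eps k)) (X s \<omega>) - 0)\<^sup>2) \<partial>lborel)} = {}"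
    proof -
      have "(\<integral>\<^sup>+s\<in>{0..T}. ennreal ((deriv (sabs (eps k)) (X s \<omega>) - 0)\<^sup>2) \<partial>lborel) \<le> ennreal T" if \<omega>: "\<omega> \<in> space M" for \<omega>
      proof -
        have "(\<integral>\<^sup>+s\<in>{0..T}. ennreal ((deriv (sabs (eps k)) (X s \<omega>) - 0)\<^sup>2) \<partial>lborel) \<le> (\<integral>\<^sup>+s. indicator {0..T} s \<partial>lborel)"
          using deriv_sabs_bounds(1)[OF eps_pos X_nonneg[OF _ \<omega>], of _ k]
          by (intro nn_integral_mono) (auto simp: indicator_def)
        then show ?thesis using T_pos by simp
      qed
      then show ?thesis by (auto simp: not_less[symmetric])
    qed
    moreover have "0 < \<eta> / 2 / eps k" using \<eta> by simp
    ultimately have I: "measure N (?E3 k) \<le> 16 * T / (\<eta> / 2 / eps k)\<^sup>2"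
      using mart_bound(2)[OF eps_pos T _ T_pos, of "\<eta> / 2 / eps k" k 0] by (simp only: measure_empty add_0)
    have "measure N (?E1 k)
      \<le> measure N (?E2 k \<union> ?E3 k)"
    proof (rule N.finite_measure_mono)
      show "?E1 k \<subseteq> ?E2 k \<union> ?E3 k"
      proof
        fix \<omega> assume "\<omega> \<in> ?E1 k"
        then have \<omega>: "\<omega> \<in> space M" "\<eta> < eps k * drift (eps k) T \<omega>" by auto
        have "drift (eps k) T \<omega> \<le> X T \<omega> + \<bar>mart (eps k) T \<omega>\<bar>"
          using sabs_bounds[OF eps_pos X_nonneg[OF T \<omega>(1)], of k] sabs_bounds(1)[OF eps_pos x0, of k]
          unfolding mart_def by linarith
        then have "eps k * drift (eps k) T \<omega> \<le> eps k * (X T \<omega> + \<bar>mart (eps k) T \<omega>\<bar>)"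
          by (intro mult_left_mono) auto
        then have "\<eta> < eps k * X T \<omega> + eps k * \<bar>mart (eps k) T \<omega>\<bar>" using \<omega>(2) by (simp add: distrib_left)
        then have "\<eta> / 2 < eps k * X T \<omega> \<or> \<eta> / 2 < eps k * \<bar>mart (eps k) T \<omega>\<bar>" by linarith
        moreover have "\<eta> / 2 < eps k * \<bar>mart (eps k) T \<omega>\<bar> \<longleftrightarrow> \<eta> / 2 / eps k < \<bar>mart (eps k) T \<omega>\<bar>"
          using eps_pos[of k] by (subst pos_divide_less_eq) (auto simp: mult.commute)
        ultimately show "\<omega> \<in> ?E2 k \<union> ?E3 k"
          using \<omega>(1) by auto
      qed
    qed (rule sets.Un[OF Xm Im])
    also have "\<dots> \<le> measure N (?E2 k) + measure N (?E3 k)"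
      by (rule measure_Un_le[OF Xm Im])
    finally show ?thesis using I by linarith
  qed
  then show "\<forall>\<^sub>F k in sequentially. measure N (?E1 k)
     \<le> measure N (?E2 k) + 16 * T / (\<eta> / 2 / eps k)\<^sup>2" by auto
  \<comment> \<open>No moment bound on \<open>X T\<close> is at hand; instead the events decrease to
    the empty set because \<open>X T\<close> is finite and nonnegative.\<close>
  have "(\<lambda>k. measure N (?E2 k)) \<longlonglongrightarrow> measure N (\<Inter>k. ?E2 k)"
  proof (rule N.finite_Lim_measure_decseq)
    show "decseq (\<lambda>k. ?E2 k)"
    proof (rule decseq_SucI, safe)
      fix k \<omega> assume "\<omega> \<in> space M" "\<eta> / 2 < eps (Suc k) * X T \<omega>"
      moreover have "eps (Suc k) * X T \<omega> \<le> eps k * X T \<omega>"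
        using X_nonneg[OF T \<open>\<omega> \<in> space M\<close>] by (intro mult_right_mono le_imp_inverse_le) auto
      ultimately show "\<eta> / 2 < eps k * X T \<omega>" by linarith
    qed
  qed (use Xm in auto)
  also have "(\<Inter>k. ?E2 k) = {}"
  proof -
    have "\<exists>k. \<not> \<eta> / 2 < eps k * X T \<omega>" for \<omega>
    proof -
      have "(\<lambda>k. eps k * X T \<omega>) \<longlonglongrightarrow> 0 * X T \<omega>" by (intro tendsto_intros LIMSEQ_inverse_real_of_nat)
      then have "\<forall>\<^sub>F k in sequentially. eps k * X T \<omega> < \<eta> / 2"
        by (rule order_tendstoD(2)) (use \<eta> in simp)
      then show ?thesis by (blast dest: eventually_happens'[OF sequentially_bot] less_not_sym)
    qed
    then show ?thesis by auto
  qed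
  finally have 1: "(\<lambda>k. measure N (?E2 k)) \<longlonglongrightarrow> 0" by simp
  have "16 * T / (\<eta> / 2 / eps k)\<^sup>2 = 64 * T / \<eta>\<^sup>2 * (eps k * eps k)" for k
    using \<eta> by (simp add: power2_eq_square divide_simps)
  moreover have "(\<lambda>k. 64 * T / \<eta>\<^sup>2 * (eps k * eps k)) \<longlonglongrightarrow> 64 * T / \<eta>\<^sup>2 * (0 * 0)"
    by (intro tendsto_intros LIMSEQ_inverse_real_of_nat)
  ultimately have 2: "(\<lambda>k. 16 * T / (\<eta> / 2 / eps k)\<^sup>2) \<longlonglongrightarrow> 0" by simp
  show "(\<lambda>k. measure N (?E2 k) + 16 * T / (\<eta> / 2 / eps k)\<^sup>2) \<longlonglongrightarrow> 0"
    using tendsto_add[OF 1 2] by simp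
qed auto

lemma mart_tendsto_W:
  assumes t: "t \<in> {0..T}" and \<eta>: "0 < \<eta>"
  shows "(\<lambda>k. measure N {\<omega>\<in>space M. \<eta> < \<bar>mart (eps k) t \<omega> - (W t \<omega> - W 0 \<omega>)\<bar>}) \<longlonglongrightarrow> 0"
proof (rule LIMSEQ_I)
  fix r :: real assume r: "0 < r"
  have T: "T \<in> {0..T}" using T_pos by simp
  \<comment> \<open>Chosen so that the term 16 \<delta> / \<eta>^2 of \<open>mart_bound\<close>
    equals r / 4. The other term, with c = 1, is dominated by \<open>?Q k\<close>, which drops below
    r / 4 eventually.\<close>
  define \<delta> where "\<delta> = r * \<eta>\<^sup>2 / 64"
  have \<delta>: "0 < \<delta>" using r \<eta> by (simp add: \<delta>_def)
  let ?P = "\<lambda>k. measure N {\<omega>\<in>space M. \<eta> < \<bar>mart (eps k) t \<omega> - (W t \<omega> - W 0 \<omega>)\<bar>}"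
  let ?Q = "\<lambda>k. measure N {\<omega>\<in>space M. \<delta> / 2 < eps k * drift (eps k) T \<omega>}"
  let ?U = "\<lambda>k \<omega>. \<integral>\<^sup>+s\<in>{0..T}. ennreal ((deriv (sabs (eps k)) (X s \<omega>) - 1)\<^sup>2) \<partial>lborel"
  have "?P k \<le> ?Q k + r / 4" for k
  proof -
    note [measurable] = drift_measurable[OF eps_pos T, of k]
    have Am: "{\<omega>\<in>space M. \<delta> / 2 < eps k * drift (eps k) T \<omega>} \<in> sets N"
      unfolding space_completion[of M, symmetric] by measurable
    have "?U k \<omega> \<le> ennreal (2 * eps k * drift (eps k) T \<omega>)" if \<omega>: "\<omega> \<in> space M" for \<omega>
    proof -
      have "?U k \<omega>
        \<le> (\<integral>\<^sup>+s\<in>{0..T}. ennreal (2 * eps k * L1 (sabs (eps k)) (X s \<omega>)) \<partial>lborel)"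
        using deriv_sabs_bounds(2)[OF eps_pos X_nonneg[OF _ \<omega>], of _ k]
        by (intro nn_integral_mono) (auto simp: indicator_def intro!: ennreal_leI simp del: of_nat_Suc)
      also have "\<dots> = ennreal (integral {0..T} (\<lambda>s. 2 * eps k * L1 (sabs (eps k)) (X s \<omega>)))"
        using L1_sabs_nonneg[OF eps_pos, of k]
        by (intro nn_integral_continuous continuous_intros continuous_on_L1_X eps_pos \<omega>) auto
      also have "integral {0..T} (\<lambda>s. 2 * eps k * L1 (sabs (eps k)) (X s \<omega>)) = 2 * eps k * drift (eps k) T \<omega>"
        by (simp add: drift_def)
      finally show ?thesis .
    qed
    then have "measure N {\<omega>\<in>space M. ennreal \<delta> < ?U k \<omega>}
      \<le> ?Q k"
    proof (intro N.finite_measure_mono subsetI)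
      fix \<omega> assume le: "\<And>\<omega>. \<omega> \<in> space M \<Longrightarrow> ?U k \<omega> \<le> ennreal (2 * eps k * drift (eps k) T \<omega>)"
        and "\<omega> \<in> {\<omega>\<in>space M. ennreal \<delta> < ?U k \<omega>}"
      then have \<omega>: "\<omega> \<in> space M" "ennreal \<delta> < ?U k \<omega>" by auto
      have "ennreal \<delta> < ennreal (2 * eps k * drift (eps k) T \<omega>)" using less_le_trans[OF \<omega>(2) le[OF \<omega>(1)]] .
      then have "\<delta> < 2 * eps k * drift (eps k) T \<omega>" using \<delta> by (subst (asm) ennreal_less_iff) auto
      then show "\<omega> \<in> {\<omega>\<in>space M. \<delta> / 2 < eps k * drift (eps k) T \<omega>}" using \<omega>(1) by simp
    qed (use Am in auto)
    moreover have "16 * \<delta> / \<eta>\<^sup>2 = r / 4" using \<eta> by (simp add: \<delta>_def)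
    ultimately show ?thesis using mart_bound(2)[OF eps_pos t \<eta> \<delta>, of k 1] unfolding mult_1 by linarith
  qed
  moreover have "\<exists>no. \<forall>k\<ge>no. norm (?Q k - 0) < r / 4"
    by (rule LIMSEQ_D[OF eps_drift_tendsto]) (use \<delta> r in auto)
  ultimately show "\<exists>no. \<forall>k\<ge>no. norm (?P k - 0) < r"
  proof (elim exE, intro exI allI impI)
    fix no k assume le: "\<And>k. ?P k \<le> ?Q k + r / 4"
      and no: "\<forall>k\<ge>no. norm (?Q k - 0) < r / 4" "no \<le> k"
    have "?Q k < r / 4"
      using no(1)[THEN spec, THEN mp, OF no(2)] by simp
    then show "norm (?P k - 0) < r"
      using le[of k] r measure_nonneg[of N "{\<omega>\<in>space M. \<eta> < \<bar>mart (eps k) t \<omega> - (W t \<omega> - W 0 \<omega>)\<bar>}"]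
      unfolding real_norm_def by linarith
  qed
qed

text \<open>At two fixed times the approximation errors exceed \<open>\<eta>\<close> with vanishing
  probability, so a bad event that forces such an error for all large k is negligible. The two
  increment lemmas for \<open>X - W\<close> are instances.\<close>

lemma AE_notin_error_sets:
  assumes ab: "a \<in> {0..T}" "b \<in> {0..T}" and \<eta>: "0 < \<eta>"
    and B: "\<forall>\<^sub>F k in sequentially. \<forall>\<omega>\<in>B. \<omega> \<in> space M \<and>
       (\<eta> < \<bar>mart (eps k) a \<omega> - (W a \<omega> - W 0 \<omega>)\<bar> \<or> \<eta> < \<bar>mart (eps k) b \<omega> - (W b \<omega> - W 0 \<omega>)\<bar>)"
  shows "AE \<omega> in N. \<omega> \<notin> B"
proof (rule N.AE_notin_if_small_covers)
  define E where "E t k = {\<omega>\<in>space M. \<eta> < \<bar>mart (eps k) t \<omega> - (W t \<omega> - W 0 \<omega>)\<bar>}" for t and k :: nat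
  have Em: "E t k \<in> sets N" if t: "t \<in> {0..T}" for t k
  proof -
    have [measurable]: "mart (eps k) t \<in> borel_measurable N" "W t \<in> borel_measurable N" "W 0 \<in> borel_measurable N"
      using mart_measurable[OF eps_pos t] W_measurable_N t T_pos by auto
    show ?thesis unfolding E_def space_completion[of M, symmetric] by measurable
  qed
  show "E a k \<union> E b k \<in> sets N" for k using Em ab by auto
  show "(\<lambda>k. measure N (E a k \<union> E b k)) \<longlonglongrightarrow> 0"
  proof (rule tendsto_sandwich[OF _ _ tendsto_const])
    show "\<forall>\<^sub>F k in sequentially. measure N (E a k \<union> E b k) \<le> measure N (E a k) + measure N (E b k)"
      by (intro always_eventually allI measure_Un_le Em ab)
    show "(\<lambda>k. measure N (E a k) + measure N (E b k)) \<longlonglongrightarrow> 0"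
      using tendsto_add[OF mart_tendsto_W[OF ab(1) \<eta>] mart_tendsto_W[OF ab(2) \<eta>]] by (simp add: E_def)
  qed auto
  show "\<forall>\<^sub>F k in sequentially. B \<subseteq> E a k \<union> E b k"
    using B by eventually_elim (auto simp: E_def)
qed

text \<open>By x - e \<le> sabs e x \<le> x the replacement errors at \<open>a\<close> and
  \<open>b\<close> have the same sign and size at most \<open>e\<close>, so their difference costs a
  single \<open>e\<close>.\<close>

lemma increment_error:
  assumes e: "0 < e" and \<omega>: "\<omega> \<in> space M" and ab: "a \<in> {0..T}" "b \<in> {0..T}"
  shows "\<bar>(X b \<omega> - W b \<omega>) - (X a \<omega> - W a \<omega>) - (drift e b \<omega> - drift e a \<omega>)\<bar>
    \<le> \<bar>mart e a \<omega> - (W a \<omega> - W 0 \<omega>)\<bar> + \<bar>mart e b \<omega> - (W b \<omega> - W 0 \<omega>)\<bar> + e"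
  using sabs_bounds[OF e X_nonneg[OF ab(1) \<omega>]] sabs_bounds[OF e X_nonneg[OF ab(2) \<omega>]]
  unfolding mart_def by linarith

lemma eventually_eps_less: "0 < r \<Longrightarrow> \<forall>\<^sub>F k in sequentially. eps k < r"
  using LIMSEQ_inverse_real_of_nat by (rule order_tendstoD(2))

text \<open>The drift increases, so a drop of \<open>X - W\<close> by more than \<eta> must be paid
  for by the three errors of \<open>increment_error\<close>. Once \<open>eps k\<close> is below
  \<eta> / 3, one of the two martingale errors exceeds \<eta> / 3.\<close>

lemma AE_increment_nonneg:
  assumes ab: "0 \<le> a" "a \<le> b" "b \<le> T" and \<eta>: "0 < \<eta>"
  shows "AE \<omega> in N. X a \<omega> - W a \<omega> \<le> X b \<omega> - W b \<omega> + \<eta>"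
proof -
  have ab': "a \<in> {0..T}" "b \<in> {0..T}" using ab by auto
  define B where "B = {\<omega>\<in>space M. X b \<omega> - W b \<omega> + \<eta> < X a \<omega> - W a \<omega>}"
  have "AE \<omega> in N. \<omega> \<notin> B"
  proof (rule AE_notin_error_sets[OF ab'])
    show "\<forall>\<^sub>F k in sequentially. \<forall>\<omega>\<in>B. \<omega> \<in> space M \<and>
       (\<eta> / 3 < \<bar>mart (eps k) a \<omega> - (W a \<omega> - W 0 \<omega>)\<bar> \<or> \<eta> / 3 < \<bar>mart (eps k) b \<omega> - (W b \<omega> - W 0 \<omega>)\<bar>)"
    proof (rule eventually_mono[OF eventually_eps_less[of "\<eta> / 3"]])
      show "0 < \<eta> / 3" using \<eta> by simp
    next
      fix k assume k: "eps k < \<eta> / 3"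
      show "\<forall>\<omega>\<in>B. \<omega> \<in> space M \<and>
       (\<eta> / 3 < \<bar>mart (eps k) a \<omega> - (W a \<omega> - W 0 \<omega>)\<bar> \<or> \<eta> / 3 < \<bar>mart (eps k) b \<omega> - (W b \<omega> - W 0 \<omega>)\<bar>)"
      proof
      fix \<omega> assume "\<omega> \<in> B"
      then have \<omega>: "\<omega> \<in> space M" "X b \<omega> - W b \<omega> + \<eta> < X a \<omega> - W a \<omega>" by (auto simp: B_def)
      then show "\<omega> \<in> space M \<and> (\<eta> / 3 < \<bar>mart (eps k) a \<omega> - (W a \<omega> - W 0 \<omega>)\<bar> \<or> \<eta> / 3 < \<bar>mart (eps k) b \<omega> - (W b \<omega> - W 0 \<omega>)\<bar>)"
        using increment_error[OF eps_pos \<omega>(1) ab', of k] drift_increment(2)[OF eps_pos \<omega>(1) ab, of k] k by argo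
      qed
    qed
  qed (use \<eta> in simp)
  then show ?thesis using AE_space by eventually_elim (auto simp: B_def not_less)
qed

text \<open>On paths staying above m the drift over [a, b] is at most c times
  \<open>(eps k)^2\<close> by \<open>L1_sabs_le\<close>. A rise by more than \<eta> is therefore
  shared among four contributions: the drift, \<open>eps k\<close>, and the two martingale
  errors.\<close>

lemma AE_increment_flat:
  assumes ab: "0 \<le> a" "a \<le> b" "b \<le> T" and \<eta>: "0 < \<eta>" and m: "0 < m"
  shows "AE \<omega> in N. (\<forall>u\<in>{a..b}. m \<le> X u \<omega>) \<longrightarrow> X b \<omega> - W b \<omega> \<le> X a \<omega> - W a \<omega> + \<eta>"
proof -
  have ab': "a \<in> {0..T}" "b \<in> {0..T}" using ab by auto
  define B where "B = {\<omega>\<in>space M. (\<forall>u\<in>{a..b}. m \<le> X u \<omega>) \<and> X a \<omega> - W a \<omega> + \<eta> < X b \<omega> - W b \<omega>}"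
  define c where "c = T / (2 * m ^ 3)"
  have c: "0 < c" using T_pos m by (simp add: c_def)
  have "AE \<omega> in N. \<omega> \<notin> B"
  proof (rule AE_notin_error_sets[OF ab'])
    \<comment> \<open>The bound 1 trades the square of \<open>eps k\<close> for
      \<open>eps k\<close>; the other two bounds keep drift and replacement error below \<eta> / 4
      each.\<close>
    have "\<forall>\<^sub>F k in sequentially. eps k < min 1 (\<eta> / (4 * c)) \<and> eps k < \<eta> / 4"
      using c \<eta> by (intro eventually_conj eventually_eps_less) auto
    then show "\<forall>\<^sub>F k in sequentially. \<forall>\<omega>\<in>B. \<omega> \<in> space M \<and>
       (\<eta> / 4 < \<bar>mart (eps k) a \<omega> - (W a \<omega> - W 0 \<omega>)\<bar> \<or> \<eta> / 4 < \<bar>mart (eps k) b \<omega> - (W b \<omega> - W 0 \<omega>)\<bar>)"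
    proof (elim eventually_mono, intro ballI)
      fix k \<omega> assume k: "eps k < min 1 (\<eta> / (4 * c)) \<and> eps k < \<eta> / 4" and "\<omega> \<in> B"
      then have \<omega>: "\<omega> \<in> space M" "\<forall>u\<in>{a..b}. m \<le> X u \<omega>" "X a \<omega> - W a \<omega> + \<eta> < X b \<omega> - W b \<omega>" by (auto simp: B_def)
      have "drift (eps k) b \<omega> - drift (eps k) a \<omega> \<le> integral {a..b} (\<lambda>_. (eps k)\<^sup>2 / (2 * m ^ 3))"
        unfolding drift_increment(1)[OF eps_pos \<omega>(1) ab] using L1_sabs_le[OF eps_pos m] \<omega>(2) ab
        by (intro integral_le integrable_continuous_real continuous_on_L1_X eps_pos \<omega>(1)) auto
      also have "\<dots> = (b - a) * ((eps k)\<^sup>2 / (2 * m ^ 3))" using ab by simp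
      also have "\<dots> \<le> T * ((eps k)\<^sup>2 / (2 * m ^ 3))" using ab m by (intro mult_right_mono) auto
      also have "\<dots> = c * (eps k * eps k)" by (simp add: c_def power2_eq_square)
      also have "\<dots> \<le> c * (1 * eps k)" using k c by (intro mult_left_mono mult_right_mono) auto
      also have "\<dots> \<le> c * (\<eta> / (4 * c))" using k c by (intro mult_left_mono) auto
      also have "\<dots> = \<eta> / 4" using c by simp
      finally have "drift (eps k) b \<omega> - drift (eps k) a \<omega> \<le> \<eta> / 4" .
      then show "\<omega> \<in> space M \<and> (\<eta> / 4 < \<bar>mart (eps k) a \<omega> - (W a \<omega> - W 0 \<omega>)\<bar> \<or> \<eta> / 4 < \<bar>mart (eps k) b \<omega> - (W b \<omega> - W 0 \<omega>)\<bar>)"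
        using increment_error[OF eps_pos \<omega>(1) ab', of k] \<omega>(1,3) conjunct2[OF k] by argo
    qed
  qed (use \<eta> in simp)
  then show ?thesis using AE_space by eventually_elim (auto simp: B_def not_less)
qed

text \<open>Rational times and thresholds \<open>eps i\<close>, \<open>eps j\<close> leave countably
  many exceptional sets. A path positive on the compact interval [a, b] attains a positive minimum
  there, hence stays above some \<open>eps i\<close>, and the tolerance \<open>eps j\<close> is sent
  to 0.\<close>

lemma AE_skorokhod:
  "AE \<omega> in N. \<forall>a\<in>\<rat>. \<forall>b\<in>\<rat>. 0 \<le> a \<longrightarrow> a \<le> b \<longrightarrow> b \<le> T \<longrightarrow>
     X a \<omega> - W a \<omega> \<le> X b \<omega> - W b \<omega> \<and>
     ((\<forall>u\<in>{a..b}. 0 < X u \<omega>) \<longrightarrow> X b \<omega> - W b \<omega> \<le> X a \<omega> - W a \<omega>)"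
proof (intro AE_ball_countable[THEN iffD2] ballI countable_rat)
  fix a b :: real
  show "AE \<omega> in N. 0 \<le> a \<longrightarrow> a \<le> b \<longrightarrow> b \<le> T \<longrightarrow> X a \<omega> - W a \<omega> \<le> X b \<omega> - W b \<omega> \<and>
     ((\<forall>u\<in>{a..b}. 0 < X u \<omega>) \<longrightarrow> X b \<omega> - W b \<omega> \<le> X a \<omega> - W a \<omega>)"
  proof (cases "0 \<le> a \<and> a \<le> b \<and> b \<le> T")
    case True
    then have ab: "0 \<le> a" "a \<le> b" "b \<le> T" by auto
    have "AE \<omega> in N. \<forall>j. X a \<omega> - W a \<omega> \<le> X b \<omega> - W b \<omega> + eps j"
      using AE_increment_nonneg[OF ab eps_pos] by (simp add: AE_all_countable)
    moreover have "AE \<omega> in N. \<forall>i j. (\<forall>u\<in>{a..b}. eps i \<le> X u \<omega>) \<longrightarrow> X b \<omega> - W b \<omega> \<le> X a \<omega> - W a \<omega> + eps j"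
      using AE_increment_flat[OF ab eps_pos eps_pos] by (simp only: AE_all_countable) blast
    ultimately show ?thesis using AE_space
    proof eventually_elim
      case (elim \<omega>)
      have limit: "x \<le> y" if le: "\<And>j. x \<le> y + eps j" for x y :: real
      proof -
        have "(\<lambda>j. y + eps j) \<longlonglongrightarrow> y + 0" by (intro tendsto_intros LIMSEQ_inverse_real_of_nat)
        then show ?thesis using le by (intro LIMSEQ_le_const[of _ y]) auto
      qed
      have "X b \<omega> - W b \<omega> \<le> X a \<omega> - W a \<omega>" if pos: "\<forall>u\<in>{a..b}. 0 < X u \<omega>"
      proof -
        have "continuous_on {a..b} (\<lambda>u. X u \<omega>)"
          by (rule continuous_on_subset[OF X_continuous]) (use ab elim in auto)
        then obtain v where v: "v \<in> {a..b}" "\<forall>u\<in>{a..b}. X v \<omega> \<le> X u \<omega>"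
          using continuous_attains_inf[of "{a..b}" "\<lambda>u. X u \<omega>"] ab by auto
        have "0 < X v \<omega>" using pos v(1) by simp
        then obtain i where "eps i < X v \<omega>" using reals_Archimedean by blast
        then have *: "\<forall>u\<in>{a..b}. eps i \<le> X u \<omega>"
        proof (intro ballI)
          fix u assume "u \<in> {a..b}"
          then have "X v \<omega> \<le> X u \<omega>" using v(2) by blast
          with \<open>eps i < X v \<omega>\<close> show "eps i \<le> X u \<omega>" by linarith
        qed
        show ?thesis by (rule limit) (rule elim(2)[THEN spec, THEN spec, THEN mp, OF *])
      qed
      moreover have "X a \<omega> - W a \<omega> \<le> X b \<omega> - W b \<omega>" by (rule limit) (rule elim(1)[THEN spec])
      ultimately show ?case by simp
    qed
  next
    case False then show ?thesis by auto
  qed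
qed

end

lemma strong_MP_solution_unique:
  assumes BM: "brownian_motion M T W" "0 < T"
    and x: "0 \<le> x1" "0 \<le> x2"
    and sol: "strong_MP_solution M T W x1 X1" "strong_MP_solution M T W x2 X2"
    and eq: "AE \<omega> in M. X1 0 \<omega> = X2 0 \<omega>"
  shows "indistinguishable M T X1 X2"
proof -
  interpret B: brownian M T W using BM by unfold_locales
  interpret s1: MP_solution M T W x1 X1 using x sol by unfold_locales
  interpret s2: MP_solution M T W x2 X2 using x sol by unfold_locales
  have "AE \<omega> in B.N. X1 0 \<omega> = X2 0 \<omega>" using eq by (rule AE_completion)
  then have "AE \<omega> in B.N. \<forall>t\<in>{0..T}. X1 t \<omega> = X2 t \<omega>"
    using s1.AE_skorokhod s2.AE_skorokhod AE_space
  proof eventually_elim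
    case (elim \<omega>)
    then have \<omega>: "\<omega> \<in> space M" by simp
    show ?case
    proof (intro ballI antisym)
      fix t assume t: "t \<in> {0..T}"
      show "X1 t \<omega> \<le> X2 t \<omega>"
      proof (rule skorokhod_le[where T=T and w="\<lambda>t. W t \<omega>", OF s1.X_continuous[OF \<omega>] s2.X_continuous[OF \<omega>] elim(1)])
      qed (use t s2.X_nonneg[OF _ \<omega>] elim(2,3) in \<open>blast+\<close>)
      show "X2 t \<omega> \<le> X1 t \<omega>"
      proof (rule skorokhod_le[where T=T and w="\<lambda>t. W t \<omega>", OF s2.X_continuous[OF \<omega>] s1.X_continuous[OF \<omega>] elim(1)[symmetric]])
      qed (use t s1.X_nonneg[OF _ \<omega>] elim(2,3) in \<open>blast+\<close>)
    qed
  qed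
  then show ?thesis unfolding indistinguishable_def by (simp add: AE_completion_iff)
qed

section \<open>Existence\<close>

text \<open>A countable description of the event that the supremum exceeds a level, from which the
  regulator is seen to be adapted. Scaling rational fractions by t keeps the index set independent
  of t.\<close>

lemma running_sup_gt_iff:
  assumes g: "continuous_on {0..t} g" and t: "0 \<le> t"
  shows "a < running_sup g t \<longleftrightarrow> (\<exists>r\<in>\<rat> \<inter> {0..1}. a < g (r * t))"
proof
  assume "\<exists>r\<in>\<rat> \<inter> {0..1}. a < g (r * t)"
  then obtain r where r: "0 \<le> r" "r \<le> 1" "a < g (r * t)" by auto
  have "g (r * t) \<le> running_sup g t"
    using r t by (intro running_sup_upper[OF g]) (auto simp: mult_left_le_one_le)
  with r show "a < running_sup g t" by simp
next
  assume a: "a < running_sup g t"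
  obtain u where u: "u \<in> {0..t}" "running_sup g t = g u" using running_sup_attained[OF g t] by auto
  \<comment> \<open>For t = 0 division by zero gives s = 0, which is still correct because then u =
    0.\<close>
  define s where "s = u / t"
  have s: "0 \<le> s" "s \<le> 1" "u = s * t" using u t by (auto simp: s_def divide_le_eq_1)
  have "continuous_on {0..1} (\<lambda>r. g (r * t))"
    using t by (intro continuous_on_compose2[OF g] continuous_intros) (auto simp: mult_left_le_one_le)
  then have "((\<lambda>r. g (r * t)) \<longlongrightarrow> g (s * t)) (at s within {0..1})"
    using s by (simp add: continuous_on_def)
  then have "\<forall>\<^sub>F r in at s within {0..1}. a < g (r * t)"
    by (rule order_tendstoD(1)) (use a u s in simp)
  then obtain d where d: "0 < d" "\<forall>r\<in>{0..1}. r \<noteq> s \<and> dist r s < d \<longrightarrow> a < g (r * t)"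
    unfolding eventually_at by blast
  have "max 0 (s - d) < min 1 (s + d)" using s d(1) by auto
  then obtain r where r: "r \<in> \<rat>" "max 0 (s - d) < r" "r < min 1 (s + d)" using Rats_dense_in_real by blast
  have "a < g (r * t)"
  proof (cases "r = s")
    case True then show ?thesis using a u s by simp
  next
    case False
    then show ?thesis using d(2) r by (auto simp: dist_real_def)
  qed
  with r show "\<exists>r\<in>\<rat> \<inter> {0..1}. a < g (r * t)" by (intro bexI[of _ r]) auto
qed

text \<open>Sample the path at the last multiple of 1 / (m + 1) before s. The sampled process is
  pieced together from countably many measurable functions of the past, and by continuity it
  converges pointwise.\<close>

lemma progressively_measurableI:
  fixes H :: "real \<Rightarrow> 'a \<Rightarrow> real"
  assumes adapted: "\<And>t. t \<in> {0..T} \<Longrightarrow> H t \<in> borel_measurable (F t)"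
    and mono: "\<And>s t. s \<le> t \<Longrightarrow> t \<le> T \<Longrightarrow> measurable (F s) (borel :: real measure) \<subseteq> measurable (F t) borel"
    and cont: "\<And>t \<omega>. t \<in> {0..T} \<Longrightarrow> \<omega> \<in> space (F t) \<Longrightarrow> continuous_on {0..t} (\<lambda>t. H t \<omega>)"
  shows "progressively_measurable F T H"
  unfolding progressively_measurable_def
proof
  fix t assume t: "t \<in> {0..T}"
  let ?P = "restrict_space borel {0..t} \<Otimes>\<^sub>M F t"
  \<comment> \<open>The minimum with t keeps every sampling time inside [0, t], also for those
    indices that the floor never takes for s \<le> t but that the countable composition has to
    cover.\<close>
  define p where "p m s = min (real (nat \<lfloor>real (Suc m) * s\<rfloor>) / real (Suc m)) t" for m s
  have "(\<lambda>x. x) \<in> borel_measurable (restrict_space borel {0..t})" by (intro measurable_restrict_space1) simp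
  then have fst_meas[measurable]: "(\<lambda>x. fst x) \<in> borel_measurable ?P"
    using measurable_compose[OF measurable_fst] by blast
  have meas: "(\<lambda>x. H (p m (fst x)) (snd x)) \<in> borel_measurable ?P" for m
    unfolding p_def
  proof (rule measurable_compose_countable[where f="\<lambda>i x. H (min (real i / real (Suc m)) t) (snd x)"])
    fix i
    have "min (real i / real (Suc m)) t \<in> {0..T}" using t by auto
    then have "H (min (real i / real (Suc m)) t) \<in> borel_measurable (F (min (real i / real (Suc m)) t))" by (rule adapted)
    then have "H (min (real i / real (Suc m)) t) \<in> borel_measurable (F t)"
      by (rule subsetD[OF mono, rotated 2]) (use t in auto)
    then show "(\<lambda>x. H (min (real i / real (Suc m)) t) (snd x)) \<in> borel_measurable ?P"
      by (rule measurable_compose[OF measurable_snd])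
  next
    show "(\<lambda>x. nat \<lfloor>real (Suc m) * fst x\<rfloor>) \<in> measurable ?P (count_space UNIV)" by measurable
  qed
  have lim: "(\<lambda>m. H (p m (fst x)) (snd x)) \<longlonglongrightarrow> H (fst x) (snd x)" if x: "x \<in> space ?P" for x
  proof -
    obtain s \<omega> where s: "x = (s, \<omega>)" "s \<in> {0..t}" "\<omega> \<in> space (F t)"
      using x by (cases x) (auto simp: space_pair_measure)
    have p: "s - inverse (real (Suc m)) \<le> p m s" "p m s \<le> s" "0 \<le> p m s" for m
    proof -
      have "real (nat \<lfloor>real (Suc m) * s\<rfloor>) = of_int \<lfloor>real (Suc m) * s\<rfloor>" using s(2) by simp
      then have le: "real (nat \<lfloor>real (Suc m) * s\<rfloor>) \<le> real (Suc m) * s" "real (Suc m) * s - 1 \<le> real (nat \<lfloor>real (Suc m) * s\<rfloor>)"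
        using of_int_floor_le[of "real (Suc m) * s"] floor_correct[of "real (Suc m) * s"] by linarith+
      then have 1: "real (nat \<lfloor>real (Suc m) * s\<rfloor>) / real (Suc m) \<le> s" by (simp add: divide_le_eq mult.commute)
      then show "p m s \<le> s" by (simp add: p_def)
      have "(real (Suc m) * s - 1) / real (Suc m) \<le> real (nat \<lfloor>real (Suc m) * s\<rfloor>) / real (Suc m)"
        using le(2) by (intro divide_right_mono) auto
      also have "(real (Suc m) * s - 1) / real (Suc m) = s - inverse (real (Suc m))" by (simp add: field_simps)
      finally have 2: "s - inverse (real (Suc m)) \<le> real (nat \<lfloor>real (Suc m) * s\<rfloor>) / real (Suc m)" .
      have "p m s = real (nat \<lfloor>real (Suc m) * s\<rfloor>) / real (Suc m)" using 1 s(2) by (simp add: p_def)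
      with 2 show "s - inverse (real (Suc m)) \<le> p m s" by simp
      show "0 \<le> p m s" using s(2) by (simp add: p_def)
    qed
    have "(\<lambda>m. s - inverse (real (Suc m))) \<longlonglongrightarrow> s - 0" by (intro tendsto_intros LIMSEQ_inverse_real_of_nat)
    then have lo: "(\<lambda>m. s - inverse (real (Suc m))) \<longlonglongrightarrow> s" unfolding diff_zero .
    have "(\<lambda>m. p m s) \<longlonglongrightarrow> s"
      by (rule tendsto_sandwich[OF always_eventually[OF allI] always_eventually[OF allI] lo tendsto_const]) (rule p)+
    then have "(\<lambda>m. H (p m s) \<omega>) \<longlonglongrightarrow> H s \<omega>"
      by (rule continuous_on_tendsto_compose[OF cont[OF t s(3)]]) (use p(3) p(2)[THEN order_trans] s(2) in auto)
    then show ?thesis using s by simp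
  qed
  show "(\<lambda>(s, \<omega>). H s \<omega>) \<in> borel_measurable ?P"
    unfolding split_beta' by (rule borel_measurable_LIMSEQ_metric[OF meas lim])
qed

lemma progressively_measurable_integral:
  fixes H :: "real \<Rightarrow> 'a \<Rightarrow> real"
  assumes "progressively_measurable F T H" "t \<in> {0..T}"
  shows "(\<lambda>\<omega>. LINT s:{0..t}|lborel. H s \<omega>) \<in> borel_measurable (F t)"
proof -
  let ?L = "restrict_space lborel {0..t}"
  interpret L: sigma_finite_measure ?L
    by (rule sigma_finite_measure_restrict_space) (auto intro: lborel.sigma_finite_measure_axioms)
  have "sets (restrict_space borel {0..t} \<Otimes>\<^sub>M F t) = sets (?L \<Otimes>\<^sub>M F t)"
    by (intro sets_pair_measure_cong sets_restrict_space_cong) auto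
  then have "(\<lambda>(s, \<omega>). H s \<omega>) \<in> borel_measurable (?L \<Otimes>\<^sub>M F t)"
    using assms measurable_cong_sets unfolding progressively_measurable_def by blast
  then have "(\<lambda>(\<omega>, s). H s \<omega>) \<in> borel_measurable (F t \<Otimes>\<^sub>M ?L)"
    using measurable_pair_swap by fastforce
  then have "(\<lambda>\<omega>. \<integral>s. H s \<omega> \<partial>?L) \<in> borel_measurable (F t)"
    by (rule L.borel_measurable_lebesgue_integral)
  then show ?thesis by (subst (asm) integral_restrict_space) (auto simp: set_lebesgue_integral_def)
qed

lemma (in finite_measure) measure_tendsto_0_AE:
  assumes "\<And>k::nat. E k \<in> sets M" "AE \<omega> in M. \<forall>\<^sub>F k in sequentially. \<omega> \<notin> E k"
  shows "(\<lambda>k. measure M (E k)) \<longlonglongrightarrow> 0"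
proof -
  have "(\<lambda>k. \<integral>\<omega>. indicat_real (E k) \<omega> \<partial>M) \<longlonglongrightarrow> (\<integral>\<omega>. 0 \<partial>M)"
  proof (rule integral_dominated_convergence[where w="\<lambda>_. 1"])
    show "AE \<omega> in M. (\<lambda>k. indicat_real (E k) \<omega>) \<longlonglongrightarrow> 0"
      using assms(2)
    proof eventually_elim
      case (elim \<omega>)
      then have "\<forall>\<^sub>F k in sequentially. indicat_real (E k) \<omega> = 0" by eventually_elim simp
      then show ?case by (rule tendsto_eventually)
    qed
  qed (use assms(1) in auto)
  then show ?thesis using assms(1) sets.sets_into_space by (simp add: Int_absorb2)
qed

text \<open>The sum of the squares has finite expectation, hence is finite almost surely, so its
  terms tend to 0.\<close>

lemma AE_tendsto_0_if_summable_second_moments: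
  fixes Z :: "nat \<Rightarrow> 'a \<Rightarrow> real"
  assumes Z: "\<And>k. Z k \<in> borel_measurable M" "\<And>k. integrable M (\<lambda>\<omega>. (Z k \<omega>)\<^sup>2)"
    and sum: "\<And>k. (\<integral>\<omega>. (Z k \<omega>)\<^sup>2 \<partial>M) \<le> b k" "summable b"
  shows "AE \<omega> in M. (\<lambda>k. Z k \<omega>) \<longlonglongrightarrow> 0"
proof -
  note [measurable] = Z(1)
  have nn: "0 \<le> b k" for k by (rule order_trans[OF _ sum(1)]) (simp add: integral_nonneg_AE)
  have "(\<integral>\<^sup>+\<omega>. (\<Sum>k. ennreal ((Z k \<omega>)\<^sup>2)) \<partial>M) = (\<Sum>k. \<integral>\<^sup>+\<omega>. ennreal ((Z k \<omega>)\<^sup>2) \<partial>M)"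
    by (rule nn_integral_suminf) measurable
  also have "\<dots> \<le> (\<Sum>k. ennreal (b k))"
    using Z(2) sum(1) by (intro suminf_le summableI) (auto simp: nn_integral_eq_integral intro!: ennreal_leI)
  also have "\<dots> = ennreal (\<Sum>k. b k)" using nn sum(2) by (intro suminf_ennreal_eq) (auto simp: summable_sums)
  also have "\<dots> < \<infinity>" by simp
  finally have "(\<integral>\<^sup>+\<omega>. (\<Sum>k. ennreal ((Z k \<omega>)\<^sup>2)) \<partial>M) \<noteq> \<infinity>" by simp
  then have "AE \<omega> in M. (\<Sum>k. ennreal ((Z k \<omega>)\<^sup>2)) \<noteq> \<infinity>"
    by (intro nn_integral_noteq_infinite) measurable
  then show ?thesis
  proof eventually_elim
    case (elim \<omega>)
    then have "summable (\<lambda>k. (Z k \<omega>)\<^sup>2)" by (intro summable_suminf_not_top) auto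
    then have "(\<lambda>k. (Z k \<omega>)\<^sup>2) \<longlonglongrightarrow> 0" by (rule summable_LIMSEQ_zero)
    then have "(\<lambda>k. sqrt ((Z k \<omega>)\<^sup>2)) \<longlonglongrightarrow> sqrt 0" by (rule tendsto_real_sqrt)
    then show ?case by (simp add: tendsto_rabs_zero_iff)
  qed
qed

text \<open>Coefficients of simple processes must be bounded, whereas \<open>deriv f\<close> and
  \<open>L1 f\<close> need not be. Clipping at level k + 1 achieves this, and on each continuous
  path it is without effect for large k.\<close>

definition clip :: "real \<Rightarrow> real \<Rightarrow> real" where
  "clip c x = max (- c) (min c x)"

lemma clip_bound: "0 \<le> c \<Longrightarrow> \<bar>clip c x\<bar> \<le> c"
  and clip_eq: "\<bar>x\<bar> \<le> c \<Longrightarrow> clip c x = x"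
  by (auto simp: clip_def)

lemma clip_measurable [measurable]: "clip c \<in> borel_measurable borel"
  unfolding clip_def[abs_def] by measurable

text \<open>Serves to exchange expressions such as \<open>deriv_Rplus f\<close> and
  \<open>deriv g\<close>, which agree along nonnegative paths only.\<close>

lemma ito_integral_cong:
  assumes ito: "ito_integral M F T W H I"
    and sp: "\<And>t. space (F t) = space M"
    and eq: "\<And>t \<omega>. t \<in> {0..T} \<Longrightarrow> \<omega> \<in> space M \<Longrightarrow> H t \<omega> = H' t \<omega>" "\<And>t \<omega>. t \<in> {0..T} \<Longrightarrow> \<omega> \<in> space M \<Longrightarrow> I t \<omega> = I' t \<omega>"
  shows "ito_integral M F T W H' I'"
proof -
  have 1: "progressively_measurable F T H'"
    unfolding progressively_measurable_def
  proof
    fix t assume t: "t \<in> {0..T}"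
    have "(\<lambda>(s, \<omega>). H s \<omega>) \<in> borel_measurable (restrict_space borel {0..t} \<Otimes>\<^sub>M F t)"
      using ito t unfolding ito_integral_def progressively_measurable_def by blast
    moreover have "(\<lambda>(s, \<omega>). H s \<omega>) x = (\<lambda>(s, \<omega>). H' s \<omega>) x" if "x \<in> space (restrict_space borel {0..t} \<Otimes>\<^sub>M F t)" for x
      using that eq(1) t by (auto simp: space_pair_measure sp)
    ultimately show "(\<lambda>(s, \<omega>). H' s \<omega>) \<in> borel_measurable (restrict_space borel {0..t} \<Otimes>\<^sub>M F t)"
      by (subst (asm) measurable_cong) auto
  qed
  have 2: "adapted_process F T I'"
    unfolding adapted_process_def
  proof
    fix t assume t: "t \<in> {0..T}"
    have "I t \<in> borel_measurable (F t)" using ito t unfolding ito_integral_def adapted_process_def by blast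
    then show "I' t \<in> borel_measurable (F t)"
      by (subst (asm) measurable_cong[of _ _ "I' t"]) (auto simp: sp eq(2)[OF t])
  qed
  have 3: "AE \<omega> in M. continuous_on {0..T} (\<lambda>t. I' t \<omega>)"
  proof -
    have "AE \<omega> in M. continuous_on {0..T} (\<lambda>t. I t \<omega>)" using ito unfolding ito_integral_def by blast
    then show ?thesis using AE_space
    proof eventually_elim
      case (elim \<omega>)
      then show ?case using eq(2) by (subst continuous_on_cong[OF refl, of _ _ "\<lambda>t. I t \<omega>"]) auto
    qed
  qed
  have eqH: "(\<integral>\<^sup>+s\<in>{0..T}. ennreal ((J s - H s \<omega>)\<^sup>2) \<partial>lborel) = (\<integral>\<^sup>+s\<in>{0..T}. ennreal ((J s - H' s \<omega>)\<^sup>2) \<partial>lborel)"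
    if "\<omega> \<in> space M" for J :: "real \<Rightarrow> real" and \<omega>
    using that eq(1) by (intro nn_integral_cong) (auto simp: indicator_def)
  have c1: "{\<omega>\<in>space M. ennreal \<epsilon> < (\<integral>\<^sup>+s\<in>{0..T}. ennreal ((J s \<omega> - H' s \<omega>)\<^sup>2) \<partial>lborel)}
     = {\<omega>\<in>space M. ennreal \<epsilon> < (\<integral>\<^sup>+s\<in>{0..T}. ennreal ((J s \<omega> - H s \<omega>)\<^sup>2) \<partial>lborel)}" for J \<epsilon>
    by (intro Collect_cong conj_cong refl) (simp only: eqH)
  have c2: "{\<omega>\<in>space M. \<epsilon> < \<bar>J \<omega> - I' t \<omega>\<bar>} = {\<omega>\<in>space M. \<epsilon> < \<bar>J \<omega> - I t \<omega>\<bar>}" if "t \<in> {0..T}" for J \<epsilon> t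
    using eq(2)[OF that] by auto
  obtain n \<tau> \<xi> where *: "(\<forall>k. simple_process_data M F T (n k) (\<tau> k) (\<xi> k)) \<and>
        (\<forall>\<epsilon>>0. (\<lambda>k. measure (completion M) {\<omega>\<in>space M. ennreal \<epsilon> < (\<integral>\<^sup>+s\<in>{0..T}.
               ennreal ((simple_process (n k) (\<tau> k) (\<xi> k) s \<omega> - H s \<omega>)\<^sup>2) \<partial>lborel)}) \<longlonglongrightarrow> 0) \<and>
        (\<forall>t\<in>{0..T}. \<forall>\<epsilon>>0. (\<lambda>k. measure (completion M) {\<omega>\<in>space M.
             \<epsilon> < \<bar>simple_integral W (n k) (\<tau> k) (\<xi> k) t \<omega> - I t \<omega>\<bar>}) \<longlonglongrightarrow> 0)"
    using ito unfolding ito_integral_def by - (elim conjE exE, rule that, intro conjI)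
  show ?thesis unfolding ito_integral_def
  proof (intro conjI 1 2 3 exI)
    show "\<forall>k. simple_process_data M F T (n k) (\<tau> k) (\<xi> k)" using * by (elim conjE)
    show "\<forall>\<epsilon>>0. (\<lambda>k. measure (completion M) {\<omega>\<in>space M. ennreal \<epsilon> < (\<integral>\<^sup>+s\<in>{0..T}.
               ennreal ((simple_process (n k) (\<tau> k) (\<xi> k) s \<omega> - H' s \<omega>)\<^sup>2) \<partial>lborel)}) \<longlonglongrightarrow> 0"
      unfolding c1 using * by (elim conjE)
    show "\<forall>t\<in>{0..T}. \<forall>\<epsilon>>0. (\<lambda>k. measure (completion M) {\<omega>\<in>space M.
             \<epsilon> < \<bar>simple_integral W (n k) (\<tau> k) (\<xi> k) t \<omega> - I' t \<omega>\<bar>}) \<longlonglongrightarrow> 0"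
    proof
      fix t assume t: "t \<in> {0..T}"
      show "\<forall>\<epsilon>>0. (\<lambda>k. measure (completion M) {\<omega>\<in>space M.
             \<epsilon> < \<bar>simple_integral W (n k) (\<tau> k) (\<xi> k) t \<omega> - I' t \<omega>\<bar>}) \<longlonglongrightarrow> 0"
        unfolding c2[OF t] using * t by (elim conjE) (rule bspec)
    qed
  qed
qed

section \<open>Grids and the quadratic variation of Brownian motion\<close>

context brownian begin

text \<open>Grids with \<open>(k + 1)\<^sup>4\<close> intervals: fine enough for the errors of integrands bounded by \<open>k + 1\<close> to be summable.\<close>

abbreviation "gn k \<equiv> Suc k ^ 4"

definition grid :: "nat \<Rightarrow> nat \<Rightarrow> real" where
  "grid k i = real i * T / real (gn k)"

lemma grid_0 [simp]: "grid k 0 = 0" and grid_end: "grid k (gn k) = T"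
  and grid_Suc: "grid k (Suc i) - grid k i = T / real (gn k)"
  by (simp_all add: grid_def field_simps)

lemma grid_le: "grid k i \<le> grid k (Suc i)"
  using T_pos by (simp add: grid_def field_simps)

lemma grid_mem: "i \<le> gn k \<Longrightarrow> grid k i \<in> {0..T}"
proof -
  assume "i \<le> gn k"
  then have "real i * T \<le> real (gn k) * T" using T_pos by (intro mult_right_mono of_nat_mono) auto
  then have "grid k i \<le> T" unfolding grid_def by (subst pos_divide_le_eq) (auto simp: mult.commute)
  then show ?thesis using T_pos by (simp add: grid_def)
qed

lemma grid_mesh:
  assumes "0 < d"
  shows "\<forall>\<^sub>F k in sequentially. T / real (gn k) < d"
proof -
  obtain k0 where k0: "T / d < real k0" using reals_Archimedean2 by blast
  have "T / real (gn k) < d" if k: "k \<ge> k0" for k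
  proof -
    have "T / d < real (Suc k)" using k k0 by linarith
    also have "Suc k \<le> gn k" by (rule self_le_power) auto
    then have "real (Suc k) \<le> real (gn k)" by (rule of_nat_mono)
    finally show ?thesis using assms by (simp add: divide_less_eq mult.commute)
  qed
  then show ?thesis unfolding eventually_sequentially by blast
qed

text \<open>Cutting off one fixed grid, instead of dividing [0, t] anew, matches
  \<open>simple_integral\<close>, where a single simple process is integrated up to every t. Points
  beyond t collapse to t and contribute empty intervals.\<close>

definition tgrid :: "real \<Rightarrow> nat \<Rightarrow> nat \<Rightarrow> real" where
  "tgrid t k i = min (grid k i) t"

lemma tgrid:
  assumes t: "t \<in> {0..T}"
  shows "tgrid t k 0 = 0" "tgrid t k (gn k) = t" "tgrid t k i \<le> tgrid t k (Suc i)"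
    "tgrid t k (Suc i) - tgrid t k i \<le> T / real (gn k)" "i \<le> gn k \<Longrightarrow> tgrid t k i \<in> {0..t}"
proof -
  show "tgrid t k 0 = 0" "tgrid t k (gn k) = t" using t grid_end[of k] by (auto simp: tgrid_def)
  show "tgrid t k i \<le> tgrid t k (Suc i)" using grid_le[of k i] by (auto simp: tgrid_def)
  show "tgrid t k (Suc i) - tgrid t k i \<le> T / real (gn k)"
    unfolding tgrid_def grid_Suc[of k i, symmetric] using grid_le[of k i] by linarith
  show "tgrid t k i \<in> {0..t}" if "i \<le> gn k" using grid_mem[OF that] t by (auto simp: tgrid_def)
qed

text \<open>On an interval of length h the compensated square has mean 0 and second moment 3 h^2 - 2
  h h + h^2 = 2 h^2, and different intervals are orthogonal. With coefficients bounded by k + 1 and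
  h \<le> T / (k + 1)^4, the second moment of the sum is at most 2 T^2 / (k + 1)^2, which is
  summable in k.\<close>

lemma quadratic_variation_AE:
  assumes t: "t \<in> {0..T}"
    and K: "\<And>k i. i < gn k \<Longrightarrow> K k i \<in> borel_measurable (F (tgrid t k i))"
      "\<And>k i \<omega>. i < gn k \<Longrightarrow> \<omega> \<in> space M \<Longrightarrow> \<bar>K k i \<omega>\<bar> \<le> real (Suc k)"
  shows "AE \<omega> in N. (\<lambda>k. \<Sum>i<gn k. K k i \<omega> * ((W (tgrid t k (Suc i)) \<omega> - W (tgrid t k i) \<omega>)\<^sup>2 - (tgrid t k (Suc i) - tgrid t k i))) \<longlonglongrightarrow> 0"
proof -
  define g where "g k i z = z\<^sup>2 - (tgrid t k (Suc i) - tgrid t k i)" for k i and z :: real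
  define c where "c k i = 2 * (tgrid t k (Suc i) - tgrid t k i)\<^sup>2" for k i
  let ?Z = "\<lambda>k \<omega>. \<Sum>i<gn k. K k i \<omega> * g k i (W (tgrid t k (Suc i)) \<omega> - W (tgrid t k i) \<omega>)"
  have mem: "tgrid t k i \<in> {0..T}" if "i \<le> gn k" for k i using tgrid(5)[OF t that] t by auto
  have mom: "integrable N (\<lambda>\<omega>. g k i (W (tgrid t k (Suc i)) \<omega> - W (tgrid t k i) \<omega>))"
    "integrable N (\<lambda>\<omega>. (g k i (W (tgrid t k (Suc i)) \<omega> - W (tgrid t k i) \<omega>))\<^sup>2)"
    "(\<integral>\<omega>. g k i (W (tgrid t k (Suc i)) \<omega> - W (tgrid t k i) \<omega>) \<partial>N) = 0"
    "(\<integral>\<omega>. (g k i (W (tgrid t k (Suc i)) \<omega> - W (tgrid t k i) \<omega>))\<^sup>2 \<partial>N) = c k i" if i: "i < gn k" for k i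
  proof -
    define h where "h = tgrid t k (Suc i) - tgrid t k i"
    define D where "D \<omega> = W (tgrid t k (Suc i)) \<omega> - W (tgrid t k i) \<omega>" for \<omega>
    have 0: "0 \<le> tgrid t k i" "tgrid t k i \<le> tgrid t k (Suc i)" "tgrid t k (Suc i) \<le> T"
      using mem[of i k] mem[of "Suc i" k] i tgrid(3)[OF t] by auto
    note m = increment_moments[OF 0, folded D_def h_def]
    have m2: "integrable N (\<lambda>\<omega>. (D \<omega>)\<^sup>2)" "integrable N (\<lambda>\<omega>. (D \<omega>) ^ 4)" using m(1) by auto
    have sq: "(g k i (D \<omega>))\<^sup>2 = (D \<omega>) ^ 4 - 2 * h * (D \<omega>)\<^sup>2 + h\<^sup>2" for \<omega>
      by (simp add: g_def h_def[symmetric] power2_diff power2_eq_square eval_nat_numeral algebra_simps)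
    have "integrable N (\<lambda>\<omega>. g k i (D \<omega>))" "(\<integral>\<omega>. g k i (D \<omega>) \<partial>N) = 0"
      using m2 m(3) N.prob_space by (simp_all add: g_def h_def[symmetric])
    moreover have "integrable N (\<lambda>\<omega>. (g k i (D \<omega>))\<^sup>2)" unfolding sq using m2 by simp
    moreover have "(\<integral>\<omega>. (g k i (D \<omega>))\<^sup>2 \<partial>N) = c k i"
      unfolding sq using m2 m(3,4) N.prob_space by (simp add: c_def h_def[symmetric] power2_eq_square)
    ultimately show "integrable N (\<lambda>\<omega>. g k i (W (tgrid t k (Suc i)) \<omega> - W (tgrid t k i) \<omega>))"
      "integrable N (\<lambda>\<omega>. (g k i (W (tgrid t k (Suc i)) \<omega> - W (tgrid t k i) \<omega>))\<^sup>2)"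
      "(\<integral>\<omega>. g k i (W (tgrid t k (Suc i)) \<omega> - W (tgrid t k i) \<omega>) \<partial>N) = 0"
      "(\<integral>\<omega>. (g k i (W (tgrid t k (Suc i)) \<omega> - W (tgrid t k i) \<omega>))\<^sup>2 \<partial>N) = c k i"
      unfolding D_def by blast+
  qed
  have gm: "g k i \<in> borel_measurable borel" for k i unfolding g_def by measurable
  note iso = transform_isometry[where \<tau>="tgrid t k" and n="gn k" and K="K k" and g="g k" and c="c k" and C="real (Suc k)" for k,
      OF mem tgrid(3)[OF t] K gm mom]
  have le: "(\<integral>\<omega>. (?Z k \<omega>)\<^sup>2 \<partial>N) \<le> 2 * T\<^sup>2 * inverse (real (Suc k) ^ 2)" for k
  proof -
    have "(\<integral>\<omega>. (?Z k \<omega>)\<^sup>2 \<partial>N) = (\<Sum>i<gn k. c k i * (\<integral>\<omega>. (K k i \<omega>)\<^sup>2 \<partial>N))"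
      by (rule iso(3))
    also have "\<dots> \<le> (\<Sum>i<gn k. 2 * (T / real (gn k) * (tgrid t k (Suc i) - tgrid t k i)) * (real (Suc k))\<^sup>2)"
    proof (rule sum_mono)
      fix i assume "i \<in> {..<gn k}"
      then have i: "i < gn k" by simp
      have "c k i \<le> 2 * (T / real (gn k) * (tgrid t k (Suc i) - tgrid t k i))"
        unfolding c_def power2_eq_square using tgrid(3,4)[OF t, of k i] by (intro mult_left_mono mult_right_mono) auto
      moreover have "(\<integral>\<omega>. (K k i \<omega>)\<^sup>2 \<partial>N) \<le> (\<integral>\<omega>. (real (Suc k))\<^sup>2 \<partial>N)"
      proof (rule integral_mono)
        have sq: "(K k i \<omega>)\<^sup>2 \<le> (real (Suc k))\<^sup>2" if "\<omega> \<in> space M" for \<omega>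
        proof -
          have "\<bar>K k i \<omega>\<bar>\<^sup>2 \<le> (real (Suc k))\<^sup>2" by (intro power_mono K(2) i that) simp
          then show ?thesis by simp
        qed
        show "integrable N (\<lambda>\<omega>. (K k i \<omega>)\<^sup>2)"
          by (rule N.integrable_const_bound[of _ "(real (Suc k))\<^sup>2"])
             (use sq measurable_F_N[OF K(1)[OF i]] in \<open>auto intro!: AE_I2\<close>)
        show "(K k i \<omega>)\<^sup>2 \<le> (real (Suc k))\<^sup>2" if "\<omega> \<in> space N" for \<omega> using sq that by simp
      qed simp
      ultimately show "c k i * (\<integral>\<omega>. (K k i \<omega>)\<^sup>2 \<partial>N) \<le> 2 * (T / real (gn k) * (tgrid t k (Suc i) - tgrid t k i)) * (real (Suc k))\<^sup>2"
        using N.prob_space T_pos tgrid(3)[OF t, of k i] by (intro mult_mono) auto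
    qed
    also have "\<dots> = 2 * (T / real (gn k)) * (real (Suc k))\<^sup>2 * (\<Sum>i<gn k. tgrid t k (Suc i) - tgrid t k i)"
      unfolding sum_distrib_left by (intro sum.cong) (auto simp del: of_nat_Suc of_nat_power)
    also have "(\<Sum>i<gn k. tgrid t k (Suc i) - tgrid t k i) = t"
      unfolding sum_lessThan_telescope using tgrid(1,2)[OF t] by simp
    also have "2 * (T / real (gn k)) * (real (Suc k))\<^sup>2 * t \<le> 2 * (T / real (gn k)) * (real (Suc k))\<^sup>2 * T"
      using t T_pos by (intro mult_left_mono) auto
    also have "\<dots> = 2 * T\<^sup>2 * inverse (real (Suc k) ^ 2)"
    proof -
      have "2 * (T / q ^ 4) * q\<^sup>2 * T = 2 * T\<^sup>2 * inverse (q\<^sup>2)" if "0 < q" for q :: real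
        using that by (simp add: field_simps power2_eq_square eval_nat_numeral)
      from this[of "real (Suc k)"] show ?thesis unfolding of_nat_power by simp
    qed
    finally show ?thesis .
  qed
  have Zm: "?Z k \<in> borel_measurable N" for k by (rule measurable_F_N[OF iso(1)])
  have "AE \<omega> in N. (\<lambda>k. ?Z k \<omega>) \<longlonglongrightarrow> 0"
  proof (rule AE_tendsto_0_if_summable_second_moments[OF Zm iso(2) le])
    have "summable (\<lambda>k. inverse (real k ^ 2))" by (rule inverse_power_summable) simp
    then have "summable (\<lambda>k. inverse (real (Suc k) ^ 2))" by (subst summable_Suc_iff)
    then show "summable (\<lambda>k. 2 * T\<^sup>2 * inverse (real (Suc k) ^ 2))" by (rule summable_mult)
  qed
  then show ?thesis by (simp only: g_def)
qed

end

section \<open>Reflected Brownian motion as a solution\<close>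

locale reflected = brownian M T W for M :: "'a measure" and T W +
  fixes x0 :: real
  assumes x0: "0 \<le> x0"
begin

definition L :: "real \<Rightarrow> 'a \<Rightarrow> real" where "L t \<omega> = reg x0 (\<lambda>s. W s \<omega>) t"

definition X :: "real \<Rightarrow> 'a \<Rightarrow> real" where "X t \<omega> = x0 + W t \<omega> + L t \<omega>"

lemma L_continuous: "\<omega> \<in> space M \<Longrightarrow> continuous_on {0..T} (\<lambda>t. L t \<omega>)"
  unfolding L_def using continuous_on_reg[OF W_continuous] by simp

lemma X_continuous: "\<omega> \<in> space M \<Longrightarrow> continuous_on {0..T} (\<lambda>t. X t \<omega>)"
  unfolding X_def by (intro continuous_intros L_continuous W_continuous)

lemma X_nonneg: "t \<in> {0..T} \<Longrightarrow> \<omega> \<in> space M \<Longrightarrow> 0 \<le> X t \<omega>"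
  unfolding X_def L_def using reflected_nonneg[OF W_continuous] by simp

lemma X_0: "AE \<omega> in M. X 0 \<omega> = x0"
  using W_0 by eventually_elim (use x0 in \<open>simp add: X_def L_def reg_def running_sup_def\<close>)

lemma X_adapted:
  assumes t: "t \<in> {0..T}"
  shows "X t \<in> borel_measurable (F t)"
proof -
  have "L t \<in> borel_measurable (F t)"
    unfolding borel_measurable_iff_greater
  proof
    fix a
    let ?g = "\<lambda>\<omega> u. max 0 (- (x0 + W u \<omega>))"
    have "{\<omega>\<in>space (F t). a < L t \<omega>} = (\<Union>r\<in>\<rat> \<inter> {0..1}. {\<omega>\<in>space (F t). a < ?g \<omega> (r * t)})"
    proof -
      have "a < L t \<omega> \<longleftrightarrow> (\<exists>r\<in>\<rat> \<inter> {0..1}. a < ?g \<omega> (r * t))" if \<omega>: "\<omega> \<in> space M" for \<omega>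
        unfolding L_def reg_def
      proof (rule running_sup_gt_iff)
        show "continuous_on {0..t} (?g \<omega>)"
          by (intro continuous_intros continuous_on_subset[OF W_continuous[OF \<omega>]]) (use t in auto)
      qed (use t in auto)
      then show ?thesis by auto
    qed
    moreover have "{\<omega>\<in>space (F t). a < ?g \<omega> (r * t)} \<in> sets (F t)" if r: "r \<in> \<rat> \<inter> {0..1}" for r
    proof -
      have [measurable]: "W (r * t) \<in> borel_measurable (F t)"
        using r t by (intro W_measurable_F) (auto simp: mult_left_le_one_le)
      show ?thesis by measurable
    qed
    ultimately show "{\<omega>\<in>space (F t). a < L t \<omega>} \<in> sets (F t)"
      using countable_rat by (auto intro!: sets.countable_UN')
  qed
  moreover have "W t \<in> borel_measurable (F t)" using t by (intro W_measurable_F) auto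
  ultimately show ?thesis unfolding X_def[abs_def] by (intro borel_measurable_add borel_measurable_const)
qed

lemma X_progressive:
  fixes h :: "real \<Rightarrow> real"
  assumes h: "continuous_on UNIV h"
  shows "progressively_measurable F T (\<lambda>t \<omega>. h (X t \<omega>))"
proof (rule progressively_measurableI)
  show "(\<lambda>\<omega>. h (X t \<omega>)) \<in> borel_measurable (F t)" if "t \<in> {0..T}" for t
    by (rule measurable_compose[OF X_adapted[OF that] borel_measurable_continuous_onI[OF h]])
  show "continuous_on {0..t} (\<lambda>t. h (X t \<omega>))" if "t \<in> {0..T}" "\<omega> \<in> space (F t)" for t \<omega>
    by (rule continuous_on_compose2[OF h continuous_on_subset[OF X_continuous]]) (use that in auto)
qed (use measurable_F_mono in blast)

context
  fixes f :: "real \<Rightarrow> real"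
  assumes f: "f \<in> D_L1"
begin

lemma f_deriv: "(f has_real_derivative deriv f y) (at y)" "(deriv f has_real_derivative deriv (deriv f) y) (at y)"
  and f_deriv2_continuous: "continuous_on UNIV (deriv (deriv f))" and f_deriv_0: "deriv f 0 = 0"
  using f by (auto simp: D_L1_def DERIV_deriv_iff_real_differentiable)

lemma f_continuous: "continuous_on UNIV f" "continuous_on UNIV (deriv f)" "continuous_on UNIV (L1 f)"
proof -
  show "continuous_on UNIV f" "continuous_on UNIV (deriv f)"
    using f_deriv by (auto intro!: continuous_at_imp_continuous_on DERIV_isCont)
  show "continuous_on UNIV (L1 f)"
    unfolding L1_def by (intro continuous_intros f_deriv2_continuous) auto
qed

definition \<xi> :: "nat \<Rightarrow> nat \<Rightarrow> 'a \<Rightarrow> real" where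
  "\<xi> k i \<omega> = clip (real (Suc k)) (deriv f (X (grid k i) \<omega>))"

definition J :: "real \<Rightarrow> 'a \<Rightarrow> real" where
  "J t \<omega> = f (X t \<omega>) - f x0 - (LINT s:{0..t}|lborel. L1 f (X s \<omega>))"

lemma \<xi>_data: "simple_process_data M F T (gn k) (grid k) (\<xi> k)"
  unfolding simple_process_data_def
proof (intro conjI allI impI)
  show "grid k i \<in> {0..T}" if "i \<le> gn k" for i by (rule grid_mem[OF that])
  show "grid k i \<le> grid k (Suc i)" for i by (rule grid_le)
  show "\<xi> k i \<in> borel_measurable (F (grid k i))" if i: "i < gn k" for i
  proof -
    have [measurable]: "X (grid k i) \<in> borel_measurable (F (grid k i))" using i by (intro X_adapted grid_mem) auto
    have [measurable]: "deriv f \<in> borel_measurable borel" by (rule borel_measurable_continuous_onI[OF f_continuous(2)])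
    show ?thesis unfolding \<xi>_def[abs_def] by measurable
  qed
  show "\<exists>C. \<forall>i<gn k. \<forall>\<omega>\<in>space M. \<bar>\<xi> k i \<omega>\<bar> \<le> C"
    by (intro exI[of _ "real (Suc k)"] allI impI ballI) (simp add: \<xi>_def clip_bound)
qed

text \<open>A continuous path has compact range over [0, T]. The index from which the bound holds
  depends on the path, which is harmless since only pathwise limits are taken.\<close>

lemma path_bounded:
  fixes h :: "real \<Rightarrow> real"
  assumes h: "continuous_on UNIV h" and \<omega>: "\<omega> \<in> space M"
  shows "\<forall>\<^sub>F k in sequentially. \<forall>s\<in>{0..T}. \<bar>h (X s \<omega>)\<bar> \<le> real (Suc k)"
proof -
  have "continuous_on {0..T} (\<lambda>s. h (X s \<omega>))"
    by (rule continuous_on_compose2[OF h X_continuous[OF \<omega>]]) auto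
  then have "bounded ((\<lambda>s. h (X s \<omega>)) ` {0..T})"
    by (intro compact_imp_bounded compact_continuous_image) auto
  then obtain B where B: "\<forall>y\<in>(\<lambda>s. h (X s \<omega>)) ` {0..T}. norm y \<le> B" unfolding bounded_iff ..
  obtain k0 where k0: "B < real k0" using reals_Archimedean2 by blast
  have "\<forall>s\<in>{0..T}. \<bar>h (X s \<omega>)\<bar> \<le> real (Suc k)" if k: "k \<ge> k0" for k
  proof
    fix s assume "s \<in> {0..T}"
    then have "\<bar>h (X s \<omega>)\<bar> \<le> B" using B by auto
    then show "\<bar>h (X s \<omega>)\<bar> \<le> real (Suc k)" using k0 k by linarith
  qed
  then show ?thesis unfolding eventually_sequentially by blast
qed

text \<open>Along a fixed path \<open>deriv f (X s)\<close> is uniformly continuous and, for large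
  k, not clipped. So the left-endpoint approximation is uniformly close on (0, T], on every path and
  not merely in probability.\<close>

lemma \<xi>_approx:
  assumes \<omega>: "\<omega> \<in> space M" and \<epsilon>: "0 < \<epsilon>"
  shows "\<forall>\<^sub>F k in sequentially. (\<integral>\<^sup>+s\<in>{0..T}. ennreal ((simple_process (gn k) (grid k) (\<xi> k) s \<omega> - deriv f (X s \<omega>))\<^sup>2) \<partial>lborel) \<le> ennreal \<epsilon>"
proof -
  define e where "e = sqrt (\<epsilon> / T)"
  have e: "0 < e" "e\<^sup>2 * T = \<epsilon>" using \<epsilon> T_pos by (auto simp: e_def)
  have "continuous_on {0..T} (\<lambda>s. deriv f (X s \<omega>))"
    by (rule continuous_on_compose2[OF f_continuous(2) X_continuous[OF \<omega>]]) auto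
  then have "uniformly_continuous_on {0..T} (\<lambda>s. deriv f (X s \<omega>))"
    by (rule compact_uniformly_continuous) simp
  then obtain d where d: "0 < d" "\<And>u v. u \<in> {0..T} \<Longrightarrow> v \<in> {0..T} \<Longrightarrow> dist v u < d \<Longrightarrow> dist (deriv f (X v \<omega>)) (deriv f (X u \<omega>)) < e"
    using e(1) unfolding uniformly_continuous_on_def by metis
  show ?thesis
    using path_bounded[OF f_continuous(2) \<omega>] grid_mesh[OF d(1)]
  proof eventually_elim
    case (elim k)
    have "(\<integral>\<^sup>+s\<in>{0..T}. ennreal ((simple_process (gn k) (grid k) (\<xi> k) s \<omega> - deriv f (X s \<omega>))\<^sup>2) \<partial>lborel)
      \<le> (\<integral>\<^sup>+s. ennreal (e\<^sup>2) * indicator {0..T} s \<partial>lborel)"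
    proof (rule nn_integral_mono_AE)
      have le: "(simple_process (gn k) (grid k) (\<xi> k) s \<omega> - deriv f (X s \<omega>))\<^sup>2 \<le> e\<^sup>2" if s: "s \<in> {0<..T}" for s
      proof -
        \<comment> \<open>With s fixed, the number \<open>deriv f (X s \<omega>)\<close> is
          subtracted from every coefficient. Exactly one interval contains s, so the new simple
          process takes at s the wanted difference, and its square can be computed termwise.\<close>
        define \<zeta> where "\<zeta> i \<omega>' = \<xi> k i \<omega>' - deriv f (X s \<omega>)" for i \<omega>'
        have ind: "(\<Sum>i<gn k. indicator {grid k i<..grid k (Suc i)} s :: real) = 1"
          using sum_indicator_partition[of "gn k" "grid k" s] grid_le grid_end[of k] s by simp
        have "simple_process (gn k) (grid k) (\<xi> k) s \<omega> - deriv f (X s \<omega>)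
          = simple_process (gn k) (grid k) (\<xi> k) s \<omega> - deriv f (X s \<omega>) * (\<Sum>i<gn k. indicator {grid k i<..grid k (Suc i)} s)"
          unfolding ind by simp
        also have "\<dots> = simple_process (gn k) (grid k) \<zeta> s \<omega>"
          unfolding simple_process_def \<zeta>_def sum_distrib_left sum_subtractf[symmetric] left_diff_distrib ..
        finally have "(simple_process (gn k) (grid k) (\<xi> k) s \<omega> - deriv f (X s \<omega>))\<^sup>2 = (\<Sum>i<gn k. (\<zeta> i \<omega>)\<^sup>2 * indicator {grid k i<..grid k (Suc i)} s)"
          using simple_process_power2[of "gn k" "grid k" \<zeta> s \<omega>] grid_le by simp
        also have "\<dots> \<le> (\<Sum>i<gn k. e\<^sup>2 * indicator {grid k i<..grid k (Suc i)} s)"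
        proof (rule sum_mono)
          fix i assume "i \<in> {..<gn k}"
          then have i: "i < gn k" by simp
          show "(\<zeta> i \<omega>)\<^sup>2 * indicator {grid k i<..grid k (Suc i)} s \<le> e\<^sup>2 * indicator {grid k i<..grid k (Suc i)} s"
          proof (cases "s \<in> {grid k i<..grid k (Suc i)}")
            case True
            have gi: "grid k i \<in> {0..T}" using i by (intro grid_mem) auto
            have "\<xi> k i \<omega> = deriv f (X (grid k i) \<omega>)"
              unfolding \<xi>_def using elim(1) gi by (intro clip_eq) blast
            moreover have "dist (grid k i) s < d" using True elim(2) grid_Suc[of k i] by (auto simp: dist_real_def)
            then have "dist (deriv f (X (grid k i) \<omega>)) (deriv f (X s \<omega>)) < e"
              by (intro d(2) gi) (use s in auto)
            ultimately have "\<bar>\<zeta> i \<omega>\<bar>\<^sup>2 \<le> e\<^sup>2" unfolding \<zeta>_def by (intro power_mono) (auto simp: dist_real_def)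
            then show ?thesis using True by simp
          qed simp
        qed
        also have "\<dots> = e\<^sup>2" unfolding sum_distrib_left[symmetric] ind by simp
        finally show ?thesis .
      qed
      show "AE s in lborel. ennreal ((simple_process (gn k) (grid k) (\<xi> k) s \<omega> - deriv f (X s \<omega>))\<^sup>2) * indicator {0..T} s
        \<le> ennreal (e\<^sup>2) * indicator {0..T} s"
        using AE_lborel_singleton[of 0]
      proof eventually_elim
        case (elim s)
        then show ?case using le[of s] by (auto simp: indicator_def intro!: ennreal_leI)
      qed
    qed
    also have "\<dots> = ennreal (e\<^sup>2) * ennreal T" using T_pos by (simp add: nn_integral_cmult_indicator)
    also have "\<dots> = ennreal \<epsilon>" using e T_pos by (simp add: ennreal_mult[symmetric])
    finally show ?case .
  qed
qed

lemma J_eq: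
  assumes "\<omega> \<in> space M" "t \<in> {0..T}"
  shows "J t \<omega> = f (X t \<omega>) - f x0 - integral {0..t} (\<lambda>s. L1 f (X s \<omega>))"
  unfolding J_def using assms
  by (subst set_integral_continuous)
     (auto intro!: continuous_on_compose2[OF f_continuous(3) continuous_on_subset[OF X_continuous]])

text \<open>Applies \<open>pathwise_ito\<close> on almost every path. The quadratic variation result
  with coefficients 1 bounds the sums of squared increments, and with the clipped values of
  \<open>L1 f\<close> it supplies the vanishing second-order sum; on a given path the clipping is
  eventually inactive.\<close>

lemma \<xi>_integral_tendsto:
  assumes t: "t \<in> {0..T}"
  shows "AE \<omega> in N. (\<lambda>k. simple_integral W (gn k) (grid k) (\<xi> k) t \<omega>) \<longlonglongrightarrow> J t \<omega>"
proof -
  let ?s = "tgrid t"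
  have mem: "?s k i \<in> {0..T}" if "i \<le> gn k" for k i using tgrid(5)[OF t that] t by auto
  have "AE \<omega> in N. (\<lambda>k. \<Sum>i<gn k. 1 * ((W (?s k (Suc i)) \<omega> - W (?s k i) \<omega>)\<^sup>2 - (?s k (Suc i) - ?s k i))) \<longlonglongrightarrow> 0"
    by (rule quadratic_variation_AE[OF t]) auto
  moreover have "AE \<omega> in N. (\<lambda>k. \<Sum>i<gn k. clip (real (Suc k)) (L1 f (X (?s k i) \<omega>)) * ((W (?s k (Suc i)) \<omega> - W (?s k i) \<omega>)\<^sup>2 - (?s k (Suc i) - ?s k i))) \<longlonglongrightarrow> 0"
  proof (rule quadratic_variation_AE[OF t])
    fix k i assume i: "i < gn k"
    have [measurable]: "X (?s k i) \<in> borel_measurable (F (?s k i))" using i by (intro X_adapted mem) auto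
    have [measurable]: "L1 f \<in> borel_measurable borel" by (rule borel_measurable_continuous_onI[OF f_continuous(3)])
    show "(\<lambda>\<omega>. clip (real (Suc k)) (L1 f (X (?s k i) \<omega>))) \<in> borel_measurable (F (?s k i))" by measurable
  qed (simp add: clip_bound)
  moreover have "AE \<omega> in N. X 0 \<omega> = x0" by (rule AE_completion[OF X_0])
  ultimately show ?thesis using AE_space
  proof eventually_elim
    case (elim \<omega>)
    then have \<omega>: "\<omega> \<in> space M" by simp
    have sub: "{0..t} \<subseteq> {0..T}" using t by auto
    have tele: "(\<Sum>i<gn k. ?s k (Suc i) - ?s k i) = t" for k
      unfolding sum_lessThan_telescope using tgrid(1,2)[OF t] by simp
    have "(\<lambda>k. (\<Sum>i<gn k. (W (?s k (Suc i)) \<omega> - W (?s k i) \<omega>)\<^sup>2) - t) \<longlonglongrightarrow> 0"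
    proof -
      have "(\<Sum>i<gn k. 1 * ((W (?s k (Suc i)) \<omega> - W (?s k i) \<omega>)\<^sup>2 - (?s k (Suc i) - ?s k i)))
        = (\<Sum>i<gn k. (W (?s k (Suc i)) \<omega> - W (?s k i) \<omega>)\<^sup>2) - (\<Sum>i<gn k. ?s k (Suc i) - ?s k i)" for k
        unfolding mult_1 by (rule sum_subtractf)
      then show ?thesis using elim(1) unfolding tele by (simp only:)
    qed
    then have "(\<lambda>k. (\<Sum>i<gn k. (W (?s k (Suc i)) \<omega> - W (?s k i) \<omega>)\<^sup>2)) \<longlonglongrightarrow> t"
      by (simp add: LIM_zero_iff)
    then have "Bseq (\<lambda>k. (\<Sum>i<gn k. (W (?s k (Suc i)) \<omega> - W (?s k i) \<omega>)\<^sup>2))"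
      by (intro convergent_imp_Bseq convergentI)
    then obtain V where V: "\<And>k. norm (\<Sum>i<gn k. (W (?s k (Suc i)) \<omega> - W (?s k i) \<omega>)\<^sup>2) \<le> V"
      unfolding Bseq_def by blast
    have "(\<lambda>k. \<Sum>i<gn k. deriv f (X (?s k i) \<omega>) * (W (?s k (Suc i)) \<omega> - W (?s k i) \<omega>))
      \<longlonglongrightarrow> f (X t \<omega>) - f (X 0 \<omega>) - integral {0..t} (\<lambda>s. deriv (deriv f) (X s \<omega>) / 2)"
    proof (rule pathwise_ito[where f=f and f'="deriv f" and f''="deriv (deriv f)" and w="\<lambda>s. W s \<omega>" and l="\<lambda>s. L s \<omega>"
          and x="\<lambda>s. X s \<omega>" and c=x0 and V=V and N="\<lambda>k. gn k" and \<sigma>="?s"])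
      show "continuous_on {0..t} (\<lambda>s. W s \<omega>)" "continuous_on {0..t} (\<lambda>s. L s \<omega>)"
        using continuous_on_subset[OF W_continuous[OF \<omega>] sub] continuous_on_subset[OF L_continuous[OF \<omega>] sub] by auto
      show "L a \<omega> \<le> L b \<omega>" if "0 \<le> a" "a \<le> b" "b \<le> t" for a b
        unfolding L_def using that t by (intro reg_mono[OF W_continuous[OF \<omega>]]) auto
      show "\<exists>u\<in>{a..b}. X u \<omega> = 0" if "0 \<le> a" "a \<le> b" "b \<le> t" "L a \<omega> < L b \<omega>" for a b
        using that t unfolding X_def L_def by (intro reg_flat_off_zeros[OF W_continuous[OF \<omega>]]) auto
      show "\<forall>\<^sub>F k in sequentially. \<forall>i<gn k. ?s k (Suc i) - ?s k i < d" if d: "0 < d" for d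
        using grid_mesh[OF d] by eventually_elim (use tgrid(4)[OF t] in \<open>auto intro: le_less_trans\<close>)
      show "(\<Sum>i<gn k. (W (?s k (Suc i)) \<omega> - W (?s k i) \<omega>)\<^sup>2) \<le> V" for k
        using V[of k] unfolding real_norm_def by (rule abs_le_D1)
      have "\<forall>\<^sub>F k in sequentially. (\<Sum>i<gn k. clip (real (Suc k)) (L1 f (X (?s k i) \<omega>)) * ((W (?s k (Suc i)) \<omega> - W (?s k i) \<omega>)\<^sup>2 - (?s k (Suc i) - ?s k i)))
        = (\<Sum>i<gn k. deriv (deriv f) (X (?s k i) \<omega>) / 2 * ((W (?s k (Suc i)) \<omega> - W (?s k i) \<omega>)\<^sup>2 - (?s k (Suc i) - ?s k i)))"
        using path_bounded[OF f_continuous(3) \<omega>]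
      proof eventually_elim
        case (elim k)
        show ?case
        proof (rule sum.cong)
          fix i assume "i \<in> {..<gn k}"
          then have "\<bar>L1 f (X (?s k i) \<omega>)\<bar> \<le> real (Suc k)" using elim mem[of i k] by simp
          then show "clip (real (Suc k)) (L1 f (X (?s k i) \<omega>)) * ((W (?s k (Suc i)) \<omega> - W (?s k i) \<omega>)\<^sup>2 - (?s k (Suc i) - ?s k i))
            = deriv (deriv f) (X (?s k i) \<omega>) / 2 * ((W (?s k (Suc i)) \<omega> - W (?s k i) \<omega>)\<^sup>2 - (?s k (Suc i) - ?s k i))"
            by (simp only: clip_eq) (simp add: L1_def)
        qed simp
      qed
      then show "(\<lambda>k. \<Sum>i<gn k. deriv (deriv f) (X (?s k i) \<omega>) / 2 * ((W (?s k (Suc i)) \<omega> - W (?s k i) \<omega>)\<^sup>2 - (?s k (Suc i) - ?s k i))) \<longlonglongrightarrow> 0"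
        by (rule Lim_transform_eventually[OF elim(2)])
    qed (use f_deriv f_deriv2_continuous f_deriv_0 tgrid(1-3)[OF t] in \<open>auto simp: X_def\<close>)
    also have "f (X t \<omega>) - f (X 0 \<omega>) - integral {0..t} (\<lambda>s. deriv (deriv f) (X s \<omega>) / 2) = J t \<omega>"
      unfolding J_eq[OF \<omega> t] elim(3) L1_def ..
    finally have lim: "(\<lambda>k. \<Sum>i<gn k. deriv f (X (?s k i) \<omega>) * (W (?s k (Suc i)) \<omega> - W (?s k i) \<omega>)) \<longlonglongrightarrow> J t \<omega>" .
    have "\<forall>\<^sub>F k in sequentially. (\<Sum>i<gn k. deriv f (X (?s k i) \<omega>) * (W (?s k (Suc i)) \<omega> - W (?s k i) \<omega>)) = simple_integral W (gn k) (grid k) (\<xi> k) t \<omega>"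
      using path_bounded[OF f_continuous(2) \<omega>]
    proof eventually_elim
      case (elim k)
      show ?case unfolding simple_integral_def
      proof (rule sum.cong)
        fix i assume "i \<in> {..<gn k}"
        then have "grid k i \<in> {0..T}" by (intro grid_mem) simp
        then have "\<xi> k i \<omega> = deriv f (X (grid k i) \<omega>)" unfolding \<xi>_def using elim by (intro clip_eq) blast
        \<comment> \<open>Past t the two sides evaluate \<open>deriv f\<close> at different times,
          but both increments are 0.\<close>
        then show "deriv f (X (?s k i) \<omega>) * (W (?s k (Suc i)) \<omega> - W (?s k i) \<omega>) = \<xi> k i \<omega> * (W (min (grid k (Suc i)) t) \<omega> - W (min (grid k i) t) \<omega>)"
          using grid_le[of k i] by (cases "grid k i \<le> t") (auto simp: tgrid_def min_def)
      qed simp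
    qed
    then show ?case by (rule Lim_transform_eventually[OF lim])
  qed
qed

lemma J_adapted: "t \<in> {0..T} \<Longrightarrow> J t \<in> borel_measurable (F t)"
proof -
  assume t: "t \<in> {0..T}"
  have [measurable]: "(\<lambda>\<omega>. LINT s:{0..t}|lborel. L1 f (X s \<omega>)) \<in> borel_measurable (F t)"
    by (rule progressively_measurable_integral[OF X_progressive[OF f_continuous(3)] t])
  have [measurable]: "X t \<in> borel_measurable (F t)" by (rule X_adapted[OF t])
  have [measurable]: "f \<in> borel_measurable borel" by (rule borel_measurable_continuous_onI[OF f_continuous(1)])
  show ?thesis unfolding J_def[abs_def] by measurable
qed

text \<open>Both required limits hold almost surely, the first even on every path, and almost sure
  convergence implies convergence in probability.\<close>

lemma reflected_ito: "ito_integral M F T W (\<lambda>t \<omega>. deriv f (X t \<omega>)) J"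
  unfolding ito_integral_def
proof (intro conjI exI[of _ "\<lambda>k. gn k"] exI[of _ grid] exI[of _ \<xi>] allI ballI impI)
  let ?D = "\<lambda>k \<omega>. \<integral>\<^sup>+s\<in>{0..T}. ennreal ((simple_process (gn k) (grid k) (\<xi> k) s \<omega> - deriv f (X s \<omega>))\<^sup>2) \<partial>lborel"
  show P: "progressively_measurable F T (\<lambda>t \<omega>. deriv f (X t \<omega>))" by (rule X_progressive[OF f_continuous(2)])
  show "adapted_process F T J" unfolding adapted_process_def using J_adapted by blast
  show "AE \<omega> in M. continuous_on {0..T} (\<lambda>t. J t \<omega>)"
  proof (rule AE_I2)
    fix \<omega> assume \<omega>: "\<omega> \<in> space M"
    have "continuous_on {0..T} (\<lambda>t. integral {0..t} (\<lambda>s. L1 f (X s \<omega>)))"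
      by (intro indefinite_integral_continuous_1 integrable_continuous_real continuous_on_compose2[OF f_continuous(3) X_continuous[OF \<omega>]]) auto
    then have "continuous_on {0..T} (\<lambda>t. f (X t \<omega>) - f x0 - integral {0..t} (\<lambda>s. L1 f (X s \<omega>)))"
      by (intro continuous_intros continuous_on_compose2[OF f_continuous(1) X_continuous[OF \<omega>]]) auto
    then show "continuous_on {0..T} (\<lambda>t. J t \<omega>)"
      using J_eq[OF \<omega>] by (subst continuous_on_cong[OF refl]) auto
  qed
  show "simple_process_data M F T (gn k) (grid k) (\<xi> k)" for k by (rule \<xi>_data)
  show "(\<lambda>k. measure N {\<omega>\<in>space M. ennreal \<epsilon> < ?D k \<omega>}) \<longlonglongrightarrow> 0"
    if \<epsilon>: "0 < \<epsilon>" for \<epsilon>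
  proof (rule N.measure_tendsto_0_AE)
    fix k
    have "(\<lambda>x. simple_process (gn k) (grid k) (\<xi> k) (fst x) (snd x) - deriv f (X (fst x) (snd x))) \<in> borel_measurable (restrict_space borel {0..T} \<Otimes>\<^sub>M N)"
      using simple_process_measurable[OF \<xi>_data[of k]] progressively_measurable_N[OF P] unfolding split_beta' by (rule borel_measurable_diff)
    then have [measurable]: "(\<lambda>\<omega>. ?D k \<omega>) \<in> borel_measurable N"
      by (intro square_integral_measurable) (simp add: split_beta')
    show "{\<omega>\<in>space M. ennreal \<epsilon> < ?D k \<omega>} \<in> sets N"
      unfolding space_completion[of M, symmetric] by measurable
  next
    show "AE \<omega> in N. \<forall>\<^sub>F k in sequentially. \<omega> \<notin> {\<omega>\<in>space M. ennreal \<epsilon> < ?D k \<omega>}"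
    proof (rule AE_I2)
      fix \<omega> assume "\<omega> \<in> space N"
      then have "\<omega> \<in> space M" by simp
      from \<xi>_approx[OF this \<epsilon>] show "\<forall>\<^sub>F k in sequentially. \<omega> \<notin> {\<omega>\<in>space M. ennreal \<epsilon> < ?D k \<omega>}"
        by eventually_elim (simp add: not_less)
    qed
  qed
  show "(\<lambda>k. measure N {\<omega>\<in>space M. \<epsilon> < \<bar>simple_integral W (gn k) (grid k) (\<xi> k) t \<omega> - J t \<omega>\<bar>}) \<longlonglongrightarrow> 0"
    if t: "t \<in> {0..T}" and \<epsilon>: "0 < \<epsilon>" for t \<epsilon>
  proof (rule N.measure_tendsto_0_AE)
    fix k
    note [measurable] = simple_integral_measurable[OF \<xi>_data[of k] t] measurable_F_N[OF J_adapted[OF t]]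
    show "{\<omega>\<in>space M. \<epsilon> < \<bar>simple_integral W (gn k) (grid k) (\<xi> k) t \<omega> - J t \<omega>\<bar>} \<in> sets N"
      unfolding space_completion[of M, symmetric] by measurable
  next
    show "AE \<omega> in N. \<forall>\<^sub>F k in sequentially. \<omega> \<notin> {\<omega>\<in>space M. \<epsilon> < \<bar>simple_integral W (gn k) (grid k) (\<xi> k) t \<omega> - J t \<omega>\<bar>}"
      using \<xi>_integral_tendsto[OF t]
    proof eventually_elim
      case (elim \<omega>)
      then have "\<forall>\<^sub>F k in sequentially. dist (simple_integral W (gn k) (grid k) (\<xi> k) t \<omega>) (J t \<omega>) < \<epsilon>"
        using \<epsilon> by (rule tendstoD)
      then show ?case by eventually_elim (simp add: dist_real_def)
    qed
  qed
qed

end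

lemma X_strong_MP_solution: "strong_MP_solution M T W x0 X"
  unfolding strong_MP_solution_def
proof (intro conjI ballI)
  show "continuous_paths M T X" unfolding continuous_paths_def using X_continuous by blast
  show "nonneg_process M T X" unfolding nonneg_process_def using X_nonneg by blast
  show "adapted_process F T X" unfolding adapted_process_def using X_adapted by blast
  show "AE \<omega> in M. X 0 \<omega> = x0" by (rule X_0)
  fix f assume "f \<in> D_L1_Rplus"
  then obtain g where g: "g \<in> D_L1" "f = restrict g {0..}" unfolding D_L1_Rplus_def by auto
  show "ito_integral M F T W (\<lambda>t \<omega>. deriv_Rplus f (X t \<omega>))
          (\<lambda>t \<omega>. f (X t \<omega>) - f x0 - (LINT s:{0..t}|lborel. L1_Rplus f (X s \<omega>)))"
  proof (rule ito_integral_cong[OF reflected_ito[OF g(1)]])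
    fix t \<omega> assume t: "t \<in> {0..T}" and \<omega>: "\<omega> \<in> space M"
    show "deriv g (X t \<omega>) = deriv_Rplus f (X t \<omega>)"
      unfolding g(2) using deriv_Rplus_restrict[OF g(1) X_nonneg[OF t \<omega>]] by simp
    have "(LINT s:{0..t}|lborel. L1_Rplus f (X s \<omega>)) = (LINT s:{0..t}|lborel. L1 g (X s \<omega>))"
      using L1_Rplus_restrict[OF g(1)] X_nonneg[OF _ \<omega>] t unfolding g(2)
      by (intro set_lebesgue_integral_cong) auto
    then show "J g t \<omega> = f (X t \<omega>) - f x0 - (LINT s:{0..t}|lborel. L1_Rplus f (X s \<omega>))"
      using X_nonneg[OF t \<omega>] x0 by (simp add: J_def[OF g(1)] g(2))
  qed simp
qed

lemma X_BES1: "is_BES1 M T W x0 X"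
proof -
  define q :: "real \<Rightarrow> real" where "q = (\<lambda>x. x\<^sup>2)"
  have d1: "(q has_real_derivative 2 * x) (at x)" for x
    unfolding q_def by (auto intro!: derivative_eq_intros)
  have dq: "deriv q = (\<lambda>x. 2 * x)" using DERIV_imp_deriv[OF d1] by auto
  have d2: "(deriv q has_real_derivative 2) (at x)" for x
    unfolding dq by (auto intro!: derivative_eq_intros)
  have ddq: "deriv (deriv q) = (\<lambda>x. 2)" using DERIV_imp_deriv[OF d2] by auto
  have q: "q \<in> D_L1"
    unfolding D_L1_def
  proof (intro CollectI conjI allI)
    show "q differentiable (at x)" "deriv q differentiable (at x)" for x
      using d1 d2 unfolding real_differentiable_def by blast+
  qed (simp_all add: dq ddq)
  have ito: "ito_integral M F T W (\<lambda>t \<omega>. 2 * sqrt \<bar>(X t \<omega>)\<^sup>2\<bar>) (\<lambda>t \<omega>. (X t \<omega>)\<^sup>2 - x0\<^sup>2 - t)"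
  proof (rule ito_integral_cong[OF reflected_ito[OF q]])
    fix t \<omega> assume t: "t \<in> {0..T}" and \<omega>: "\<omega> \<in> space M"
    show "deriv q (X t \<omega>) = 2 * sqrt \<bar>(X t \<omega>)\<^sup>2\<bar>" using X_nonneg[OF t \<omega>] by (simp add: dq)
    show "J q t \<omega> = (X t \<omega>)\<^sup>2 - x0\<^sup>2 - t"
      using t unfolding J_eq[OF q \<omega> t] L1_def ddq by (simp add: q_def)
  qed simp
  show ?thesis
    unfolding is_BES1_def is_BESQ1_def
  proof (intro conjI ito BM)
    show "nonneg_process M T X" unfolding nonneg_process_def using X_nonneg by blast
    show "continuous_paths M T (\<lambda>t \<omega>. (X t \<omega>)\<^sup>2)"
      unfolding continuous_paths_def using X_continuous by (auto intro!: continuous_intros)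
    show "adapted_process F T (\<lambda>t \<omega>. (X t \<omega>)\<^sup>2)"
      unfolding adapted_process_def using X_adapted by (auto intro!: borel_measurable_power)
    show "AE \<omega> in M. (X 0 \<omega>)\<^sup>2 = x0\<^sup>2" using X_0 by eventually_elim simp
  qed (auto simp: nonneg_process_def)
qed

end

theorem proposition3p24:
  fixes M :: "'a measure" and T x0 :: real and W :: "real \<Rightarrow> 'a \<Rightarrow> real"
  assumes "prob_space M"
    and "0 < T"
    and "brownian_motion M T W"
    and "0 \<le> x0"
  shows "(\<exists>X. is_BES1 M T W x0 X \<and> strong_MP_solution M T W x0 X) \<and>
    (\<forall>X1 X2 x1 x2. 0 \<le> x1 \<longrightarrow> 0 \<le> x2 \<longrightarrow>
       strong_MP_solution M T W x1 X1 \<longrightarrow> strong_MP_solution M T W x2 X2 \<longrightarrow>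
       (AE \<omega> in M. X1 0 \<omega> = X2 0 \<omega>) \<longrightarrow> indistinguishable M T X1 X2)"
proof (intro conjI)
  interpret reflected M T W x0 using assms by unfold_locales
  show "\<exists>X. is_BES1 M T W x0 X \<and> strong_MP_solution M T W x0 X"
    using X_BES1 X_strong_MP_solution by blast
  show "\<forall>X1 X2 x1 x2. 0 \<le> x1 \<longrightarrow> 0 \<le> x2 \<longrightarrow>
       strong_MP_solution M T W x1 X1 \<longrightarrow> strong_MP_solution M T W x2 X2 \<longrightarrow>
       (AE \<omega> in M. X1 0 \<omega> = X2 0 \<omega>) \<longrightarrow> indistinguishable M T X1 X2"
    using strong_MP_solution_unique[OF assms(3,2)] by blast
qed

end
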